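(* Let $1\le p,q<\infty$, and let $(V_k : k\in\mathbb{N}_0)$ denote either $$\bigl(H_k^p(H_k^q) : k\in\mathbb{N}_0\bigr)\qquad\text{or}\qquad \bigl((H_k^p(H_k^q))^* : k\in\mathbb{N}_0\bigr).$$ Let $n\in\mathbb{N}_0$ and $\delta,\Gamma,\eta>0$. Define the integer $N=N(n,\delta,\Gamma,\eta)$ by $$N = 41(n+3) + \bigl\lfloor 4\log_2(\Gamma/\delta) + 4\log_2\bigl(1+\eta^{-1}\bigr)\bigr\rfloor .$$ Then for any linear operator $T : V_N\to V_N$ satisfying $$\|T\|\le \Gamma\qquad\text{and}\qquad |\langle T h_Q, h_Q\rangle| \ge \delta |Q|\quad\text{for all } Q\in\mathcal{D}_{\le N}\otimes\mathcal{D}_{\le N},$$ there exist bounded linear operators $E : V_n\to V_N$ and $F : V_N\to V_n$ such that $$F\,T\,E = \mathrm{Id}_{V_n}\qquad\text{and}\qquad \|E\|\,\|F\|\le \frac{1+\eta}{\delta}.$$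
   Context: All spaces are real. $\mathcal{D}=\{[(k-1)2^{-n},k2^{-n}) : n\in\mathbb{N}_0,\ 1\le k\le 2^n\}$ is the set of dyadic intervals in $[0,1)$; $|\cdot|$ is Lebesgue measure (on $[0,1)$ or $[0,1)^2$); $\mathcal{D}_N=\{I\in\mathcal{D}:|I|=2^{-N}\}$ and $\mathcal{D}_{\le N}=\bigcup_{n=0}^N\mathcal{D}_n$. For $\mathcal{A},\mathcal{B}\subset\mathcal{D}$, $\mathcal{A}\otimes\mathcal{B}=\{I\times J: I\in\mathcal{A},\ J\in\mathcal{B}\}$. For $I\in\mathcal{D}$, $I^+$ and $I^-$ denote the left and right dyadic halves of $I$, and $h_I=\chi_{I^+}-\chi_{I^-}$ is the $L^\infty$-normalized Haar function. The bi-parameter Haar functions are $h_{I\times J}(x,y)=h_I(x)h_J(y)$, $I,J\in\mathcal{D}$. For $1\le p,q<\infty$, the bi-parameter dyadic Hardy space $H^p(H^q)$ is the completion of $\mathrm{span}\{h_R: R\in\mathcal{D}\otimes\mathcal{D}\}$ under the norm $$\Bigl\|\sum_R a_R h_R\Bigr\|_{H^p(H^q)}=\biggl(\int_0^1\Bigl(\int_0^1\bigl(\sum_{R}|a_R|^2h_R^2(x,y)\bigr)^{q/2}\,dy\Bigr)^{p/q}dx\biggr)^{1/p},$$ and for $n\in\mathbb{N}_0$, $H_n^p(H_n^q)=\mathrm{span}\{h_R: R\in\mathcal{D}_{\le n}\otimes\mathcal{D}_{\le n}\}\subset H^p(H^q)$ with the inherited norm. $\langle f,g\rangle=\int_0^1\int_0^1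 f(x,y)g(x,y)\,dx\,dy$ is the standard bilinear form. Via this form, the dual space $(H_k^p(H_k^q))^*$ is identified with $\mathrm{span}\{h_R:R\in\mathcal{D}_{\le k}\otimes\mathcal{D}_{\le k}\}$, equipped with the dual norm $\|f\|=\sup\{|\langle f,g\rangle| : g\in H_k^p(H_k^q),\ \|g\|_{H^p(H^q)}\le 1\}$; in particular Haar functions are regarded as elements of both spaces. $\|T\|,\|E\|,\|F\|$ are operator norms. The spaces $V_k$ are defined only for $k\in\mathbb{N}_0$, so the statement concerns parameters for which $N\ge 0$. *)

theory Defs
  imports "HOL-Analysis.Analysis" "HOL-Library.Function_Algebras"
begin

text \<open>
  Functions are added and scaled pointwise; with the instance below, the library's
  \<^const>\<open>span\<close> and \<^const>\<open>representation\<close> are available for spaces of functions.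
\<close>

instantiation "fun" :: (type, real_vector) real_vector
begin

definition scaleR_fun :: "real \<Rightarrow> ('a \<Rightarrow> 'b) \<Rightarrow> 'a \<Rightarrow> 'b"
  where "scaleR_fun c f = (\<lambda>x. c *\<^sub>R f x)"

instance
  by standard (auto simp: scaleR_fun_def fun_eq_iff scaleR_right_distrib scaleR_left_distrib)

end

definition dyadic :: "real set set" where
  "dyadic = {{(real k - 1) / 2 ^ n ..< real k / 2 ^ n} | n k :: nat. 1 \<le> k \<and> k \<le> 2 ^ n}"

definition dyadic_level :: "nat \<Rightarrow> real set set" where
  "dyadic_level n = {I \<in> dyadic. measure lborel I = 1 / 2 ^ n}"

definition dyadic_upto :: "nat \<Rightarrow> real set set" where
  "dyadic_upto N = (\<Union>n\<le>N. dyadic_level n)"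

definition left_half :: "real set \<Rightarrow> real set" where
  "left_half I = {Inf I ..< (Inf I + Sup I) / 2}"

definition right_half :: "real set \<Rightarrow> real set" where
  "right_half I = {(Inf I + Sup I) / 2 ..< Sup I}"

definition haar :: "real set \<Rightarrow> real \<Rightarrow> real" where
  "haar I x = indicator (left_half I) x - indicator (right_half I) x"

text \<open>
  The dyadic rectangle \<open>I \<times> J\<close> is represented by the pair \<open>(I, J)\<close>, so
  \<open>\<A> \<otimes> \<B>\<close> becomes \<open>\<A> \<times> \<B>\<close>; dyadic intervals are nonempty, so pairs and
  rectangles correspond bijectively.
\<close>

type_synonym rect = "real set \<times> real set"

definition rect_area :: "rect \<Rightarrow> real" where
  "rect_area R = measure lborel (fst R \<times> snd R)"

definition haar2 :: "rect \<Rightarrow> real \<times> real \<Rightarrow> real" where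
  "haar2 R z = haar (fst R) (fst z) * haar (snd R) (snd z)"

definition haar_space :: "nat \<Rightarrow> (real \<times> real \<Rightarrow> real) set" where
  "haar_space n = span (haar2 ` (dyadic_upto n \<times> dyadic_upto n))"

text \<open>
  The coefficient \<open>a\<^sub>R\<close> in the expansion of \<open>f\<close>, an element of the linear span of
  the (linearly independent) bi-parameter Haar functions. Only finitely many coefficients are
  nonzero.
\<close>

definition haar_coeff :: "(real \<times> real \<Rightarrow> real) \<Rightarrow> rect \<Rightarrow> real" where
  "haar_coeff f R = representation (haar2 ` (dyadic \<times> dyadic)) f (haar2 R)"

definition square_sum :: "(real \<times> real \<Rightarrow> real) \<Rightarrow> real \<times> real \<Rightarrow> real" where
  "square_sum f z =
     (\<Sum>R \<in> {R \<in> dyadic \<times> dyadic. haar_coeff f R \<noteq> 0}. \<bar>haar_coeff f R\<bar>\<^sup>2 * (haar2 R z)\<^sup>2)"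

definition hardy_norm :: "real \<Rightarrow> real \<Rightarrow> (real \<times> real \<Rightarrow> real) \<Rightarrow> real" where
  "hardy_norm p q f =
     (LINT x:{0..<1}|lborel.
        (LINT y:{0..<1}|lborel. square_sum f (x, y) powr (q / 2)) powr (p / q)) powr (1 / p)"

definition pairing :: "(real \<times> real \<Rightarrow> real) \<Rightarrow> (real \<times> real \<Rightarrow> real) \<Rightarrow> real" where
  "pairing f g = (LINT y:{0..<1}|lborel. LINT x:{0..<1}|lborel. f (x, y) * g (x, y))"

text \<open>
  The next two suprema are taken over sets that are nonempty and, \<open>haar_space k\<close> being
  finite-dimensional, bounded above for \<open>f \<in> haar_space k\<close> and linear \<open>T\<close>.
\<close>

definition hardy_dual_norm ::
    "real \<Rightarrow> real \<Rightarrow> nat \<Rightarrow> (real \<times> real \<Rightarrow> real) \<Rightarrow> real" where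
  "hardy_dual_norm p q k f =
     Sup {\<bar>pairing f g\<bar> | g. g \<in> haar_space k \<and> hardy_norm p q g \<le> 1}"

definition op_norm ::
    "'a set \<Rightarrow> ('a \<Rightarrow> real) \<Rightarrow> ('b \<Rightarrow> real) \<Rightarrow> ('a \<Rightarrow> 'b) \<Rightarrow> real" where
  "op_norm U normU normW T = Sup {normW (T f) | f. f \<in> U \<and> normU f \<le> 1}"

definition linear_between ::
    "'a::real_vector set \<Rightarrow> 'b::real_vector set \<Rightarrow> ('a \<Rightarrow> 'b) \<Rightarrow> bool" where
  "linear_between U W T \<longleftrightarrow>
     (\<forall>f\<in>U. T f \<in> W) \<and>
     (\<forall>f\<in>U. \<forall>g\<in>U. T (f + g) = T f + T g) \<and>
     (\<forall>c. \<forall>f\<in>U. T (c *\<^sub>R f) = c *\<^sub>R T f)"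

definition bounded_between ::
    "'a set \<Rightarrow> ('a \<Rightarrow> real) \<Rightarrow> ('b \<Rightarrow> real) \<Rightarrow> ('a \<Rightarrow> 'b) \<Rightarrow> bool" where
  "bounded_between U normU normW T \<longleftrightarrow> (\<exists>C. \<forall>f\<in>U. normW (T f) \<le> C * normU f)"

end

theory Submission
  imports Defs
begin

text \<open>
  Fix \<open>m = N - n\<close> and place one copy of the coarse Haar system in each dyadic interval of length
  \<open>2\<^sup>-\<^sup>m\<close>. With independent random signs \<open>\<theta>, \<epsilon>\<close> put \<open>b\<^sub>I = \<Sum>\<^sub>A \<theta>\<^sub>A\<^sub>I h\<^sub>A\<^sub>I\<close>, where \<open>AI\<close> is the copy of \<open>I\<close> in \<open>A\<close>, and
  let \<open>b\<^sub>R = b\<^sub>I \<otimes> b\<^sub>J\<close> for \<open>R = I \<times> J\<close>. The square function does not see signs, so \<open>h\<^sub>R \<mapsto> b\<^sub>R\<close> is a contraction, and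
  the averaging map \<open>f \<mapsto> \<Sum>\<^sub>R \<langle>f, b\<^sub>R\<rangle> / |R| h\<^sub>R\<close> is one too, by Minkowski and Jensen; the two maps are
  adjoint to each other, which gives the same for the dual norms.

  Apart from the diagonal, \<open>\<langle>T b\<^sub>R, b\<^sub>S\<rangle>\<close> is a chaos of order at most two in each family of signs. Its
  second moment is \<open>O(\<Gamma>\<^sup>2 2\<^sup>-\<^sup>m\<^sup>/\<^sup>2)\<close>: for a matrix on \<open>M\<close> points with entries at most \<open>\<Gamma>/M\<close>, row sums at most
  \<open>\<Gamma> M\<^sup>-\<^sup>\<alpha>\<close> and column sums at most \<open>\<Gamma> M\<^sup>-\<^sup>(\<^sup>1\<^sup>-\<^sup>\<alpha>\<^sup>)\<close>, the better of the two sums gives \<open>M\<^sup>-\<^sup>1\<^sup>/\<^sup>2\<close> for the sum of squares.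
  Hence for some choice of signs the compressed operator is a small perturbation of a diagonal
  operator with entries at least \<open>\<delta>\<close>, and a Neumann series inverts it.
\<close>

section \<open>Power means\<close>

text \<open>The obstacle in two parameters is that removing the diagonal leaves terms in which the
  signs of one variable cancel and those of the other do not. Their coefficients are not entries of
  T but partial traces, sums of M = 2^m entries, and they form a matrix on M points only. This is
  why the second moment decays like M^(-1/2) and not like 1/M. The diagonal entries of T may have
  either sign and could cancel when summed over the copies. Therefore the input signs are multiplied
  by the signs of these entries, while the output signs are not. Origin of N: there are at most
  2^(4n+4) pairs (R, S), each of second moment at most 24 \<Gamma>^2 2^(-m/2), so some choice of
  signs makes every entry of the perturbation at most 2^(2n+5) \<Gamma> 2^(-m/4). Passing to the
  operator norm costs 2^(8n+4) / \<delta>. A Neumann series of norm at most 1 + \<eta> thus needs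
  2^(10n+9) (\<Gamma>/\<delta>) (1 + 1/\<eta>) <= 2^(m/4), and taking logarithms gives 40n + 36 plus
  four times the two logarithms as a lower bound for m. Adding n yields the coefficient 41 of
  n.\<close>

lemma powr_convex_nonneg:
  assumes "p \<ge> 1"
  shows "convex_on {0..} (\<lambda>x::real. x powr p)"
proof (rule convex_onI)
  fix t x y :: real
  assume t: "0 < t" "t < 1" and xy: "x \<in> {0..}" "y \<in> {0..}"
  \<comment> \<open>If x or y is 0, convexity reduces to \<open>s powr p \<le> s\<close> on [0, 1];
    the interior is the usual convexity of the power function.\<close>
  have shrink: "(s * z) powr p \<le> s * z powr p" if "0 \<le> s" "s \<le> 1" "0 \<le> z" for s z :: real
  proof -
    have "s powr p \<le> s"
      using that assms powr_mono'[of 1 p s] by simp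
    then show ?thesis
      using that by (simp add: powr_mult mult_right_mono)
  qed
  show "((1 - t) *\<^sub>R x + t *\<^sub>R y) powr p \<le> (1 - t) * x powr p + t * y powr p"
  proof (cases "x = 0 \<or> y = 0")
    case True
    then show ?thesis
      using shrink[of t y] shrink[of "1 - t" x] t xy by auto
  next
    case False
    then have "x \<in> {0<..}" "y \<in> {0<..}"
      using xy by auto
    then show ?thesis
      using convex_onD[OF powr_convex[OF assms], of t x y] t by simp
  qed
qed (rule convex_real_interval)

text \<open>The L^p norm for the uniform probability measure on S. With this normalisation constants
  keep their value and Jensen's inequality carries no factor.\<close>

definition pmean :: "real \<Rightarrow> 'a set \<Rightarrow> ('a \<Rightarrow> real) \<Rightarrow> real" where
  "pmean p S f = ((\<Sum>i\<in>S. f i powr p) / card S) powr (1 / p)"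

lemma pmean_nonneg [simp]: "0 \<le> pmean p S f"
  by (simp add: pmean_def)

lemma pmean_cong: "(\<And>i. i \<in> S \<Longrightarrow> f i = g i) \<Longrightarrow> pmean p S f = pmean p S g"
  unfolding pmean_def by (metis (mono_tags, lifting) sum.cong)

lemma pmean_powr: "p \<ge> 1 \<Longrightarrow> pmean p S f powr p = (\<Sum>i\<in>S. f i powr p) / card S"
  by (simp add: pmean_def powr_powr sum_nonneg)

lemma pmean_mono:
  assumes "p \<ge> 1" "\<And>i. i \<in> S \<Longrightarrow> 0 \<le> f i" "\<And>i. i \<in> S \<Longrightarrow> f i \<le> g i"
  shows "pmean p S f \<le> pmean p S g"
  unfolding pmean_def
  using assms by (intro powr_mono2 divide_right_mono sum_mono divide_nonneg_nonneg sum_nonneg) auto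

lemma pmean_cmult:
  assumes "p \<ge> 1" "c \<ge> 0" "\<And>i. i \<in> S \<Longrightarrow> 0 \<le> f i"
  shows "pmean p S (\<lambda>i. c * f i) = c * pmean p S f"
proof -
  have "(\<Sum>i\<in>S. (c * f i) powr p) = c powr p * (\<Sum>i\<in>S. f i powr p)"
    using assms by (simp add: powr_mult sum_distrib_left)
  then have "pmean p S (\<lambda>i. c * f i) = (c powr p) powr (1 / p) * pmean p S f"
    unfolding pmean_def by (simp add: powr_mult sum_nonneg flip: times_divide_eq_right)
  then show ?thesis
    using assms by (simp add: powr_powr)
qed

lemma pmean_const:
  assumes "p \<ge> 1" "c \<ge> 0" "finite S" "S \<noteq> {}"
  shows "pmean p S (\<lambda>i. c) = c"
  using assms by (simp add: pmean_def powr_powr)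

lemma pmean_zero [simp]: "pmean p S (\<lambda>i. 0) = 0"
  by (simp add: pmean_def)

lemma pmean_indicator:
  assumes "finite S" "A \<subseteq> S"
  shows "pmean p S (\<lambda>i. of_bool (i \<in> A)) = (card A / card S) powr (1 / p)"
proof -
  have "(\<Sum>i\<in>S. of_bool (i \<in> A) powr p) = (\<Sum>i\<in>S. of_bool (i \<in> A) :: real)"
    by (intro sum.cong) auto
  also have "\<dots> = card A"
    using assms by (simp add: Int_absorb1)
  finally show ?thesis
    by (simp add: pmean_def)
qed

lemma pmean_jensen:
  assumes "p \<ge> 1" "\<And>i. i \<in> S \<Longrightarrow> 0 \<le> f i"
  shows "(\<Sum>i\<in>S. f i) / card S \<le> pmean p S f"
proof (cases "finite S \<and> S \<noteq> {}")
  case True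
  have "(\<Sum>i\<in>S. (1 / card S) *\<^sub>R f i) powr p \<le> (\<Sum>i\<in>S. 1 / card S * f i powr p)"
    using assms True by (intro convex_on_sum[OF _ _ powr_convex_nonneg]) auto
  then have "((\<Sum>i\<in>S. f i) / card S) powr p \<le> pmean p S f powr p"
    using assms by (simp add: pmean_powr flip: sum_divide_distrib)
  then show ?thesis
    using assms(1) powr_less_mono2[of p "pmean p S f" "(\<Sum>i\<in>S. f i) / card S"]
    by (auto simp: not_le[symmetric])
qed (auto simp: pmean_def)

text \<open>Hoelder's inequality against the indicator of A. Jensen on A followed by rescaling the
  mean from A to S treats p = 1, where the exponent \<open>1 - 1 / p\<close> is 0, together with p >
  1.\<close>

lemma pmean_hoelder:
  assumes "p \<ge> 1" "finite S" "A \<subseteq> S" "A \<noteq> {}" "\<And>i. i \<in> S \<Longrightarrow> 0 \<le> f i"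
  shows "(\<Sum>i\<in>A. f i) / card S \<le> (card A / card S) powr (1 - 1 / p) * pmean p S f"
proof -
  have A: "finite A" "0 < card A" "0 < card S"
    using assms finite_subset by (auto simp: card_gt_0_iff)
  let ?r = "real (card A) / card S"
  have "pmean p A f \<le> ((\<Sum>i\<in>S. f i powr p) / card A) powr (1 / p)"
    unfolding pmean_def using assms
    by (intro powr_mono2 divide_right_mono sum_mono2 divide_nonneg_nonneg sum_nonneg) auto
  also have "(\<Sum>i\<in>S. f i powr p) / card A = (\<Sum>i\<in>S. f i powr p) / card S / ?r"
    using A by simp
  also have "\<dots> powr (1 / p) = pmean p S f * ?r powr (- (1 / p))"
    unfolding pmean_def using assms(1)
    by (simp add: powr_divide powr_minus_divide sum_nonneg)
  finally have le: "pmean p A f \<le> pmean p S f * ?r powr (- (1 / p))" .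
  have "(\<Sum>i\<in>A. f i) / card S = ?r * ((\<Sum>i\<in>A. f i) / card A)"
    using A by simp
  also have "\<dots> \<le> ?r * (pmean p S f * ?r powr (- (1 / p)))"
    using le pmean_jensen[OF assms(1), of A f] assms(3,5)
    by (intro mult_left_mono) (auto intro: order_trans)
  also have "\<dots> = (?r powr 1 * ?r powr (- (1 / p))) * pmean p S f"
    using A by simp
  also have "\<dots> = ?r powr (1 - 1 / p) * pmean p S f"
    by (subst powr_add[symmetric]) simp
  finally show ?thesis .
qed

lemma pmean_eq_0:
  assumes "p \<ge> 1" "finite S" "\<And>i. i \<in> S \<Longrightarrow> 0 \<le> f i" "pmean p S f = 0" "i \<in> S"
  shows "f i = 0"
proof -
  have "(\<Sum>i\<in>S. f i powr p) = 0"
    using assms by (auto simp: pmean_def)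
  then show ?thesis
    using assms by (subst (asm) sum_nonneg_eq_0_iff) auto
qed

text \<open>Minkowski's inequality: normalise \<open>f\<close> and \<open>g\<close> and use convexity of \<open>t \<mapsto> t\<^sup>p\<close>.\<close>

lemma pmean_triangle:
  assumes p: "p \<ge> 1" and S: "finite S"
    and f: "\<And>i. i \<in> S \<Longrightarrow> 0 \<le> f i" and g: "\<And>i. i \<in> S \<Longrightarrow> 0 \<le> g i"
  shows "pmean p S (\<lambda>i. f i + g i) \<le> pmean p S f + pmean p S g"
proof -
  let ?a = "pmean p S f" and ?b = "pmean p S g"
  consider "?a = 0" | "?b = 0" | "?a > 0" "?b > 0"
    using pmean_nonneg[of p S f] pmean_nonneg[of p S g] by linarith
  then show ?thesis
  proof cases
    case 1
    then have "pmean p S (\<lambda>i. f i + g i) = ?b"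
      using pmean_eq_0[OF p S f] by (intro pmean_cong) auto
    with 1 show ?thesis by simp
  next
    case 2
    then have "pmean p S (\<lambda>i. f i + g i) = ?a"
      using pmean_eq_0[OF p S g] by (intro pmean_cong) auto
    with 2 show ?thesis by simp
  next
    case 3
    let ?t = "?b / (?a + ?b)"
    have S0: "0 < card S"
      using 3 by (cases "card S = 0") (auto simp: pmean_def)
    have t: "0 \<le> ?t" "?t \<le> 1" "1 - ?t = ?a / (?a + ?b)"
      using 3 by (auto simp: field_simps)
    have split_sum: "u + v = s * ((a / s) * (u / a) + (b / s) * (v / b))"
      if "a > 0" "b > 0" "s > 0" for a b s u v :: real
      using that by (simp add: distrib_left)
    have conv: "((1 - t) * u + t * v) powr p \<le> (1 - t) * u powr p + t * v powr p"
      if "0 \<le> t" "t \<le> 1" "0 \<le> u" "0 \<le> v" for t u v :: real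
      using convex_onD[OF powr_convex_nonneg[OF p] that(1,2), of u v] that by simp
    have split: "(f i + g i) powr p \<le>
        (?a + ?b) powr p * ((1 - ?t) * (f i powr p / ?a powr p) + ?t * (g i powr p / ?b powr p))"
      if i: "i \<in> S" for i
    proof -
      have eq: "f i + g i = (?a + ?b) * ((1 - ?t) * (f i / ?a) + ?t * (g i / ?b))"
        unfolding t(3) by (rule split_sum) (use 3 in auto)
      have "(f i + g i) powr p = (?a + ?b) powr p * ((1 - ?t) * (f i / ?a) + ?t * (g i / ?b)) powr p"
        unfolding eq by (rule powr_mult)
      also have "\<dots> \<le> (?a + ?b) powr p * ((1 - ?t) * (f i / ?a) powr p + ?t * (g i / ?b) powr p)"
        by (intro mult_left_mono conv[OF t(1,2)] divide_nonneg_nonneg f g i pmean_nonneg powr_ge_zero)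
      finally show ?thesis
        by (simp only: powr_divide)
    qed
    have "(\<Sum>i\<in>S. (f i + g i) powr p) \<le> (\<Sum>i\<in>S.
        (?a + ?b) powr p * ((1 - ?t) * (f i powr p / ?a powr p) + ?t * (g i powr p / ?b powr p)))"
      by (rule sum_mono[OF split])
    also have "\<dots> = (?a + ?b) powr p * ((1 - ?t) * ((\<Sum>i\<in>S. f i powr p) / ?a powr p)
        + ?t * ((\<Sum>i\<in>S. g i powr p) / ?b powr p))"
      by (simp only: sum_divide_distrib sum_distrib_left sum.distrib distrib_left)
    also have "\<dots> = (?a + ?b) powr p * card S"
    proof -
      have "(\<Sum>i\<in>S. f i powr p) = ?a powr p * card S" "(\<Sum>i\<in>S. g i powr p) = ?b powr p * card S"
        using S0 by (simp_all add: pmean_powr[OF p])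
      then have "(\<Sum>i\<in>S. f i powr p) / ?a powr p = card S" "(\<Sum>i\<in>S. g i powr p) / ?b powr p = card S"
        using 3 by auto
      then show ?thesis
        by (simp only:) (simp add: left_diff_distrib)
    qed
    finally have "(\<Sum>i\<in>S. (f i + g i) powr p) / card S \<le> (?a + ?b) powr p"
      using S0 by (simp add: field_simps)
    then have "pmean p S (\<lambda>i. f i + g i) \<le> ((?a + ?b) powr p) powr (1 / p)"
      unfolding pmean_def[of p S "\<lambda>i. f i + g i"] using p by (intro powr_mono2) (auto intro!: divide_nonneg_nonneg sum_nonneg)
    then show ?thesis
      using p 3 by (simp add: powr_powr)
  qed
qed

lemma pmean_sum:
  assumes "p \<ge> 1" "finite S" "finite K" "\<And>k i. k \<in> K \<Longrightarrow> i \<in> S \<Longrightarrow> 0 \<le> f k i"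
  shows "pmean p S (\<lambda>i. \<Sum>k\<in>K. f k i) \<le> (\<Sum>k\<in>K. pmean p S (f k))"
  using assms(3,4)
proof (induction K)
  case (insert k K)
  have "pmean p S (\<lambda>i. f k i + (\<Sum>k\<in>K. f k i)) \<le> pmean p S (f k) + pmean p S (\<lambda>i. \<Sum>k\<in>K. f k i)"
    using insert.prems by (intro pmean_triangle assms(1,2) sum_nonneg) auto
  with insert show ?case by force
qed simp

lemma pmean_average:
  assumes "p \<ge> 1" "finite S" "finite K" "\<And>k i. k \<in> K \<Longrightarrow> i \<in> S \<Longrightarrow> 0 \<le> f k i"
  shows "pmean p S (\<lambda>i. (\<Sum>k\<in>K. f k i) / card K) \<le> (\<Sum>k\<in>K. pmean p S (f k)) / card K"
proof -
  have "pmean p S (\<lambda>i. (\<Sum>k\<in>K. f k i) / card K) = (1 / card K) * pmean p S (\<lambda>i. \<Sum>k\<in>K. f k i)"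
    by (subst pmean_cmult[symmetric]) (use assms in \<open>auto intro!: sum_nonneg\<close>)
  then show ?thesis
    using pmean_sum[of p S K f] assms by (simp add: divide_right_mono)
qed

section \<open>Splitting a grid into equal blocks\<close>

lemma bij_betw_blocks:
  "bij_betw (\<lambda>(a, i). a * L + i) ({..<M} \<times> {..<L}) {..<M * L :: nat}"
proof (rule bij_betw_byWitness[where f' = "\<lambda>x. (x div L, x mod L)"])
  show "(\<lambda>(a, i). a * L + i) ` ({..<M} \<times> {..<L}) \<subseteq> {..<M * L}"
  proof clarsimp
    fix a i assume "a < M" "i < L"
    then have "a * L + i < Suc a * L" "Suc a * L \<le> M * L"
      by (simp, intro mult_le_mono1, simp)
    then show "a * L + i < M * L" by linarith
  qed
  show "(\<lambda>x. (x div L, x mod L)) ` {..<M * L} \<subseteq> {..<M} \<times> {..<L}"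
    by (cases "L = 0") (auto simp: less_mult_imp_div_less)
qed auto

lemma sum_blocks: "(\<Sum>x<M * L :: nat. f x) = (\<Sum>i<L. \<Sum>a<M. f (a * L + i))"
proof -
  have "(\<Sum>x<M * L. f x) = (\<Sum>a<M. \<Sum>i<L. f (a * L + i))"
    using sum.reindex_bij_betw[OF bij_betw_blocks[of L M], of f]
    by (simp add: case_prod_unfold sum.cartesian_product)
  then show ?thesis
    using sum.swap[of "\<lambda>a i. f (a * L + i)" "{..<L}" "{..<M}"] by simp
qed

text \<open>Fubini for positions written as \<open>a * L + i\<close>. The block number is averaged
  inside and the position within the block outside, so for fixed i the inner mean runs over all
  copies of one cell.\<close>

lemma pmean_blocks:
  assumes "p \<ge> 1"
  shows "pmean p {..<M * L :: nat} f = pmean p {..<L} (\<lambda>i. pmean p {..<M} (\<lambda>a. f (a * L + i)))"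
proof -
  have "(\<Sum>x<M * L. f x powr p) / (M * L) = (\<Sum>i<L. pmean p {..<M} (\<lambda>a. f (a * L + i)) powr p) / L"
    by (simp add: sum_blocks pmean_powr[OF assms] sum_divide_distrib)
  then show ?thesis
    unfolding pmean_def[of p "{..<L}"] pmean_def[of p "{..<M * L}"] by simp
qed

section \<open>Averages over random signs\<close>

text \<open>A choice of signs is encoded as the set W of indices with sign -1. Expectations become
  finite averages over \<open>Pow S\<close>.\<close>

definition rad :: "'a set \<Rightarrow> 'a \<Rightarrow> real" where
  "rad W a = (if a \<in> W then - 1 else 1)"

definition rad_avg :: "'a set \<Rightarrow> ('a set \<Rightarrow> real) \<Rightarrow> real" where
  "rad_avg S f = (\<Sum>W\<in>Pow S. f W) / 2 ^ card S"

lemma abs_rad [simp]: "\<bar>rad W a\<bar> = 1"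
  by (simp add: rad_def)

lemma rad_mult_self [simp]: "rad W a * rad W a = 1" "rad W a * (rad W a * x) = x"
  by (auto simp: rad_def)

lemma rad_avg_mono: "(\<And>W. f W \<le> g W) \<Longrightarrow> rad_avg S f \<le> rad_avg S g"
  by (simp add: rad_avg_def divide_right_mono sum_mono)

lemma rad_avg_sum: "rad_avg S (\<lambda>W. \<Sum>k\<in>K. f k W) = (\<Sum>k\<in>K. rad_avg S (f k))"
  unfolding rad_avg_def by (subst sum.swap) (simp add: sum_divide_distrib)

lemma rad_avg_add: "rad_avg S (\<lambda>W. f W + g W) = rad_avg S f + rad_avg S g"
  by (simp add: rad_avg_def sum.distrib add_divide_distrib)

lemma rad_avg_cmult: "rad_avg S (\<lambda>W. c * f W) = c * rad_avg S f"
  by (simp add: rad_avg_def sum_distrib_left)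

lemma rad_avg_const [simp]: "finite S \<Longrightarrow> rad_avg S (\<lambda>W. c) = c"
  by (simp add: rad_avg_def card_Pow)

lemma rad_avg_le:
  assumes "finite S" "\<And>W. f W \<le> c"
  shows "rad_avg S f \<le> c"
  using rad_avg_mono[of f "\<lambda>_. c" S] assms by simp

text \<open>Turns a bound in the mean into one choice of signs; it is applied once for each of the
  two families.\<close>

lemma rad_avg_witness:
  assumes "finite S" "rad_avg S f \<le> c"
  obtains W where "f W \<le> c"
proof (rule ccontr)
  assume "\<not> thesis"
  with that have "c < f W" for W
    by (meson not_le)
  then have "(\<Sum>W\<in>Pow S. c) < (\<Sum>W\<in>Pow S. f W)"
    using assms(1) by (intro sum_strict_mono) auto
  then have "c < rad_avg S f"
    using assms(1) by (simp add: rad_avg_def card_Pow field_simps)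
  with assms(2) show False by simp
qed

text \<open>Toggling the membership of a is an involution of \<open>Pow S\<close> under which f
  changes sign, so the values cancel.\<close>

lemma rad_avg_flip:
  assumes "a \<in> S" "\<And>W. f (sym_diff W {a}) = - f W"
  shows "rad_avg S f = 0"
proof -
  have "bij_betw (\<lambda>W. sym_diff W {a}) (Pow S) (Pow S)"
    by (rule bij_betw_byWitness[where f' = "\<lambda>W. sym_diff W {a}"]) (use assms(1) in auto)
  then have "(\<Sum>W\<in>Pow S. f W) = (\<Sum>W\<in>Pow S. f (sym_diff W {a}))"
    by (rule sum.reindex_bij_betw[symmetric])
  then show ?thesis
    unfolding assms(2) by (simp add: rad_avg_def sum_negf)
qed

lemma rad_sym_diff: "rad (sym_diff W {a}) b = (if a = b then - rad W b else rad W b)"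
  by (auto simp: rad_def)

lemma rad_orthonormal:
  assumes "finite S" "a \<in> S" "b \<in> S"
  shows "rad_avg S (\<lambda>W. rad W a * rad W b) = of_bool (a = b)"
proof (cases "a = b")
  case False
  then show ?thesis
    using assms by (subst rad_avg_flip[of a]) (auto simp: rad_sym_diff)
qed (use assms in simp)

text \<open>Products of two distinct signs are Walsh functions. If the unordered pairs differ, a or
  b occurs exactly once among the four factors, and flipping that sign makes the average
  vanish.\<close>

lemma rad_pair_orthonormal:
  assumes S: "finite S" "a \<in> S" "b \<in> S" and ne: "a \<noteq> b" "c \<noteq> d"
  shows "rad_avg S (\<lambda>W. rad W a * rad W b * (rad W c * rad W d)) = of_bool ({a, b} = {c, d})"
proof -
  consider "{a, b} = {c, d}" | "{a, b} \<noteq> {c, d}" "a \<notin> {c, d}" | "{a, b} \<noteq> {c, d}" "b \<notin> {c, d}"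
    using ne by blast
  then show ?thesis
  proof cases
    case 1
    then have "rad W a * rad W b * (rad W c * rad W d) = 1" for W
      by (auto simp: doubleton_eq_iff rad_def)
    with 1 S show ?thesis by simp
  next
    case 2
    then show ?thesis
      using S ne by (subst rad_avg_flip[of a]) (auto simp: rad_sym_diff)
  next
    case 3
    then show ?thesis
      using S ne by (subst rad_avg_flip[of b]) (auto simp: rad_sym_diff)
  qed
qed

text \<open>Up to two indices p may carry the same Walsh function. Estimating
  \<open>z p * z p'\<close> by half the sum of the squares charges each square at most twice, whence
  the factor 2.\<close>

lemma rad_chaos:
  assumes S: "finite S" and P: "finite P"
    and fg: "\<And>p. p \<in> P \<Longrightarrow> f p \<in> S \<and> g p \<in> S \<and> f p \<noteq> g p"
    and two: "\<And>p. p \<in> P \<Longrightarrow> card {p' \<in> P. {f p, g p} = {f p', g p'}} \<le> 2"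
  shows "rad_avg S (\<lambda>W. (\<Sum>p\<in>P. z p * (rad W (f p) * rad W (g p)))\<^sup>2) \<le> 2 * (\<Sum>p\<in>P. (z p)\<^sup>2)"
proof -
  let ?e = "\<lambda>p p'. of_bool ({f p, g p} = {f p', g p'}) :: real"
  have "rad_avg S (\<lambda>W. (\<Sum>p\<in>P. z p * (rad W (f p) * rad W (g p)))\<^sup>2)
    = rad_avg S (\<lambda>W. \<Sum>p\<in>P. \<Sum>p'\<in>P. z p * z p' *
        (rad W (f p) * rad W (g p) * (rad W (f p') * rad W (g p'))))"
    by (simp add: power2_eq_square sum_product mult_ac)
  also have "\<dots> = (\<Sum>p\<in>P. \<Sum>p'\<in>P. z p * z p' * ?e p p')"
    unfolding rad_avg_sum rad_avg_cmult
    using fg S by (intro sum.cong refl arg_cong2[where f = times] rad_pair_orthonormal) auto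
  also have "\<dots> \<le> (\<Sum>p\<in>P. \<Sum>p'\<in>P. ((z p)\<^sup>2 + (z p')\<^sup>2) / 2 * ?e p p')"
  proof (intro sum_mono mult_right_mono)
    fix p p'
    show "z p * z p' \<le> ((z p)\<^sup>2 + (z p')\<^sup>2) / 2"
      using sum_squares_bound[of "z p" "z p'"] by simp
  qed simp
  also have "\<dots> = (\<Sum>p\<in>P. \<Sum>p'\<in>P. (z p)\<^sup>2 / 2 * ?e p p') + (\<Sum>p\<in>P. \<Sum>p'\<in>P. (z p')\<^sup>2 / 2 * ?e p p')"
    by (simp add: add_divide_distrib distrib_right sum.distrib del: sum_mult_of_bool_eq)
  also have "(\<Sum>p\<in>P. \<Sum>p'\<in>P. (z p')\<^sup>2 / 2 * ?e p p') = (\<Sum>p\<in>P. \<Sum>p'\<in>P. (z p)\<^sup>2 / 2 * ?e p p')"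
    by (subst sum.swap) (simp add: eq_commute del: sum_mult_of_bool_eq)
  also have "(\<Sum>p\<in>P. \<Sum>p'\<in>P. (z p)\<^sup>2 / 2 * ?e p p') + (\<Sum>p\<in>P. \<Sum>p'\<in>P. (z p)\<^sup>2 / 2 * ?e p p')
      = (\<Sum>p\<in>P. (z p)\<^sup>2 * (\<Sum>p'\<in>P. ?e p p'))"
    by (simp add: sum_distrib_left flip: sum.distrib del: sum_mult_of_bool_eq)
  also have "\<dots> \<le> (\<Sum>p\<in>P. (z p)\<^sup>2 * 2)"
  proof (intro sum_mono mult_left_mono)
    fix p assume p: "p \<in> P"
    have "(\<Sum>p'\<in>P. ?e p p') = card {p' \<in> P. {f p, g p} = {f p', g p'}}"
      using P by (simp add: Collect_conj_eq Int_commute)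
    also have "\<dots> \<le> 2"
      using two[OF p] by linarith
    finally show "(\<Sum>p'\<in>P. ?e p p') \<le> 2" .
  qed simp
  finally show ?thesis
    by (simp add: mult.commute flip: sum_distrib_left)
qed

text \<open>If e and e' agree, (A, A') and its transpose carry the same product of signs; if their
  ranges are disjoint, every pair carries its own. In both cases the multiplicity is at most 2, so
  equal and different intervals are treated together.\<close>

lemma rad_chaos_rows:
  fixes e e' :: "nat \<Rightarrow> 'a"
  assumes S: "finite S" and e: "\<And>A. A < M \<Longrightarrow> e A \<in> S" "\<And>A. A < M \<Longrightarrow> e' A \<in> S"
    and inj: "inj_on e {..<M}" "inj_on e' {..<M}"
    and same: "(\<forall>A<M. e A = e' A) \<or> e ` {..<M} \<inter> e' ` {..<M} = {}"
  shows "rad_avg S (\<lambda>W. (\<Sum>A<M. \<Sum>A'<M. of_bool (e A \<noteq> e' A') * (z A A' * (rad W (e A) * rad W (e' A'))))\<^sup>2)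
     \<le> 2 * (\<Sum>A<M. \<Sum>A'<M. (z A A')\<^sup>2)"
proof -
  define P where "P = {p \<in> {..<M} \<times> {..<M}. e (fst p) \<noteq> e' (snd p)}"
  have P: "finite P" "P \<subseteq> {..<M} \<times> {..<M}"
    by (auto simp: P_def)
  have sumP: "(\<Sum>A<M. \<Sum>A'<M. of_bool (e A \<noteq> e' A') * h A A') = (\<Sum>p\<in>P. h (fst p) (snd p))"
    for h :: "nat \<Rightarrow> nat \<Rightarrow> real"
    unfolding sum.cartesian_product P_def
    by (subst sum.inter_filter) (auto intro!: sum.cong)
  have two: "card {p' \<in> P. {e (fst p), e' (snd p)} = {e (fst p'), e' (snd p')}} \<le> 2"
    if p: "p \<in> P" for p
  proof -
    have "{p' \<in> P. {e (fst p), e' (snd p)} = {e (fst p'), e' (snd p')}} \<subseteq> {p, (snd p, fst p)}"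
    proof (intro subsetI)
      fix x
      assume "x \<in> {p' \<in> P. {e (fst p), e' (snd p)} = {e (fst p'), e' (snd p')}}"
      moreover obtain a b where x: "x = (a, b)"
        by force
      ultimately have ab: "(a, b) \<in> P" and eq: "{e (fst p), e' (snd p)} = {e a, e' b}"
        by auto
      have lt: "a < M" "b < M" "fst p < M" "snd p < M"
        using p ab by (auto simp: P_def)
      consider "e (fst p) = e a" "e' (snd p) = e' b" | "e (fst p) = e' b" "e' (snd p) = e a"
        using eq by (auto simp: doubleton_eq_iff)
      then show "x \<in> {p, (snd p, fst p)}"
      proof cases
        case 1
        then show ?thesis
          using inj lt by (auto simp: x inj_on_def prod_eq_iff)
      next
        case 2
        then have "\<forall>A<M. e A = e' A"
          using same lt by blast
        then show ?thesis
          using 2 inj lt by (auto simp: x inj_on_def prod_eq_iff)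
      qed
    qed
    then have "card {p' \<in> P. {e (fst p), e' (snd p)} = {e (fst p'), e' (snd p')}} \<le> card {p, (snd p, fst p)}"
      by (intro card_mono) auto
    also have "\<dots> \<le> 2"
      by (simp add: card_insert_if)
    finally show ?thesis .
  qed
  have "rad_avg S (\<lambda>W. (\<Sum>p\<in>P. z (fst p) (snd p) * (rad W (e (fst p)) * rad W (e' (snd p))))\<^sup>2)
      \<le> 2 * (\<Sum>p\<in>P. (z (fst p) (snd p))\<^sup>2)"
    by (rule rad_chaos[OF S P(1) _ two]) (use e in \<open>auto simp: P_def\<close>)
  also have "(\<Sum>p\<in>P. (z (fst p) (snd p))\<^sup>2) \<le> (\<Sum>A<M. \<Sum>A'<M. (z A A')\<^sup>2)"
    unfolding sum.cartesian_product case_prod_unfold using P by (intro sum_mono2) auto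
  finally show ?thesis
    unfolding sumP by simp
qed

text \<open>One of \<alpha> and \<open>1 - \<alpha>\<close> is at least 1/2, so either all row sums
  or all column sums are at most \<open>G * M powr (- (1 / 2))\<close>. The conclusion is free of
  \<alpha>, which is why N does not depend on p and q.\<close>

lemma sum_square_gain:
  fixes z :: "'a \<Rightarrow> 'b \<Rightarrow> real"
  assumes "finite S" "finite S'" "card S \<le> M" "card S' \<le> M" "M > 0" "G \<ge> 0"
    and entry: "\<And>a b. a \<in> S \<Longrightarrow> b \<in> S' \<Longrightarrow> \<bar>z a b\<bar> \<le> G / M"
    and row: "\<And>a. a \<in> S \<Longrightarrow> (\<Sum>b\<in>S'. \<bar>z a b\<bar>) \<le> G * M powr (- \<alpha>)"
    and col: "\<And>b. b \<in> S' \<Longrightarrow> (\<Sum>a\<in>S. \<bar>z a b\<bar>) \<le> G * M powr (- (1 - \<alpha>))"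
  shows "(\<Sum>a\<in>S. \<Sum>b\<in>S'. (z a b)\<^sup>2) \<le> G\<^sup>2 * M powr (- (1 / 2))"
proof -
  have M: "1 \<le> real M" using \<open>M > 0\<close> by simp
  have l1: "(\<Sum>a\<in>S. \<Sum>b\<in>S'. \<bar>z a b\<bar>) \<le> M * (G * M powr (- (1 / 2)))"
  proof (cases "\<alpha> \<ge> 1 / 2")
    case True
    have "(\<Sum>a\<in>S. \<Sum>b\<in>S'. \<bar>z a b\<bar>) \<le> (\<Sum>a\<in>S. G * M powr (- (1 / 2)))"
      using True M \<open>G \<ge> 0\<close> by (intro sum_mono order_trans[OF row] mult_left_mono powr_mono) auto
    also have "\<dots> \<le> M * (G * M powr (- (1 / 2)))"
      using assms(3) \<open>G \<ge> 0\<close> by (simp add: mult_right_mono)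
    finally show ?thesis .
  next
    case False
    have "(\<Sum>b\<in>S'. \<Sum>a\<in>S. \<bar>z a b\<bar>) \<le> (\<Sum>b\<in>S'. G * M powr (- (1 / 2)))"
      using False M \<open>G \<ge> 0\<close> by (intro sum_mono order_trans[OF col] mult_left_mono powr_mono) auto
    also have "\<dots> \<le> M * (G * M powr (- (1 / 2)))"
      using assms(4) \<open>G \<ge> 0\<close> by (simp add: mult_right_mono)
    finally show ?thesis
      by (subst sum.swap)
  qed
  \<comment> \<open>One factor of each square is replaced by the entry bound \<open>G / M\<close>;
    this 1/M absorbs the number of rows or columns.\<close>
  have "(\<Sum>a\<in>S. \<Sum>b\<in>S'. (z a b)\<^sup>2) \<le> (\<Sum>a\<in>S. \<Sum>b\<in>S'. G / M * \<bar>z a b\<bar>)"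
  proof (intro sum_mono)
    fix a b assume "a \<in> S" "b \<in> S'"
    then have "\<bar>z a b\<bar> * \<bar>z a b\<bar> \<le> G / M * \<bar>z a b\<bar>"
      by (intro mult_right_mono entry) auto
    then show "(z a b)\<^sup>2 \<le> G / M * \<bar>z a b\<bar>"
      by (simp add: power2_eq_square)
  qed
  also have "\<dots> = G / M * (\<Sum>a\<in>S. \<Sum>b\<in>S'. \<bar>z a b\<bar>)"
    by (simp add: sum_distrib_left)
  also have "\<dots> \<le> G / M * (M * (G * M powr (- (1 / 2))))"
    using \<open>G \<ge> 0\<close> by (intro mult_left_mono l1) auto
  also have "\<dots> = G\<^sup>2 * M powr (- (1 / 2))"
    using \<open>M > 0\<close> by (simp add: power2_eq_square)
  finally show ?thesis .
qed

section \<open>Lattice norms on finite families of coefficients\<close>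

text \<open>Common abstraction of the Hardy norm and its dual on coefficient families, so that the
  perturbation argument is run once. By \<open>mono\<close> only absolute values on S count.
  \<open>lower\<close> and \<open>upper\<close> compare the norm with single coefficients and with
  their sum; for w the area and S = \<open>rects n\<close> the losses depend on n only.\<close>

locale lattice_norm =
  fixes S :: "'a set" and w :: "'a \<Rightarrow> real" and \<nu> :: "('a \<Rightarrow> real) \<Rightarrow> real"
  assumes finite_S: "finite S"
    and w_pos: "r \<in> S \<Longrightarrow> 0 < w r"
    and triangle: "\<nu> (\<lambda>r. c r + d r) \<le> \<nu> c + \<nu> d"
    and mono: "(\<And>r. r \<in> S \<Longrightarrow> \<bar>c r\<bar> \<le> \<bar>d r\<bar>) \<Longrightarrow> \<nu> c \<le> \<nu> d"
    and scale: "\<nu> (\<lambda>r. a * c r) = \<bar>a\<bar> * \<nu> c"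
    and lower: "r \<in> S \<Longrightarrow> \<bar>c r\<bar> * w r \<le> \<nu> c"
    and upper: "\<nu> c \<le> (\<Sum>r\<in>S. \<bar>c r\<bar>)"
begin

lemma zero [simp]: "\<nu> (\<lambda>r. 0) = 0"
  using scale[of 0 "\<lambda>r. 0"] by simp

lemma cong: "(\<And>r. r \<in> S \<Longrightarrow> c r = d r) \<Longrightarrow> \<nu> c = \<nu> d"
  by (intro antisym mono) auto

lemma nonneg [simp]: "0 \<le> \<nu> c"
  using triangle[of c "\<lambda>r. - 1 * c r"] unfolding scale by simp

lemma coeff_bound: "r \<in> S \<Longrightarrow> \<bar>c r\<bar> \<le> \<nu> c / w r"
  using lower[of r c] w_pos by (simp add: pos_le_divide_eq)

text \<open>A crude estimate of an operator by its entries. For the perturbation the index sets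
  belong to the coarse level n, so the loss depends on n only, while the entries are small in
  m.\<close>

lemma matrix_bound:
  assumes "finite R" "\<And>r s. r \<in> R \<Longrightarrow> s \<in> S \<Longrightarrow> \<bar>l r s\<bar> \<le> K r s" "\<And>r. r \<in> R \<Longrightarrow> \<bar>c r\<bar> \<le> x r"
  shows "\<nu> (\<lambda>s. \<Sum>r\<in>R. l r s * c r) \<le> (\<Sum>s\<in>S. \<Sum>r\<in>R. K r s * x r)"
proof -
  have "\<bar>\<Sum>r\<in>R. l r s * c r\<bar> \<le> (\<Sum>r\<in>R. K r s * x r)" if "s \<in> S" for s
    using assms that
    by (intro order_trans[OF sum_abs] sum_mono) (auto simp: abs_mult intro!: mult_mono intro: order_trans[OF abs_ge_zero])
  then show ?thesis
    by (intro order_trans[OF upper] sum_mono)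
qed

text \<open>H is the Neumann series of \<open>1 - L\<close>. \<open>lower\<close> makes it converge
  in every coordinate of S, and the norm bound comes from the equation
  \<open>H c = c + L (H c)\<close> on S rather than from summing norms.\<close>

lemma neumann:
  fixes l :: "'a \<Rightarrow> 'a \<Rightarrow> real"
  defines "L \<equiv> \<lambda>c s. \<Sum>r\<in>S. l r s * c r"
  assumes contr: "\<And>c. \<nu> (L c) \<le> e * \<nu> c" and e: "0 \<le> e" "e < 1"
  obtains H where
    "\<And>c d s. H (\<lambda>r. c r + d r) s = H c s + H d s" "\<And>a c s. H (\<lambda>r. a * c r) s = a * H c s"
    "\<And>c s. s \<in> S \<Longrightarrow> H (\<lambda>r. c r - L c r) s = c s"
    "\<And>c. \<nu> (H c) \<le> \<nu> c / (1 - e)"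
proof -
  define it where "it c k = (L ^^ k) c" for c k
  have it_0: "it c 0 = c" and it_Suc: "it c (Suc k) = L (it c k)" for c k
    by (simp_all add: it_def)
  have L_add: "L (\<lambda>r. c r + d r) = (\<lambda>r. L c r + L d r)" and L_scale: "L (\<lambda>r. a * c r) = (\<lambda>r. a * L c r)" for a c d
    by (auto simp: L_def algebra_simps sum.distrib sum_distrib_left)
  have it_add: "it (\<lambda>r. c r + d r) k = (\<lambda>r. it c k r + it d k r)" for c d k
    by (induction k) (simp_all add: it_0 it_Suc L_add)
  have it_scale: "it (\<lambda>r. a * c r) k = (\<lambda>r. a * it c k r)" for a c k
    by (induction k) (simp_all add: it_0 it_Suc L_scale)
  have it_bound: "\<nu> (it c k) \<le> e ^ k * \<nu> c" for c k
  proof (induction k)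
    case (Suc k)
    then have "e * \<nu> (it c k) \<le> e * (e ^ k * \<nu> c)"
      using e by (intro mult_left_mono)
    then show ?case
      using contr[of "it c k"] by (simp add: it_Suc)
  qed (simp add: it_0)
  have summable: "summable (\<lambda>k. it c k s)" if s: "s \<in> S" for c s
  proof (rule summable_comparison_test')
    show "summable (\<lambda>k. e ^ k * (\<nu> c / w s))"
      using e by (intro summable_mult2 summable_geometric) auto
    fix k
    have "\<bar>it c k s\<bar> \<le> \<nu> (it c k) / w s"
      by (rule coeff_bound[OF s])
    also have "\<dots> \<le> (e ^ k * \<nu> c) / w s"
      using it_bound w_pos[OF s] by (intro divide_right_mono) auto
    finally show "norm (it c k s) \<le> e ^ k * (\<nu> c / w s)"
      by simp
  qed
  \<comment> \<open>Convergence is known in the coordinates of S only; the value 0 elsewhere lets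
    linearity hold for every s.\<close>
  define H where "H c s = (if s \<in> S then \<Sum>k. it c k s else 0)" for c s
  have H_add: "H (\<lambda>r. c r + d r) s = H c s + H d s" for c d s
    by (auto simp: H_def it_add suminf_add summable)
  have H_scale: "H (\<lambda>r. a * c r) s = a * H c s" for a c s
    using summable by (auto simp: H_def it_scale suminf_mult)
  have right_inverse: "H c s = c s + L (H c) s" if s: "s \<in> S" for c s
  proof -
    have "L (H c) s = (\<Sum>r\<in>S. \<Sum>k. l r s * it c k r)"
      unfolding L_def by (intro sum.cong) (auto simp: H_def suminf_mult summable)
    also have "\<dots> = (\<Sum>k. \<Sum>r\<in>S. l r s * it c k r)"
      by (intro suminf_sum[symmetric] summable_mult summable)
    also have "\<dots> = (\<Sum>k. it c (Suc k) s)"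
      by (simp add: it_Suc L_def)
    also have "\<dots> = (\<Sum>k. it c k s) - it c 0 s"
      by (rule suminf_split_head[OF summable[OF s]])
    finally show ?thesis
      using s by (simp add: H_def it_0)
  qed
  have bound: "(1 - e) * \<nu> (H c) \<le> \<nu> c" for c
  proof -
    have "\<nu> (H c) = \<nu> (\<lambda>s. c s + L (H c) s)"
      by (rule cong[OF right_inverse])
    also have "\<dots> \<le> \<nu> c + e * \<nu> (H c)"
      using triangle contr by (meson add_left_mono order_trans)
    finally show ?thesis
      by (simp add: algebra_simps)
  qed
  \<comment> \<open>H will be applied after T, so a left inverse is wanted, while the series
    directly yields a right inverse. The difference d of the two sides satisfies d = L d on S, and e
    < 1 forces its norm to be 0.\<close>
  have left_inverse: "H (\<lambda>r. c r - L c r) s = c s" if s: "s \<in> S" for c s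
  proof -
    define d where "d = (\<lambda>s. H (\<lambda>r. c r - L c r) s - c s)"
    have sub: "L (\<lambda>r. x r - y r) = (\<lambda>r. L x r - L y r)" for x y
      by (auto simp: L_def algebra_simps sum_subtractf)
    have "d r = L d r" if "r \<in> S" for r
      using right_inverse[OF that, of "\<lambda>r. c r - L c r"] by (simp add: d_def sub)
    then have "\<nu> d \<le> e * \<nu> d"
      using cong[of d "L d"] contr[of d] by simp
    then have "(1 - e) * \<nu> d \<le> 0"
      by (simp add: algebra_simps)
    then have "\<nu> d = 0"
      using e nonneg[of d] by (simp add: mult_le_0_iff)
    then show ?thesis
      using coeff_bound[OF s, of d] by (simp add: d_def)
  qed
  show thesis
  proof
    show "\<nu> (H c) \<le> \<nu> c / (1 - e)" for c
      using bound[of c] e by (simp add: pos_le_divide_eq mult.commute)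
  qed (fact H_add H_scale left_inverse)+
qed

end

section \<open>Hardy norms in terms of Haar coefficients\<close>

text \<open>
  The pair \<open>(l, i)\<close> encodes the dyadic interval of length \<open>2\<^sup>-\<^sup>l\<close> with left end \<open>i 2\<^sup>-\<^sup>l\<close>, and \<open>chain k x\<close>
  consists of the intervals of length at least \<open>2\<^sup>-\<^sup>k\<close> containing \<open>[x 2\<^sup>-\<^sup>k, (x + 1) 2\<^sup>-\<^sup>k)\<close>.
\<close>

type_synonym ivl = "nat \<times> nat"

definition ivls :: "nat \<Rightarrow> ivl set" where
  "ivls k = (SIGMA l:{..k}. {..<2 ^ l})"

definition chain :: "nat \<Rightarrow> nat \<Rightarrow> ivl set" where
  "chain k x = (\<lambda>l. (l, x div 2 ^ (k - l))) ` {..k}"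

definition rects :: "nat \<Rightarrow> (ivl \<times> ivl) set" where
  "rects k = ivls k \<times> ivls k"

definition area :: "ivl \<times> ivl \<Rightarrow> real" where
  "area r = (1 / 2 ^ fst (fst r)) * (1 / 2 ^ fst (snd r))"

text \<open>This is the square function on the cell (x, y): the square of a Haar function is the
  indicator of its rectangle, which contains the cell exactly when its sides lie in the two
  chains.\<close>

definition square_fn :: "nat \<Rightarrow> (ivl \<times> ivl \<Rightarrow> real) \<Rightarrow> nat \<Rightarrow> nat \<Rightarrow> real" where
  "square_fn k c x y = L2_set c (chain k x \<times> chain k y)"

definition hardy_c :: "real \<Rightarrow> real \<Rightarrow> nat \<Rightarrow> (ivl \<times> ivl \<Rightarrow> real) \<Rightarrow> real" where
  "hardy_c p q k c = pmean p {..<2 ^ k} (\<lambda>x. pmean q {..<2 ^ k} (\<lambda>y. square_fn k c x y))"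

definition pair_c :: "nat \<Rightarrow> (ivl \<times> ivl \<Rightarrow> real) \<Rightarrow> (ivl \<times> ivl \<Rightarrow> real) \<Rightarrow> real" where
  "pair_c k c d = (\<Sum>r\<in>rects k. c r * d r * area r)"

definition dual_c :: "real \<Rightarrow> real \<Rightarrow> nat \<Rightarrow> (ivl \<times> ivl \<Rightarrow> real) \<Rightarrow> real" where
  "dual_c p q k c = Sup {\<bar>pair_c k c d\<bar> | d. hardy_c p q k d \<le> 1}"

lemma finite_ivls [simp]: "finite (ivls k)"
  by (simp add: ivls_def)

lemma finite_rects [simp]: "finite (rects k)"
  by (simp add: rects_def)

lemma finite_chain [simp]: "finite (chain k x)"
  by (simp add: chain_def)

lemma chain_subset: "x < 2 ^ k \<Longrightarrow> chain k x \<subseteq> ivls k"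
  by (auto simp: chain_def ivls_def less_mult_imp_div_less simp flip: power_add)

lemma area_pos [simp]: "0 < area r"
  by (simp add: area_def)

lemma card_ivls: "card (ivls k) \<le> 2 ^ (k + 1)"
proof -
  have "card (ivls k) = (\<Sum>l\<le>k. 2 ^ l)"
    by (simp add: ivls_def)
  also have "\<dots> \<le> 2 ^ (k + 1)"
    by (induction k) auto
  finally show ?thesis .
qed

lemma area_lower: "r \<in> rects k \<Longrightarrow> 1 / 2 ^ (2 * k) \<le> area r"
proof -
  assume "r \<in> rects k"
  then have "fst (fst r) + fst (snd r) \<le> 2 * k"
    by (auto simp: rects_def ivls_def)
  then have "(2::real) ^ (fst (fst r) + fst (snd r)) \<le> 2 ^ (2 * k)"
    by (intro power_increasing) auto
  then show ?thesis
    by (simp add: area_def field_simps power_add)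
qed

text \<open>Double counting: an interval of level l lies in the chains of 2^(k - l) among the 2^k
  cells, a proportion equal to its length.\<close>

lemma sum_chain_average:
  fixes f :: "ivl \<Rightarrow> real"
  shows "(\<Sum>a\<in>ivls k. f a / 2 ^ fst a) = (\<Sum>x<2 ^ k. \<Sum>a\<in>chain k x. f a) / 2 ^ k"
proof -
  have level: "(\<Sum>x<2 ^ k. f (l, x div 2 ^ (k - l))) / 2 ^ k = (\<Sum>i<2 ^ l. f (l, i) / 2 ^ l)"
    if l: "l \<le> k" for l
  proof -
    have k: "(2::nat) ^ k = 2 ^ l * 2 ^ (k - l)" "(2::real) ^ k = 2 ^ l * 2 ^ (k - l)"
      using l by (simp_all flip: power_add)
    have "(\<Sum>x<2 ^ k. f (l, x div 2 ^ (k - l))) = 2 ^ (k - l) * (\<Sum>i<2 ^ l. f (l, i))"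
      unfolding k(1) by (subst sum_blocks) simp
    then show ?thesis
      by (simp add: k(2) sum_divide_distrib)
  qed
  have "(\<Sum>x<2 ^ k. \<Sum>a\<in>chain k x. f a) = (\<Sum>x<2 ^ k. \<Sum>l\<le>k. f (l, x div 2 ^ (k - l)))"
    unfolding chain_def by (intro sum.cong refl, subst sum.reindex) (auto simp: inj_on_def)
  also have "\<dots> = (\<Sum>l\<le>k. \<Sum>x<2 ^ k. f (l, x div 2 ^ (k - l)))"
    by (rule sum.swap)
  finally have "(\<Sum>x<2 ^ k. \<Sum>a\<in>chain k x. f a) / 2 ^ k = (\<Sum>l\<le>k. \<Sum>i<2 ^ l. f (l, i) / 2 ^ l)"
    using level by (simp add: sum_divide_distrib[of _ "{..k}"])
  then show ?thesis
    by (simp add: ivls_def sum.Sigma case_prod_unfold)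
qed

text \<open>Writes an area-weighted sum as an integral over cells, to which Cauchy-Schwarz, Jensen
  and Hoelder can be applied.\<close>

lemma sum_area:
  "(\<Sum>r\<in>rects k. f r * area r)
    = (\<Sum>x<2 ^ k. (\<Sum>y<2 ^ k. \<Sum>r\<in>chain k x \<times> chain k y. f r) / 2 ^ k) / 2 ^ k"
proof -
  have "(\<Sum>r\<in>rects k. f r * area r) = (\<Sum>a\<in>ivls k. (\<Sum>b\<in>ivls k. f (a, b) / 2 ^ fst b) / 2 ^ fst a)"
    unfolding rects_def
    by (simp add: sum.cartesian_product' area_def sum_divide_distrib field_simps)
  also have "\<dots> = (\<Sum>x<2 ^ k. \<Sum>a\<in>chain k x. (\<Sum>y<2 ^ k. \<Sum>b\<in>chain k y. f (a, b)) / 2 ^ k) / 2 ^ k"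
    by (simp only: sum_chain_average)
  also have "\<dots> = (\<Sum>x<2 ^ k. (\<Sum>y<2 ^ k. \<Sum>a\<in>chain k x. \<Sum>b\<in>chain k y. f (a, b)) / 2 ^ k) / 2 ^ k"
  proof -
    have "(\<Sum>a\<in>chain k x. (\<Sum>y<2 ^ k. g a y) / 2 ^ k) = (\<Sum>y<2 ^ k. \<Sum>a\<in>chain k x. g a y) / 2 ^ k"
      for x and g :: "ivl \<Rightarrow> nat \<Rightarrow> real"
      by (subst sum.swap) (simp add: sum_divide_distrib)
    then show ?thesis by simp
  qed
  finally show ?thesis
    by (simp add: sum.cartesian_product')
qed

lemma square_fn_nonneg [simp]: "0 \<le> square_fn k c x y"
  by (simp add: square_fn_def)

lemma L2_set_abs: "L2_set (\<lambda>i. \<bar>f i\<bar>) A = L2_set f A"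
  by (simp add: L2_set_def)

lemma L2_set_abs_mono: "(\<And>i. i \<in> A \<Longrightarrow> \<bar>f i\<bar> \<le> \<bar>g i\<bar>) \<Longrightarrow> L2_set f A \<le> L2_set g A"
  by (metis L2_set_abs L2_set_mono abs_ge_zero)

lemma square_fn_mono:
  assumes "\<And>r. r \<in> rects k \<Longrightarrow> \<bar>c r\<bar> \<le> \<bar>d r\<bar>" "x < 2 ^ k" "y < 2 ^ k"
  shows "square_fn k c x y \<le> square_fn k d x y"
  unfolding square_fn_def
  by (intro L2_set_abs_mono assms(1)) (use chain_subset assms(2,3) in \<open>auto simp: rects_def\<close>)

lemma abs_pair_c_le: "\<bar>pair_c k c d\<bar> \<le> (\<Sum>r\<in>rects k. \<bar>c r\<bar> * \<bar>d r\<bar> * area r)"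
  unfolding pair_c_def
  by (intro order_trans[OF sum_abs] sum_mono) (auto simp: abs_mult less_imp_le[OF area_pos])

lemma pair_c_scale_right: "pair_c k c (\<lambda>r. a * d r) = a * pair_c k c d"
  by (simp add: pair_c_def sum_distrib_left mult_ac)

lemma pair_c_commute: "pair_c k c d = pair_c k d c"
  by (simp add: pair_c_def mult_ac)

section \<open>The Hardy norm and its dual as lattice norms\<close>

context
  fixes p q :: real
  assumes p: "1 \<le> p" and q: "1 \<le> q"
begin

lemma hardy_c_pmean_mono:
  assumes "\<And>x y. x < 2 ^ k \<Longrightarrow> y < 2 ^ k \<Longrightarrow> 0 \<le> f x y \<and> f x y \<le> g x y"
  shows "pmean p {..<2 ^ k} (\<lambda>x. pmean q {..<2 ^ k} (f x)) \<le> pmean p {..<2 ^ k} (\<lambda>x. pmean q {..<2 ^ k} (g x))"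
  using assms by (intro pmean_mono p q) auto

lemma average_le_hardy_c:
  "(\<Sum>x<2 ^ k. (\<Sum>y<2 ^ k. square_fn k c x y) / 2 ^ k) / 2 ^ k \<le> hardy_c p q k c"
proof -
  have "(\<Sum>x<2 ^ k. (\<Sum>y<2 ^ k. square_fn k c x y) / 2 ^ k) / 2 ^ k
      \<le> (\<Sum>x<2 ^ k. pmean q {..<2 ^ k} (square_fn k c x)) / 2 ^ k"
    using pmean_jensen[OF q, of "{..<2 ^ k}" "square_fn k c _"]
    by (intro divide_right_mono sum_mono) auto
  also have "\<dots> \<le> hardy_c p q k c"
    unfolding hardy_c_def
    using pmean_jensen[OF p, of "{..<2 ^ k}" "\<lambda>x. pmean q {..<2 ^ k} (square_fn k c x)"] by simp
  finally show ?thesis .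
qed

text \<open>The triangle inequality is Minkowski three times: in l2 along the chains, then for q and
  for p. For \<open>lower\<close>, \<open>\<bar>c r\<bar> * area r\<close> is the integral of one
  coefficient over its rectangle, which lies below the integral of the square function, and Jensen
  bounds the latter by the norm.\<close>

lemma lattice_norm_hardy_c: "lattice_norm (rects k) area (hardy_c p q k)"
proof
  show "hardy_c p q k (\<lambda>r. c r + d r) \<le> hardy_c p q k c + hardy_c p q k d" for c d
  proof -
    have "hardy_c p q k (\<lambda>r. c r + d r) \<le>
        pmean p {..<2 ^ k} (\<lambda>x. pmean q {..<2 ^ k} (\<lambda>y. square_fn k c x y + square_fn k d x y))"
      unfolding hardy_c_def by (rule hardy_c_pmean_mono) (simp add: square_fn_def L2_set_triangle_ineq)
    also have "\<dots> \<le> pmean p {..<2 ^ k} (\<lambda>x. pmean q {..<2 ^ k} (square_fn k c x) + pmean q {..<2 ^ k} (square_fn k d x))"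
      by (intro pmean_mono[OF p] pmean_triangle[OF q]) auto
    also have "\<dots> \<le> hardy_c p q k c + hardy_c p q k d"
      unfolding hardy_c_def by (intro pmean_triangle[OF p]) auto
    finally show ?thesis .
  qed
  show mono: "hardy_c p q k c \<le> hardy_c p q k d" if "\<And>r. r \<in> rects k \<Longrightarrow> \<bar>c r\<bar> \<le> \<bar>d r\<bar>" for c d
    unfolding hardy_c_def by (rule hardy_c_pmean_mono) (simp add: square_fn_mono that)
  show "hardy_c p q k (\<lambda>r. a * c r) = \<bar>a\<bar> * hardy_c p q k c" for a c
  proof -
    have "square_fn k (\<lambda>r. a * c r) x y = \<bar>a\<bar> * square_fn k c x y" for x y
      unfolding square_fn_def L2_set_abs[of "\<lambda>r. a * c r", symmetric] abs_mult
      by (simp add: L2_set_abs flip: L2_set_right_distrib)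
    then show ?thesis
      by (simp add: hardy_c_def pmean_cmult p q)
  qed
  show "\<bar>c r\<bar> * area r \<le> hardy_c p q k c" if r: "r \<in> rects k" for r c
  proof -
    let ?f = "\<lambda>s. if s = r then \<bar>c r\<bar> else 0"
    have "\<bar>c r\<bar> * area r = (\<Sum>s\<in>rects k. ?f s * area s)"
      using r by (subst sum.remove[of _ r]) (auto intro!: sum.neutral)
    also have "\<dots> \<le> (\<Sum>x<2 ^ k. (\<Sum>y<2 ^ k. square_fn k c x y) / 2 ^ k) / 2 ^ k"
      unfolding sum_area
    proof (intro divide_right_mono sum_mono)
      fix x y :: nat
      show "(\<Sum>s\<in>chain k x \<times> chain k y. ?f s) \<le> square_fn k c x y"
        using member_le_L2_set[of "chain k x \<times> chain k y" r "\<lambda>r. \<bar>c r\<bar>"]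
        by (simp add: square_fn_def L2_set_abs)
    qed auto
    also have "\<dots> \<le> hardy_c p q k c"
      by (rule average_le_hardy_c)
    finally show ?thesis .
  qed
  show "hardy_c p q k c \<le> (\<Sum>r\<in>rects k. \<bar>c r\<bar>)" for c
  proof -
    let ?b = "\<Sum>r\<in>rects k. \<bar>c r\<bar>"
    have "hardy_c p q k c \<le> pmean p {..<(2::nat) ^ k} (\<lambda>x. pmean q {..<(2::nat) ^ k} (\<lambda>y. ?b))"
      unfolding hardy_c_def
    proof (rule hardy_c_pmean_mono, intro conjI)
      fix x y :: nat
      assume "x < 2 ^ k" "y < 2 ^ k"
      then have "(\<Sum>r\<in>chain k x \<times> chain k y. \<bar>c r\<bar>) \<le> ?b"
        unfolding rects_def using chain_subset by (intro sum_mono2) auto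
      then show "square_fn k c x y \<le> ?b"
        unfolding square_fn_def using L2_set_le_sum_abs order_trans by blast
    qed simp
    also have "\<dots> = ?b"
      by (simp add: pmean_const p q sum_nonneg lessThan_empty_iff)
    finally show ?thesis .
  qed
qed (simp_all add: rects_def)

interpretation hardy: lattice_norm "rects k" area "hardy_c p q k" for k
  by (rule lattice_norm_hardy_c)

lemma pair_c_bounded: "\<bar>pair_c k c d\<bar> \<le> (\<Sum>r\<in>rects k. \<bar>c r\<bar>) * hardy_c p q k d"
proof -
  have "(\<Sum>r\<in>rects k. \<bar>c r\<bar> * \<bar>d r\<bar> * area r) \<le> (\<Sum>r\<in>rects k. \<bar>c r\<bar> * hardy_c p q k d)"
    using hardy.lower[of _ k d] by (intro sum_mono) (auto simp: mult.assoc intro: mult_left_mono)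
  then show ?thesis
    using abs_pair_c_le[of k c d] by (simp add: sum_distrib_right)
qed

lemma bdd_above_dual_c: "bdd_above {\<bar>pair_c k c d\<bar> | d. hardy_c p q k d \<le> 1}"
proof (rule bdd_aboveI)
  fix t assume "t \<in> {\<bar>pair_c k c d\<bar> | d. hardy_c p q k d \<le> 1}"
  then obtain d where d: "t = \<bar>pair_c k c d\<bar>" "hardy_c p q k d \<le> 1"
    by auto
  have "(\<Sum>r\<in>rects k. \<bar>c r\<bar>) * hardy_c p q k d \<le> (\<Sum>r\<in>rects k. \<bar>c r\<bar>) * 1"
    by (intro mult_left_mono d sum_nonneg) auto
  then show "t \<le> (\<Sum>r\<in>rects k. \<bar>c r\<bar>)"
    using pair_c_bounded[of k c d] d by simp
qed

lemma dual_c_upper: "hardy_c p q k d \<le> 1 \<Longrightarrow> \<bar>pair_c k c d\<bar> \<le> dual_c p q k c"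
  unfolding dual_c_def by (intro cSup_upper bdd_above_dual_c) auto

lemma dual_c_least:
  assumes "\<And>d. hardy_c p q k d \<le> 1 \<Longrightarrow> \<bar>pair_c k c d\<bar> \<le> B"
  shows "dual_c p q k c \<le> B"
  unfolding dual_c_def using assms hardy.zero[of k]
  by (intro cSup_least) (auto intro!: exI[of _ "\<lambda>r. 0"])

lemma pair_c_le_dual: "\<bar>pair_c k c d\<bar> \<le> dual_c p q k c * hardy_c p q k d"
proof (cases "hardy_c p q k d = 0")
  case True
  then show ?thesis
    using pair_c_bounded[of k c d] by simp
next
  case False
  let ?t = "hardy_c p q k d"
  have t: "0 < ?t"
    using False hardy.nonneg[of k d] by linarith
  have "hardy_c p q k (\<lambda>r. (1 / ?t) * d r) \<le> 1"
    unfolding hardy.scale using t by simp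
  then have "\<bar>pair_c k c (\<lambda>r. (1 / ?t) * d r)\<bar> \<le> dual_c p q k c"
    by (rule dual_c_upper)
  then show ?thesis
    unfolding pair_c_scale_right using t by (simp add: abs_mult field_simps)
qed

lemma lattice_norm_dual_c: "lattice_norm (rects k) area (dual_c p q k)"
proof
  show "dual_c p q k (\<lambda>r. c r + d r) \<le> dual_c p q k c + dual_c p q k d" for c d
  proof (rule dual_c_least)
    fix g assume g: "hardy_c p q k g \<le> 1"
    have "pair_c k (\<lambda>r. c r + d r) g = pair_c k c g + pair_c k d g"
      by (simp add: pair_c_def algebra_simps sum.distrib)
    then show "\<bar>pair_c k (\<lambda>r. c r + d r) g\<bar> \<le> dual_c p q k c + dual_c p q k d"
      using dual_c_upper[OF g, of c] dual_c_upper[OF g, of d] by linarith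
  qed
  show "dual_c p q k c \<le> dual_c p q k d" if le: "\<And>r. r \<in> rects k \<Longrightarrow> \<bar>c r\<bar> \<le> \<bar>d r\<bar>" for c d
  proof (rule dual_c_least)
    fix g assume g: "hardy_c p q k g \<le> 1"
    \<comment> \<open>The Hardy norm ignores signs, so the test family may take over those of d. All
      terms of \<open>pair_c k d ?g\<close> are then nonnegative and dominate the terms of
      \<open>pair_c k c g\<close>.\<close>
    let ?g = "\<lambda>r. sgn (d r) * \<bar>g r\<bar>"
    have "hardy_c p q k ?g \<le> hardy_c p q k g"
      by (rule hardy.mono) (auto simp: abs_mult abs_sgn_eq)
    then have "\<bar>pair_c k d ?g\<bar> \<le> dual_c p q k d"
      using g by (intro dual_c_upper) simp
    moreover have "\<bar>pair_c k c g\<bar> \<le> (\<Sum>r\<in>rects k. \<bar>d r\<bar> * \<bar>g r\<bar> * area r)"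
      using le less_imp_le[OF area_pos]
      by (intro order_trans[OF abs_pair_c_le] sum_mono mult_right_mono) auto
    moreover have "(\<Sum>r\<in>rects k. \<bar>d r\<bar> * \<bar>g r\<bar> * area r) = pair_c k d ?g"
      unfolding pair_c_def by (intro sum.cong) (auto simp: abs_sgn mult_ac)
    ultimately show "\<bar>pair_c k c g\<bar> \<le> dual_c p q k d"
      by linarith
  qed
  have scale_le: "dual_c p q k (\<lambda>r. a * c r) \<le> \<bar>a\<bar> * dual_c p q k c" for a c
  proof (rule dual_c_least)
    fix g assume g: "hardy_c p q k g \<le> 1"
    have "pair_c k (\<lambda>r. a * c r) g = a * pair_c k c g"
      by (simp add: pair_c_def sum_distrib_left mult_ac)
    then show "\<bar>pair_c k (\<lambda>r. a * c r) g\<bar> \<le> \<bar>a\<bar> * dual_c p q k c"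
      using dual_c_upper[OF g, of c] by (simp add: abs_mult mult_left_mono)
  qed
  show "dual_c p q k (\<lambda>r. a * c r) = \<bar>a\<bar> * dual_c p q k c" for a c
  proof (cases "a = 0")
    case True
    have "0 \<le> dual_c p q k (\<lambda>r. 0)"
      using dual_c_upper[of k "\<lambda>r. 0" "\<lambda>r. 0"] by (simp add: hardy.zero)
    then show ?thesis
      using scale_le[of 0 c] True by simp
  next
    case False
    then have "\<bar>a\<bar> * dual_c p q k c \<le> dual_c p q k (\<lambda>r. a * c r)"
      using scale_le[of "1 / a" "\<lambda>r. a * c r"] by (simp add: field_simps)
    then show ?thesis
      using scale_le[of a c] by simp
  qed
  show "\<bar>c r\<bar> * area r \<le> dual_c p q k c" if r: "r \<in> rects k" for r c
  proof -
    \<comment> \<open>The unit family at r is admissible as a test family, its norm being at most 1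
      by \<open>hardy.upper\<close>.\<close>
    let ?d = "\<lambda>s. if s = r then 1 else 0 :: real"
    have "hardy_c p q k ?d \<le> 1"
      using r by (intro order_trans[OF hardy.upper]) (simp add: if_distrib cong: if_cong)
    then have "\<bar>pair_c k c ?d\<bar> \<le> dual_c p q k c"
      by (rule dual_c_upper)
    moreover have "pair_c k c ?d = c r * area r"
      unfolding pair_c_def using r by (subst sum.remove[of _ r]) (auto intro!: sum.neutral)
    ultimately show ?thesis
      by (simp add: abs_mult abs_of_pos[OF area_pos])
  qed
  show "dual_c p q k c \<le> (\<Sum>r\<in>rects k. \<bar>c r\<bar>)" for c
  proof (rule dual_c_least)
    fix g assume "hardy_c p q k g \<le> 1"
    then have "(\<Sum>r\<in>rects k. \<bar>c r\<bar>) * hardy_c p q k g \<le> (\<Sum>r\<in>rects k. \<bar>c r\<bar>) * 1"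
      by (intro mult_left_mono sum_nonneg) auto
    then show "\<bar>pair_c k c g\<bar> \<le> (\<Sum>r\<in>rects k. \<bar>c r\<bar>)"
      using pair_c_bounded[of k c g] by simp
  qed
qed (simp_all add: rects_def)

end

section \<open>Copies of the coarse Haar system\<close>

text \<open>
  \<open>copy m A I\<close> is the image of \<open>I\<close> under the affine map of \<open>[0, 1)\<close> onto the \<open>A\<close>-th interval
  of length \<open>2\<^sup>-\<^sup>m\<close>; \<open>block_index m\<close> and \<open>base_ivl m\<close> recover \<open>A\<close> and \<open>I\<close>.
\<close>

definition copy :: "nat \<Rightarrow> nat \<Rightarrow> ivl \<Rightarrow> ivl" where
  "copy m A I = (m + fst I, A * 2 ^ fst I + snd I)"

definition base_ivl :: "nat \<Rightarrow> ivl \<Rightarrow> ivl" where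
  "base_ivl m a = (fst a - m, snd a mod 2 ^ (fst a - m))"

definition block_index :: "nat \<Rightarrow> ivl \<Rightarrow> nat" where
  "block_index m a = snd a div 2 ^ (fst a - m)"

definition copy2 :: "nat \<Rightarrow> nat \<Rightarrow> nat \<Rightarrow> ivl \<times> ivl \<Rightarrow> ivl \<times> ivl" where
  "copy2 m A C r = (copy m A (fst r), copy m C (snd r))"

text \<open>In coefficients, a Haar function is sent to the sum of its copies with weights \<phi>.
  General weights are allowed because contractivity uses only that they are at most 1 in absolute
  value.\<close>

definition expand :: "nat \<Rightarrow> (ivl \<times> ivl \<Rightarrow> real) \<Rightarrow> (ivl \<times> ivl \<Rightarrow> real) \<Rightarrow> ivl \<times> ivl \<Rightarrow> real" where
  "expand m \<phi> c q = (if m \<le> fst (fst q) \<and> m \<le> fst (snd q)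
     then \<phi> q * c (base_ivl m (fst q), base_ivl m (snd q)) else 0)"

text \<open>The adjoint of \<open>expand\<close> for \<open>pair_c\<close>. The two averages account
  for the ratio 4^(-m) between the area of a copy and that of r.\<close>

definition compress :: "nat \<Rightarrow> (ivl \<times> ivl \<Rightarrow> real) \<Rightarrow> (ivl \<times> ivl \<Rightarrow> real) \<Rightarrow> ivl \<times> ivl \<Rightarrow> real" where
  "compress m \<phi> d r = (\<Sum>A<2 ^ m. (\<Sum>C<2 ^ m. \<phi> (copy2 m A C r) * d (copy2 m A C r)) / 2 ^ m) / 2 ^ m"

lemma copy_base_index: "m \<le> fst a \<Longrightarrow> copy m (block_index m a) (base_ivl m a) = a"
  by (auto simp: copy_def base_ivl_def block_index_def intro!: prod_eqI div_mult_mod_eq)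

lemma base_copy [simp]: "I \<in> ivls n \<Longrightarrow> base_ivl m (copy m A I) = I"
  and block_index_copy [simp]: "I \<in> ivls n \<Longrightarrow> block_index m (copy m A I) = A"
  and level_copy [simp]: "fst (copy m A I) = m + fst I"
  by (auto simp: copy_def base_ivl_def block_index_def ivls_def)

lemma inj_copy: "inj (\<lambda>A. copy m A I)"
  by (auto simp: copy_def inj_def)

lemma bij_betw_copy:
  "bij_betw (\<lambda>(I, A). copy m A I) (ivls n \<times> {..<2 ^ m}) {a \<in> ivls (m + n). m \<le> fst a}"
proof (rule bij_betw_byWitness[where f' = "\<lambda>a. (base_ivl m a, block_index m a)"])
  show "(\<lambda>(I, A). copy m A I) ` (ivls n \<times> {..<2 ^ m}) \<subseteq> {a \<in> ivls (m + n). m \<le> fst a}"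
  proof clarsimp
    fix l i A :: nat assume "(l, i) \<in> ivls n" "A < 2 ^ m"
    then have "l \<le> n" "i < 2 ^ l"
      by (auto simp: ivls_def)
    moreover have "Suc A * 2 ^ l \<le> 2 ^ m * 2 ^ l"
      by (rule mult_le_mono1) (use \<open>A < 2 ^ m\<close> in simp)
    ultimately show "copy m A (l, i) \<in> ivls (m + n)"
      by (auto simp: copy_def ivls_def power_add)
  qed
  show "(\<lambda>a. (base_ivl m a, block_index m a)) ` {a \<in> ivls (m + n). m \<le> fst a} \<subseteq> ivls n \<times> {..<2 ^ m}"
    by (auto simp: ivls_def base_ivl_def block_index_def less_mult_imp_div_less simp flip: power_add)
qed (auto simp: copy_base_index)

lemma copy_in_ivls: "I \<in> ivls n \<Longrightarrow> A < 2 ^ m \<Longrightarrow> copy m A I \<in> ivls (m + n)"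
  using bij_betwE[OF bij_betw_copy[of m n]] by auto

lemma copy2_in_rects: "r \<in> rects n \<Longrightarrow> A < 2 ^ m \<Longrightarrow> C < 2 ^ m \<Longrightarrow> copy2 m A C r \<in> rects (m + n)"
  by (auto simp: rects_def copy2_def copy_in_ivls)

lemma sum_copies:
  fixes f :: "ivl \<Rightarrow> real"
  assumes "\<And>a. a \<in> ivls (m + n) \<Longrightarrow> fst a < m \<Longrightarrow> f a = 0"
  shows "(\<Sum>a\<in>ivls (m + n). f a) = (\<Sum>I\<in>ivls n. \<Sum>A<2 ^ m. f (copy m A I))"
proof -
  have "(\<Sum>a\<in>ivls (m + n). f a) = (\<Sum>a\<in>{a \<in> ivls (m + n). m \<le> fst a}. f a)"
    using assms by (intro sum.mono_neutral_right) (auto simp: not_le)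
  also have "\<dots> = (\<Sum>(I, A)\<in>ivls n \<times> {..<2 ^ m}. f (copy m A I))"
    using sum.reindex_bij_betw[OF bij_betw_copy[of m n], of f] by (simp add: case_prod_unfold)
  finally show ?thesis
    by (simp add: sum.cartesian_product)
qed

lemma sum_copies2:
  fixes f :: "ivl \<times> ivl \<Rightarrow> real"
  assumes "\<And>q. q \<in> rects (m + n) \<Longrightarrow> \<not> (m \<le> fst (fst q) \<and> m \<le> fst (snd q)) \<Longrightarrow> f q = 0"
  shows "(\<Sum>q\<in>rects (m + n). f q) = (\<Sum>r\<in>rects n. \<Sum>A<2 ^ m. \<Sum>C<2 ^ m. f (copy2 m A C r))"
proof -
  have "(\<Sum>q\<in>rects (m + n). f q) = (\<Sum>a\<in>ivls (m + n). \<Sum>b\<in>ivls (m + n). f (a, b))"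
    by (simp add: rects_def sum.cartesian_product')
  also have "\<dots> = (\<Sum>I\<in>ivls n. \<Sum>A<2 ^ m. \<Sum>b\<in>ivls (m + n). f (copy m A I, b))"
    by (rule sum_copies) (auto intro!: sum.neutral assms simp: rects_def)
  also have "\<dots> = (\<Sum>I\<in>ivls n. \<Sum>A<2 ^ m. \<Sum>J\<in>ivls n. \<Sum>C<2 ^ m. f (copy m A I, copy m C J))"
    by (intro sum.cong refl sum_copies) (auto intro!: assms copy_in_ivls simp: rects_def)
  also have "\<dots> = (\<Sum>I\<in>ivls n. \<Sum>J\<in>ivls n. \<Sum>A<2 ^ m. \<Sum>C<2 ^ m. f (copy m A I, copy m C J))"
    by (intro sum.cong refl sum.swap)
  finally show ?thesis
    by (simp add: rects_def sum.cartesian_product' copy2_def)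
qed

lemma area_copy2: "area (copy2 m A C r) = area r / 2 ^ m / 2 ^ m"
  by (simp add: area_def copy2_def power_add)

lemma expand_copy2: "r \<in> rects n \<Longrightarrow> expand m \<phi> c (copy2 m A C r) = \<phi> (copy2 m A C r) * c r"
  by (auto simp: expand_def copy2_def rects_def)

section \<open>Adjointness and contractivity of the two maps\<close>

lemma pair_expand: "pair_c (m + n) (expand m \<phi> c) d = pair_c n c (compress m \<phi> d)"
proof -
  have "pair_c (m + n) (expand m \<phi> c) d = (\<Sum>r\<in>rects n. \<Sum>A<2 ^ m. \<Sum>C<2 ^ m.
      expand m \<phi> c (copy2 m A C r) * d (copy2 m A C r) * area (copy2 m A C r))"
    unfolding pair_c_def by (rule sum_copies2) (auto simp: expand_def)
  also have "\<dots> = pair_c n c (compress m \<phi> d)"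
    unfolding pair_c_def compress_def
    by (intro sum.cong refl)
      (simp add: expand_copy2 area_copy2 sum_distrib_left sum_distrib_right sum_divide_distrib mult_ac)
  finally show ?thesis .
qed

text \<open>In binary, \<open>A * 2 ^ n + x\<close> consists of the digits of A followed by the n
  digits of x. Dropping at most n final digits leaves A in front, so the intervals of length at most
  2^(-m) around the cell are the copies in block A of the chain of x.\<close>

lemma chain_copy:
  assumes "x < 2 ^ n"
  shows "chain (m + n) (A * 2 ^ n + x) \<inter> {a. m \<le> fst a} = copy m A ` chain n x"
proof -
  have div: "(A * 2 ^ n + x) div 2 ^ (n - l) = A * 2 ^ l + x div 2 ^ (n - l)" if "l \<le> n" for l
  proof -
    have "(2::nat) ^ n = 2 ^ l * 2 ^ (n - l)"
      using that by (simp flip: power_add)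
    then show ?thesis
      by (simp add: mult.assoc[symmetric])
  qed
  have "chain (m + n) (A * 2 ^ n + x) \<inter> {a. m \<le> fst a}
      = (\<lambda>l. (l, (A * 2 ^ n + x) div 2 ^ (m + n - l))) ` {m..m + n}"
    by (auto simp: chain_def)
  also have "{m..m + n} = (\<lambda>l. m + l) ` {..n}"
    by (simp add: image_add_atLeastAtMost atMost_atLeast0)
  finally show ?thesis
    by (simp add: image_image chain_def copy_def div cong: image_cong_simp)
qed

lemma square_fn_expand:
  assumes "\<And>q. \<bar>\<phi> q\<bar> \<le> 1" "x < 2 ^ n" "y < 2 ^ n"
  shows "square_fn (m + n) (expand m \<phi> c) (A * 2 ^ n + x) (C * 2 ^ n + y) \<le> square_fn n c x y"
proof -
  let ?X = "chain (m + n) (A * 2 ^ n + x)" and ?Y = "chain (m + n) (C * 2 ^ n + y)"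
  let ?T = "chain n x \<times> chain n y"
  have T: "?T \<subseteq> rects n"
    using chain_subset assms(2,3) by (auto simp: rects_def)
  have im: "(?X \<inter> {a. m \<le> fst a}) \<times> (?Y \<inter> {a. m \<le> fst a}) = copy2 m A C ` ?T"
    unfolding chain_copy[OF assms(2)] chain_copy[OF assms(3)]
    by (auto simp: copy2_def image_iff)
  have inj: "inj_on (copy2 m A C) ?T"
    by (auto simp: inj_on_def copy2_def copy_def)
  have "(\<Sum>q\<in>?X \<times> ?Y. (expand m \<phi> c q)\<^sup>2)
      = (\<Sum>q\<in>(?X \<inter> {a. m \<le> fst a}) \<times> (?Y \<inter> {a. m \<le> fst a}). (expand m \<phi> c q)\<^sup>2)"
    by (rule sum.mono_neutral_right) (auto simp: expand_def)
  also have "\<dots> = (\<Sum>r\<in>?T. (expand m \<phi> c (copy2 m A C r))\<^sup>2)"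
    unfolding im by (simp add: sum.reindex[OF inj])
  also have "\<dots> \<le> (\<Sum>r\<in>?T. (c r)\<^sup>2)"
  proof (rule sum_mono)
    fix r assume "r \<in> ?T"
    then have "\<bar>expand m \<phi> c (copy2 m A C r)\<bar> \<le> \<bar>c r\<bar>"
      using T assms(1)[of "copy2 m A C r"] by (subst expand_copy2) (auto simp: abs_mult mult_left_le_one_le)
    then show "(expand m \<phi> c (copy2 m A C r))\<^sup>2 \<le> (c r)\<^sup>2"
      by (simp add: abs_le_square_iff)
  qed
  finally show ?thesis
    unfolding square_fn_def L2_set_def by simp
qed

lemma L2_set_sum_le: "finite K \<Longrightarrow> L2_set (\<lambda>r. \<Sum>k\<in>K. f k r) T \<le> (\<Sum>k\<in>K. L2_set (f k) T)"
proof (induction K rule: finite_induct)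
  case (insert k K)
  then show ?case
    using L2_set_triangle_ineq[of "f k" "\<lambda>r. \<Sum>k\<in>K. f k r" T] by simp
qed (simp add: L2_set_def)

lemma square_fn_copy:
  assumes "\<And>q. \<bar>\<phi> q\<bar> \<le> 1" "x < 2 ^ n" "y < 2 ^ n"
  shows "square_fn n (\<lambda>r. \<phi> (copy2 m A C r) * d (copy2 m A C r)) x y
    \<le> square_fn (m + n) d (A * 2 ^ n + x) (C * 2 ^ n + y)"
proof -
  let ?T = "chain n x \<times> chain n y"
  have inj: "inj_on (copy2 m A C) ?T"
    by (auto simp: inj_on_def copy2_def copy_def)
  have "square_fn n (\<lambda>r. \<phi> (copy2 m A C r) * d (copy2 m A C r)) x y \<le> L2_set (\<lambda>r. d (copy2 m A C r)) ?T"
    unfolding square_fn_def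
    by (intro L2_set_abs_mono) (simp add: abs_mult assms(1) mult_left_le_one_le)
  also have "\<dots> = L2_set d (copy2 m A C ` ?T)"
    by (simp add: L2_set_def sum.reindex[OF inj])
  also have "\<dots> \<le> square_fn (m + n) d (A * 2 ^ n + x) (C * 2 ^ n + y)"
    unfolding square_fn_def L2_set_def
    using chain_copy[OF assms(2), of m A] chain_copy[OF assms(3), of m C]
    by (intro real_sqrt_le_mono sum_mono2) (auto simp: copy2_def)
  finally show ?thesis .
qed

lemma square_fn_compress:
  assumes "\<And>q. \<bar>\<phi> q\<bar> \<le> 1" "x < 2 ^ n" "y < 2 ^ n"
  shows "square_fn n (compress m \<phi> d) x y
    \<le> (\<Sum>A<2 ^ m. (\<Sum>C<2 ^ m. square_fn (m + n) d (A * 2 ^ n + x) (C * 2 ^ n + y)) / 2 ^ m) / 2 ^ m"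
proof -
  let ?f = "\<lambda>A C r. \<phi> (copy2 m A C r) * d (copy2 m A C r)"
  let ?T = "chain n x \<times> chain n y"
  have "square_fn n (compress m \<phi> d) x y
      = L2_set (\<lambda>r. 1 / 2 ^ m / 2 ^ m * (\<Sum>A<2 ^ m. \<Sum>C<2 ^ m. ?f A C r)) ?T"
    unfolding square_fn_def compress_def by (simp add: sum_divide_distrib)
  also have "\<dots> = 1 / 2 ^ m / 2 ^ m * L2_set (\<lambda>r. \<Sum>A<2 ^ m. \<Sum>C<2 ^ m. ?f A C r) ?T"
    by (rule L2_set_right_distrib[symmetric]) simp
  also have "\<dots> \<le> 1 / 2 ^ m / 2 ^ m * (\<Sum>A<2 ^ m. \<Sum>C<2 ^ m. square_fn n (?f A C) x y)"
    unfolding square_fn_def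
    by (intro mult_left_mono order_trans[OF L2_set_sum_le] sum_mono) auto
  also have "\<dots> \<le> 1 / 2 ^ m / 2 ^ m *
      (\<Sum>A<2 ^ m. \<Sum>C<2 ^ m. square_fn (m + n) d (A * 2 ^ n + x) (C * 2 ^ n + y))"
    by (intro mult_left_mono sum_mono square_fn_copy assms) auto
  finally show ?thesis
    by (simp add: sum_divide_distrib)
qed

lemma hardy_c_blocks:
  assumes "1 \<le> p" "1 \<le> q"
  shows "hardy_c p q (m + n) c = pmean p {..<2 ^ n} (\<lambda>x. pmean p {..<2 ^ m} (\<lambda>A.
    pmean q {..<2 ^ n} (\<lambda>y. pmean q {..<2 ^ m} (\<lambda>C.
      square_fn (m + n) c (A * 2 ^ n + x) (C * 2 ^ n + y)))))"
  unfolding hardy_c_def power_add by (simp add: pmean_blocks assms)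

text \<open>After the splitting into blocks the bound on each cell no longer depends on A and C, and
  means of constants are constants.\<close>

lemma expand_contractive:
  assumes "1 \<le> p" "1 \<le> q" "\<And>q. \<bar>\<phi> q\<bar> \<le> 1"
  shows "hardy_c p q (m + n) (expand m \<phi> c) \<le> hardy_c p q n c"
proof -
  have "hardy_c p q (m + n) (expand m \<phi> c) \<le> pmean p {..<2 ^ n} (\<lambda>x. pmean p {..<(2::nat) ^ m} (\<lambda>A.
    pmean q {..<2 ^ n} (\<lambda>y. pmean q {..<(2::nat) ^ m} (\<lambda>C. square_fn n c x y))))"
    unfolding hardy_c_blocks[OF assms(1,2)]
    by (intro pmean_mono assms square_fn_expand) auto
  also have "\<dots> = hardy_c p q n c"
    by (simp add: pmean_const assms hardy_c_def lessThan_empty_iff)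
  finally show ?thesis .
qed

lemma compress_contractive:
  assumes "1 \<le> p" "1 \<le> q" "\<And>q. \<bar>\<phi> q\<bar> \<le> 1"
  shows "hardy_c p q n (compress m \<phi> d) \<le> hardy_c p q (m + n) d"
proof -
  define g where "g x A y C = square_fn (m + n) d (A * 2 ^ n + x) (C * 2 ^ n + y)" for x A y C
  have g: "0 \<le> g x A y C" for x A y C
    by (simp add: g_def)
  have avg: "pmean r {..<2 ^ n} (\<lambda>x. (\<Sum>A<2 ^ m. f A x) / 2 ^ m) \<le> (\<Sum>A<2 ^ m. pmean r {..<2 ^ n} (f A)) / 2 ^ m"
    if "1 \<le> r" "\<And>A x. 0 \<le> f A x" for r and f :: "nat \<Rightarrow> nat \<Rightarrow> real"
    using pmean_average[of r "{..<2 ^ n}" "{..<2 ^ m}" f] that by simp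
  have jensen: "(\<Sum>A<2 ^ m. f A) / 2 ^ m \<le> pmean r {..<2 ^ m} f"
    if "1 \<le> r" "\<And>A. 0 \<le> f A" for r and f :: "nat \<Rightarrow> real"
    using pmean_jensen[of r "{..<2 ^ m}" f] that by simp
  have "hardy_c p q n (compress m \<phi> d) \<le>
      pmean p {..<2 ^ n} (\<lambda>x. pmean q {..<2 ^ n} (\<lambda>y. (\<Sum>A<2 ^ m. (\<Sum>C<2 ^ m. g x A y C) / 2 ^ m) / 2 ^ m))"
    unfolding hardy_c_def g_def
    by (intro pmean_mono assms square_fn_compress) auto
  also have "\<dots> \<le> pmean p {..<2 ^ n} (\<lambda>x. pmean p {..<2 ^ m} (\<lambda>A. pmean q {..<2 ^ n} (\<lambda>y. pmean q {..<2 ^ m} (g x A y))))"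
  proof (intro pmean_mono assms pmean_nonneg)
    fix x :: nat
    \<comment> \<open>The average over A belongs to the variable x but stands inside the q-mean in
      y. Minkowski moves it out, without any relation between p and q; Jensen then turns the
      averages over C and A into a q-mean and a p-mean.\<close>
    have "pmean q {..<2 ^ n} (\<lambda>y. (\<Sum>A<2 ^ m. (\<Sum>C<2 ^ m. g x A y C) / 2 ^ m) / 2 ^ m)
        \<le> (\<Sum>A<2 ^ m. pmean q {..<2 ^ n} (\<lambda>y. (\<Sum>C<2 ^ m. g x A y C) / 2 ^ m)) / 2 ^ m"
      by (intro avg assms divide_nonneg_nonneg sum_nonneg g) auto
    also have "\<dots> \<le> (\<Sum>A<2 ^ m. pmean q {..<2 ^ n} (\<lambda>y. pmean q {..<2 ^ m} (g x A y))) / 2 ^ m"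
      by (intro divide_right_mono sum_mono pmean_mono jensen assms divide_nonneg_nonneg sum_nonneg g) auto
    also have "\<dots> \<le> pmean p {..<2 ^ m} (\<lambda>A. pmean q {..<2 ^ n} (\<lambda>y. pmean q {..<2 ^ m} (g x A y)))"
      by (intro jensen assms) auto
    finally show "pmean q {..<2 ^ n} (\<lambda>y. (\<Sum>A<2 ^ m. (\<Sum>C<2 ^ m. g x A y C) / 2 ^ m) / 2 ^ m) \<le> \<dots>" .
  qed
  also have "\<dots> = hardy_c p q (m + n) d"
    by (simp add: hardy_c_blocks assms g_def[abs_def])
  finally show ?thesis .
qed

lemma expand_contractive_dual:
  assumes "1 \<le> p" "1 \<le> q" "\<And>q. \<bar>\<phi> q\<bar> \<le> 1"
  shows "dual_c p q (m + n) (expand m \<phi> c) \<le> dual_c p q n c"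
proof (rule dual_c_least[OF assms(1,2)])
  fix d assume "hardy_c p q (m + n) d \<le> 1"
  then have "hardy_c p q n (compress m \<phi> d) \<le> 1"
    by (rule order_trans[OF compress_contractive[OF assms]])
  then show "\<bar>pair_c (m + n) (expand m \<phi> c) d\<bar> \<le> dual_c p q n c"
    unfolding pair_expand by (rule dual_c_upper[OF assms(1,2)])
qed

lemma compress_contractive_dual:
  assumes "1 \<le> p" "1 \<le> q" "\<And>q. \<bar>\<phi> q\<bar> \<le> 1"
  shows "dual_c p q n (compress m \<phi> c) \<le> dual_c p q (m + n) c"
proof (rule dual_c_least[OF assms(1,2)])
  fix d assume "hardy_c p q n d \<le> 1"
  then have "hardy_c p q (m + n) (expand m \<phi> d) \<le> 1"
    by (rule order_trans[OF expand_contractive[OF assms]])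
  then have "\<bar>pair_c (m + n) c (expand m \<phi> d)\<bar> \<le> dual_c p q (m + n) c"
    by (rule dual_c_upper[OF assms(1,2)])
  then show "\<bar>pair_c n (compress m \<phi> c) d\<bar> \<le> dual_c p q (m + n) c"
    by (simp add: pair_c_commute[of "m + n" c] pair_expand pair_c_commute[of n d])
qed

section \<open>Families supported on the copies of one rectangle\<close>

definition block :: "nat \<Rightarrow> ivl \<times> ivl \<Rightarrow> nat set \<Rightarrow> nat set \<Rightarrow> (ivl \<times> ivl \<Rightarrow> real) \<Rightarrow> bool" where
  "block m r \<A> \<C> c \<longleftrightarrow>
    (\<forall>q. \<bar>c q\<bar> \<le> of_bool (\<exists>A\<in>\<A>. \<exists>C\<in>\<C>. q = copy2 m A C r))"

text \<open>A chain has one interval of each length, so at most one copy of r contains the cell, and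
  the square function there is a single coefficient.\<close>

lemma square_fn_block:
  assumes "r \<in> rects n" "block m r \<A> \<C> c"
  shows "square_fn (m + n) c x y \<le> of_bool (x div 2 ^ n \<in> \<A>) * of_bool (y div 2 ^ n \<in> \<C>)"
proof -
  obtain l i l' i' where r: "r = ((l, i), (l', i'))"
    by (metis surj_pair)
  have l: "l \<le> n" "i < 2 ^ l" "l' \<le> n" "i' < 2 ^ l'"
    using assms(1) by (auto simp: r rects_def ivls_def)
  let ?q = "((m + l, x div 2 ^ (n - l)), (m + l', y div 2 ^ (n - l')))"
  let ?T = "chain (m + n) x \<times> chain (m + n) y"
  have q: "?q \<in> ?T"
    using l by (auto simp: chain_def image_iff)
  have supp: "c q = 0" if "q \<in> ?T" "q \<noteq> ?q" for q
  proof -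
    have "\<not> (\<exists>A\<in>\<A>. \<exists>C\<in>\<C>. q = copy2 m A C r)"
      using that by (auto simp: chain_def copy2_def copy_def r)
    then show ?thesis
      using assms(2)[unfolded block_def, THEN spec, of q] by auto
  qed
  have div: "u div 2 ^ n = A" if "u div 2 ^ (n - l) = A * 2 ^ l + i" "l \<le> n" "i < 2 ^ l" for u A l i :: nat
  proof -
    have "u div 2 ^ n = u div 2 ^ (n - l) div 2 ^ l"
      using that(2) by (simp add: div_mult2_eq[symmetric] power_add[symmetric])
    then show ?thesis
      using that by simp
  qed
  have "square_fn (m + n) c x y = sqrt (\<Sum>q\<in>{?q}. (c q)\<^sup>2)"
    unfolding square_fn_def L2_set_def using q supp
    by (intro arg_cong[where f = sqrt] sum.mono_neutral_right) auto
  then have "square_fn (m + n) c x y = \<bar>c ?q\<bar>"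
    by simp
  also have "\<dots> \<le> of_bool (\<exists>A\<in>\<A>. \<exists>C\<in>\<C>. ?q = copy2 m A C r)"
    using assms(2) unfolding block_def by blast
  also have "\<dots> \<le> of_bool (x div 2 ^ n \<in> \<A> \<and> y div 2 ^ n \<in> \<C>)"
    using div[of x l _ i] div[of y l' _ i'] l by (auto simp: copy2_def copy_def r)
  finally show ?thesis
    by (simp only: of_bool_conj)
qed

text \<open>The square function lies below the indicator of a product set, whose mixed norm
  factorises.\<close>

lemma hardy_c_block:
  assumes "1 \<le> p" "1 \<le> q" "r \<in> rects n" "block m r \<A> \<C> c" "\<A> \<subseteq> {..<2 ^ m}" "\<C> \<subseteq> {..<2 ^ m}"
  shows "hardy_c p q (m + n) c \<le> (card \<A> / 2 ^ m) powr (1 / p) * (card \<C> / 2 ^ m) powr (1 / q)"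
    (is "_ \<le> _ * ?K")
proof -
  have inner: "pmean q {..<2 ^ m} (\<lambda>C. of_bool (A \<in> \<A>) * of_bool (C \<in> \<C>)) = of_bool (A \<in> \<A>) * ?K" for A
    using pmean_indicator[OF _ assms(6), of q] by (subst pmean_cmult[OF assms(2)]) auto
  have outer: "pmean p {..<2 ^ m} (\<lambda>A. of_bool (A \<in> \<A>) * ?K) = (card \<A> / 2 ^ m) powr (1 / p) * ?K"
    using pmean_indicator[OF _ assms(5), of p] pmean_cmult[OF assms(1), of ?K "{..<2 ^ m}" "\<lambda>A. of_bool (A \<in> \<A>)"]
    by (simp add: mult.commute)
  have "hardy_c p q (m + n) c \<le> pmean p {..<(2::nat) ^ n} (\<lambda>x. pmean p {..<2 ^ m} (\<lambda>A.
      pmean q {..<(2::nat) ^ n} (\<lambda>y. pmean q {..<2 ^ m} (\<lambda>C. of_bool (A \<in> \<A>) * of_bool (C \<in> \<C>)))))"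
    unfolding hardy_c_blocks[OF assms(1,2)]
  proof (intro pmean_mono assms(1,2) pmean_nonneg square_fn_nonneg)
    fix x A y C :: nat
    assume "x \<in> {..<2 ^ n}" "y \<in> {..<2 ^ n}"
    then have "(A * 2 ^ n + x) div 2 ^ n = A" "(C * 2 ^ n + y) div 2 ^ n = C"
      by auto
    then show "square_fn (m + n) c (A * 2 ^ n + x) (C * 2 ^ n + y) \<le> of_bool (A \<in> \<A>) * of_bool (C \<in> \<C>)"
      using square_fn_block[OF assms(3,4), of "A * 2 ^ n + x" "C * 2 ^ n + y"] by (simp only:)
  qed
  also have "\<dots> = (card \<A> / 2 ^ m) powr (1 / p) * ?K"
    unfolding inner outer by (simp add: pmean_const assms(1,2) lessThan_empty_iff outer)
  finally show ?thesis .
qed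

lemma hoelder_block:
  assumes "1 \<le> p" "\<A> \<subseteq> {..<2 ^ m}" "\<And>x. 0 \<le> f x"
  shows "(\<Sum>x<2 ^ (m + n). of_bool (x div 2 ^ n \<in> \<A>) * f x) / 2 ^ (m + n)
    \<le> (card \<A> / 2 ^ m) powr (1 - 1 / p) * pmean p {..<(2::nat) ^ (m + n)} f"
proof (cases "\<A> = {}")
  case False
  define X where "X = {x \<in> {..<(2::nat) ^ (m + n)}. x div 2 ^ n \<in> \<A>}"
  have "real (card X) = (\<Sum>x<2 ^ m * 2 ^ n. of_bool (x div 2 ^ n \<in> \<A>))"
    by (simp add: X_def power_add Collect_conj_eq lessThan_def Int_commute)
  also have "\<dots> = card \<A> * 2 ^ n"
    using assms(2) by (subst sum_blocks) (simp add: Int_absorb1)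
  finally have card: "card X / 2 ^ (m + n) = card \<A> / 2 ^ m"
    by (simp add: power_add)
  have "card \<A> \<noteq> 0"
    using False assms(2) finite_subset by (auto simp: card_eq_0_iff)
  then have "X \<noteq> {}"
    using card by force
  have X: "X \<subseteq> {..<2 ^ (m + n)}"
    by (auto simp: X_def)
  have sum_X: "(\<Sum>x<2 ^ (m + n). of_bool (x div 2 ^ n \<in> \<A>) * f x) = (\<Sum>x\<in>X. f x)"
    unfolding X_def by (rule sum.mono_neutral_cong_right) auto
  show ?thesis
    using pmean_hoelder[of p "{..<2 ^ (m + n)}" X f, OF assms(1) _ X \<open>X \<noteq> {}\<close> assms(3)] card
    unfolding sum_X by simp
qed simp

text \<open>Cauchy-Schwarz along the chains separates c from the test family. Hoelder in y over the
  blocks of \<C> and in x over those of \<A> then produces the conjugate exponents.\<close>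

lemma dual_c_block:
  assumes "1 \<le> p" "1 \<le> q" "r \<in> rects n" "block m r \<A> \<C> c" "\<A> \<subseteq> {..<2 ^ m}" "\<C> \<subseteq> {..<2 ^ m}"
  shows "dual_c p q (m + n) c \<le> (card \<A> / 2 ^ m) powr (1 - 1 / p) * (card \<C> / 2 ^ m) powr (1 - 1 / q)"
    (is "_ \<le> ?a * ?b")
proof (rule dual_c_least[OF assms(1,2)])
  fix d assume d: "hardy_c p q (m + n) d \<le> 1"
  let ?N = "m + n"
  have "\<bar>pair_c ?N c d\<bar> \<le> (\<Sum>q\<in>rects ?N. \<bar>c q\<bar> * \<bar>d q\<bar> * area q)"
    by (rule abs_pair_c_le)
  also have "\<dots> \<le> (\<Sum>x<2 ^ ?N. (\<Sum>y<2 ^ ?N. of_bool (x div 2 ^ n \<in> \<A>) * (of_bool (y div 2 ^ n \<in> \<C>) * square_fn ?N d x y)) / 2 ^ ?N) / 2 ^ ?N"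
    unfolding sum_area
  proof (intro divide_right_mono sum_mono)
    fix x y :: nat
    have "(\<Sum>r\<in>chain ?N x \<times> chain ?N y. \<bar>c r\<bar> * \<bar>d r\<bar>) \<le> square_fn ?N c x y * square_fn ?N d x y"
      unfolding square_fn_def by (rule L2_set_mult_ineq)
    also have "\<dots> \<le> (of_bool (x div 2 ^ n \<in> \<A>) * of_bool (y div 2 ^ n \<in> \<C>)) * square_fn ?N d x y"
      by (intro mult_right_mono square_fn_block[OF assms(3,4)] square_fn_nonneg)
    finally show "(\<Sum>r\<in>chain ?N x \<times> chain ?N y. \<bar>c r\<bar> * \<bar>d r\<bar>)
        \<le> of_bool (x div 2 ^ n \<in> \<A>) * (of_bool (y div 2 ^ n \<in> \<C>) * square_fn ?N d x y)"
      by (simp only: mult.assoc)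
  qed auto
  also have "\<dots> = (\<Sum>x<2 ^ ?N. of_bool (x div 2 ^ n \<in> \<A>) *
      ((\<Sum>y<2 ^ ?N. of_bool (y div 2 ^ n \<in> \<C>) * square_fn ?N d x y) / 2 ^ ?N)) / 2 ^ ?N"
    by (simp only: sum_distrib_left times_divide_eq_right)
  also have "\<dots> \<le> (\<Sum>x<2 ^ ?N. of_bool (x div 2 ^ n \<in> \<A>) *
      (?b * pmean q {..<2 ^ ?N} (square_fn ?N d x))) / 2 ^ ?N"
    by (intro divide_right_mono sum_mono mult_left_mono hoelder_block assms) auto
  also have "\<dots> = ?b * ((\<Sum>x<2 ^ ?N. of_bool (x div 2 ^ n \<in> \<A>) * pmean q {..<2 ^ ?N} (square_fn ?N d x)) / 2 ^ ?N)"
    by (simp add: sum_distrib_left mult_ac)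
  also have "\<dots> \<le> ?b * (?a * hardy_c p q ?N d)"
    unfolding hardy_c_def by (intro mult_left_mono hoelder_block assms) auto
  also have "\<dots> \<le> ?b * (?a * 1)"
    by (intro mult_left_mono d) auto
  finally show "\<bar>pair_c ?N c d\<bar> \<le> ?a * ?b"
    by (simp add: mult.commute)
qed

section \<open>Second moments of random block entries\<close>

text \<open>For fixed R and S, \<tau> stands for the pairings of T applied to the copy of R at (A,
  C) with the copy of S at (A', C'). The condition is a restricted-type estimate: singletons give
  bounds for entries, singletons against full sets bounds for row and column sums.\<close>

definition tensor_bound :: "nat \<Rightarrow> real \<Rightarrow> real \<Rightarrow> real \<Rightarrow> (nat \<Rightarrow> nat \<Rightarrow> nat \<Rightarrow> nat \<Rightarrow> real) \<Rightarrow> bool" where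
  "tensor_bound M G \<alpha> \<beta> \<tau> \<longleftrightarrow> (\<forall>\<A> \<C> \<A>' \<C>' u v.
    \<A> \<subseteq> {..<M} \<longrightarrow> \<C> \<subseteq> {..<M} \<longrightarrow> \<A>' \<subseteq> {..<M} \<longrightarrow> \<C>' \<subseteq> {..<M} \<longrightarrow>
    (\<forall>A C. \<bar>u A C\<bar> \<le> 1) \<longrightarrow> (\<forall>A C. \<bar>v A C\<bar> \<le> 1) \<longrightarrow>
    \<bar>\<Sum>A\<in>\<A>. \<Sum>C\<in>\<C>. \<Sum>A'\<in>\<A>'. \<Sum>C'\<in>\<C>'. u A C * v A' C' * \<tau> A C A' C'\<bar>
      \<le> G * ((card \<A> / M) powr \<alpha> * (card \<C> / M) powr \<beta>)
          * ((card \<A>' / M) powr (1 - \<alpha>) * (card \<C>' / M) powr (1 - \<beta>)))"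

lemma tensor_boundD:
  fixes u v :: "nat \<Rightarrow> nat \<Rightarrow> real"
  assumes "tensor_bound M G \<alpha> \<beta> \<tau>"
    "\<A> \<subseteq> {..<M}" "\<C> \<subseteq> {..<M}" "\<A>' \<subseteq> {..<M}" "\<C>' \<subseteq> {..<M}"
    "\<And>A C. \<bar>u A C\<bar> \<le> 1" "\<And>A C. \<bar>v A C\<bar> \<le> 1"
  shows "\<bar>\<Sum>A\<in>\<A>. \<Sum>C\<in>\<C>. \<Sum>A'\<in>\<A>'. \<Sum>C'\<in>\<C>'. u A C * v A' C' * \<tau> A C A' C'\<bar>
    \<le> G * ((card \<A> / M) powr \<alpha> * (card \<C> / M) powr \<beta>)
          * ((card \<A>' / M) powr (1 - \<alpha>) * (card \<C>' / M) powr (1 - \<beta>))"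
  using assms unfolding tensor_bound_def by blast

text \<open>Exchanging the two variables carries statements on traces over C to traces over
  A.\<close>

lemma tensor_bound_swap:
  assumes "tensor_bound M G \<alpha> \<beta> \<tau>"
  shows "tensor_bound M G \<beta> \<alpha> (\<lambda>C A C' A'. \<tau> A C A' C')"
  unfolding tensor_bound_def
proof (intro allI impI)
  fix \<C> \<A> \<C>' \<A>' and u v :: "nat \<Rightarrow> nat \<Rightarrow> real"
  assume *: "\<C> \<subseteq> {..<M}" "\<A> \<subseteq> {..<M}" "\<C>' \<subseteq> {..<M}" "\<A>' \<subseteq> {..<M}"
    "\<forall>A C. \<bar>u A C\<bar> \<le> 1" "\<forall>A C. \<bar>v A C\<bar> \<le> 1"
  have "(\<Sum>C\<in>\<C>. \<Sum>A\<in>\<A>. \<Sum>C'\<in>\<C>'. \<Sum>A'\<in>\<A>'. u C A * v C' A' * \<tau> A C A' C')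
      = (\<Sum>A\<in>\<A>. \<Sum>C\<in>\<C>. \<Sum>C'\<in>\<C>'. \<Sum>A'\<in>\<A>'. u C A * v C' A' * \<tau> A C A' C')"
    by (rule sum.swap)
  also have "\<dots> = (\<Sum>A\<in>\<A>. \<Sum>C\<in>\<C>. \<Sum>A'\<in>\<A>'. \<Sum>C'\<in>\<C>'. u C A * v C' A' * \<tau> A C A' C')"
    by (intro sum.cong refl sum.swap)
  finally show "\<bar>\<Sum>C\<in>\<C>. \<Sum>A\<in>\<A>. \<Sum>C'\<in>\<C>'. \<Sum>A'\<in>\<A>'. u C A * v C' A' * \<tau> A C A' C'\<bar>
      \<le> G * ((card \<C> / M) powr \<beta> * (card \<A> / M) powr \<alpha>)
          * ((card \<C>' / M) powr (1 - \<beta>) * (card \<A>' / M) powr (1 - \<alpha>))"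
    using tensor_boundD[OF assms *(2,1,4,3), of "\<lambda>A C. u C A" "\<lambda>A C. v C A"] *(5,6)
    by (simp add: mult_ac)
qed

lemma sum_abs_eq_sgn: "(\<Sum>k\<in>K. \<bar>f k\<bar>) = (\<Sum>k\<in>K. sgn (f k) * (f k :: real))"
  by (intro sum.cong) (auto simp: abs_sgn mult.commute)

lemma abs_sgn_le_1: "\<bar>sgn (x::real)\<bar> \<le> 1"
  by (simp add: abs_sgn_eq)

text \<open>Here \<tau> is read as a matrix on M * M points. In terms of that number the exponent of
  the row sums is the mean of \<alpha> and \<beta>.\<close>

lemma tensor_square_sum:
  assumes "tensor_bound M G \<alpha> \<beta> \<tau>" "0 < M" "0 \<le> G"
  shows "(\<Sum>A<M. \<Sum>A'<M. \<Sum>C<M. \<Sum>C'<M. (\<tau> A C A' C')\<^sup>2) \<le> G\<^sup>2 * M powr (- (1 / 2))"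
proof -
  let ?S = "{..<M} \<times> {..<M}"
  let ?z = "\<lambda>a b. \<tau> (fst a) (snd a) (fst b) (snd b)"
  note B = tensor_boundD[OF assms(1)]
  have M: "real M > 0" using assms(2) by simp
  have powr: "(1 / real M) powr s * (1 / real M) powr t = real (M * M) powr (- ((s + t) / 2))" for s t
  proof -
    have sq: "real (M * M) = real M powr 2"
      using M by (simp add: powr_numeral power2_eq_square)
    have "(1 / real M) powr s * (1 / real M) powr t = real M powr (- (s + t))"
      unfolding powr_minus_divide powr_add by (simp add: powr_divide)
    also have "\<dots> = real (M * M) powr (- ((s + t) / 2))"
      unfolding sq powr_powr by (simp add: add_divide_distrib)
    finally show ?thesis .
  qed
  have "(\<Sum>a\<in>?S. \<Sum>b\<in>?S. (?z a b)\<^sup>2) \<le> G\<^sup>2 * real (M * M) powr (- (1 / 2))"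
  proof (rule sum_square_gain[where \<alpha> = "(\<alpha> + \<beta>) / 2"])
    fix a b assume a: "a \<in> ?S" and b: "b \<in> ?S"
    have "\<bar>?z a b\<bar> \<le> G * ((1 / M) powr \<alpha> * (1 / M) powr \<beta>) * ((1 / M) powr (1 - \<alpha>) * (1 / M) powr (1 - \<beta>))"
      using B[of "{fst a}" "{snd a}" "{fst b}" "{snd b}" "\<lambda>_ _. 1" "\<lambda>_ _. 1"] a b by auto
    also have "\<dots> = G / (M * M)"
    proof -
      have "(1 / M) powr \<alpha> * (1 / M) powr (1 - \<alpha>) = 1 / M" "(1 / M) powr \<beta> * (1 / M) powr (1 - \<beta>) = 1 / M"
        using M by (simp_all flip: powr_add)
      then show ?thesis
        by (metis (no_types, lifting) mult.assoc mult.left_commute of_nat_mult times_divide_eq_right mult.right_neutral divide_divide_eq_left)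
    qed
    finally show "\<bar>?z a b\<bar> \<le> G / real (M * M)" by simp
  next
    fix a assume a: "a \<in> ?S"
    \<comment> \<open>With the signs of the entries as test weights, the row sum becomes a value of
      the bilinear form.\<close>
    have "(\<Sum>b\<in>?S. \<bar>?z a b\<bar>) = \<bar>\<Sum>b\<in>?S. sgn (?z a b) * ?z a b\<bar>"
      by (simp only: sum_abs_eq_sgn[symmetric]) (simp add: sum_nonneg)
    also have "\<dots> \<le> G * ((1 / M) powr \<alpha> * (1 / M) powr \<beta>)"
      using B[of "{fst a}" "{snd a}" "{..<M}" "{..<M}" "\<lambda>_ _. 1" "\<lambda>A' C'. sgn (\<tau> (fst a) (snd a) A' C')"] a assms(2)
      by (auto simp: abs_sgn_le_1 sum.cartesian_product')
    finally show "(\<Sum>b\<in>?S. \<bar>?z a b\<bar>) \<le> G * real (M * M) powr (- ((\<alpha> + \<beta>) / 2))"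
      by (simp only: powr)
  next
    fix b assume b: "b \<in> ?S"
    have "(\<Sum>a\<in>?S. \<bar>?z a b\<bar>) = \<bar>\<Sum>a\<in>?S. sgn (?z a b) * ?z a b\<bar>"
      by (simp only: sum_abs_eq_sgn[symmetric]) (simp add: sum_nonneg)
    also have "\<dots> \<le> G * ((1 / M) powr (1 - \<alpha>) * (1 / M) powr (1 - \<beta>))"
      using B[of "{..<M}" "{..<M}" "{fst b}" "{snd b}" "\<lambda>A C. sgn (\<tau> A C (fst b) (snd b))" "\<lambda>_ _. 1"] b assms(2)
      by (auto simp: abs_sgn_le_1 sum.cartesian_product')
    also have "\<dots> = G * real (M * M) powr (- (1 - (\<alpha> + \<beta>) / 2))"
      unfolding powr by (simp add: field_simps)
    finally show "(\<Sum>a\<in>?S. \<bar>?z a b\<bar>) \<le> G * real (M * M) powr (- (1 - (\<alpha> + \<beta>) / 2))" .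
  qed (use assms in auto)
  \<comment> \<open>The rate reached so far is 1/M; it is weakened to the one available for the
    partial traces.\<close>
  also have "\<dots> \<le> G\<^sup>2 * M powr (- (1 / 2))"
    using assms(2) by (intro mult_left_mono powr_mono2') auto
  also have "(\<Sum>a\<in>?S. \<Sum>b\<in>?S. (?z a b)\<^sup>2) = (\<Sum>A<M. \<Sum>C<M. \<Sum>A'<M. \<Sum>C'<M. (\<tau> A C A' C')\<^sup>2)"
    by (simp add: sum.cartesian_product')
  also have "\<dots> = (\<Sum>A<M. \<Sum>A'<M. \<Sum>C<M. \<Sum>C'<M. (\<tau> A C A' C')\<^sup>2)"
    by (intro sum.cong refl sum.swap)
  finally show ?thesis .
qed

text \<open>
  Averaging \<open>\<Sum> a\<^sub>A \<epsilon>\<^sub>C b\<^sub>A\<^sub>' \<epsilon>\<^sub>C\<^sub>' \<tau>\<close> over the signs \<open>\<epsilon>\<close> leaves the terms with \<open>C = C'\<close>, so the partial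
  traces of \<open>\<tau>\<close> inherit its bounds.
\<close>

lemma tensor_trace_bound:
  fixes a b :: "nat \<Rightarrow> real"
  assumes "tensor_bound M G \<alpha> \<beta> \<tau>" "0 < M" "\<A> \<subseteq> {..<M}" "\<A>' \<subseteq> {..<M}"
    "\<And>A. \<bar>a A\<bar> \<le> 1" "\<And>A. \<bar>b A\<bar> \<le> 1"
  shows "\<bar>\<Sum>A\<in>\<A>. \<Sum>A'\<in>\<A>'. a A * b A' * (\<Sum>C<M. \<tau> A C A' C)\<bar>
    \<le> G * ((card \<A> / M) powr \<alpha> * (card \<A>' / M) powr (1 - \<alpha>))"
proof -
  let ?X = "\<lambda>W. \<Sum>A\<in>\<A>. \<Sum>C<M. \<Sum>A'\<in>\<A>'. \<Sum>C'<M. (a A * rad W C) * (b A' * rad W C') * \<tau> A C A' C'"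
  let ?B = "G * ((card \<A> / M) powr \<alpha> * (card \<A>' / M) powr (1 - \<alpha>))"
  have X: "\<bar>?X W\<bar> \<le> ?B" for W
    using tensor_boundD[OF assms(1,3) subset_refl assms(4) subset_refl, of "\<lambda>A C. a A * rad W C" "\<lambda>A C. b A * rad W C"]
      assms(2,5,6) by (simp add: abs_mult mult_ac)
  have "rad_avg {..<M} ?X = (\<Sum>A\<in>\<A>. \<Sum>C<M. \<Sum>A'\<in>\<A>'. \<Sum>C'<M. a A * b A' * \<tau> A C A' C' * of_bool (C = C'))"
    unfolding rad_avg_sum
  proof (intro sum.cong refl)
    fix A C A' C' assume C: "C \<in> {..<M}" "C' \<in> {..<M}"
    have "rad_avg {..<M} (\<lambda>W. (a A * rad W C) * (b A' * rad W C') * \<tau> A C A' C')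
        = rad_avg {..<M} (\<lambda>W. (a A * b A' * \<tau> A C A' C') * (rad W C * rad W C'))"
      by (simp add: mult_ac)
    then show "rad_avg {..<M} (\<lambda>W. (a A * rad W C) * (b A' * rad W C') * \<tau> A C A' C')
        = a A * b A' * \<tau> A C A' C' * of_bool (C = C')"
      unfolding rad_avg_cmult using C by (simp add: rad_orthonormal)
  qed
  also have "\<dots> = (\<Sum>A\<in>\<A>. \<Sum>C<M. \<Sum>A'\<in>\<A>'. a A * b A' * \<tau> A C A' C)"
    by (intro sum.cong refl) (simp add: of_bool_def if_distrib cong: if_cong)
  also have "\<dots> = (\<Sum>A\<in>\<A>. \<Sum>A'\<in>\<A>'. a A * b A' * (\<Sum>C<M. \<tau> A C A' C))"
    by (subst sum.swap) (simp add: sum_distrib_left)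
  finally have eq: "(\<Sum>A\<in>\<A>. \<Sum>A'\<in>\<A>'. a A * b A' * (\<Sum>C<M. \<tau> A C A' C)) = rad_avg {..<M} ?X" ..
  have "rad_avg {..<M} ?X \<le> ?B"
    using X by (intro rad_avg_le) (auto intro: order_trans[OF abs_ge_self])
  moreover have "rad_avg {..<M} (\<lambda>W. - 1 * ?X W) \<le> ?B"
    using X by (intro rad_avg_le) (auto intro: order_trans[OF abs_ge_minus_self])
  ultimately show ?thesis
    unfolding eq rad_avg_cmult by linarith
qed

text \<open>A partial trace is a matrix on M points only, so its rate is
  \<open>M powr (- (1 / 2))\<close>. Its square root is the origin of the exponent 1/4 of
  \<open>2 ^ m\<close>, and of the factor 4 before the logarithms in N.\<close>

lemma tensor_trace_square_sum:
  assumes "tensor_bound M G \<alpha> \<beta> \<tau>" "0 < M" "0 \<le> G"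
  shows "(\<Sum>A<M. \<Sum>A'<M. (\<Sum>C<M. \<tau> A C A' C)\<^sup>2) \<le> G\<^sup>2 * M powr (- (1 / 2))"
proof (rule sum_square_gain[where \<alpha> = \<alpha>])
  let ?z = "\<lambda>A A'. \<Sum>C<M. \<tau> A C A' C"
  note B = tensor_trace_bound[OF assms(1,2)]
  have powr: "(1 / real M) powr s = real M powr (- s)" for s
    by (simp add: powr_divide powr_minus_divide)
  fix A assume A: "A \<in> {..<M}"
  show "\<bar>?z A A'\<bar> \<le> G / M" if "A' \<in> {..<M}" for A'
  proof -
    have "(1 / real M) powr \<alpha> * (1 / M) powr (1 - \<alpha>) = 1 / M"
      using assms(2) by (simp flip: powr_add)
    then show ?thesis
      using B[of "{A}" "{A'}" "\<lambda>_. 1" "\<lambda>_. 1"] A that by simp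
  qed
  have "(\<Sum>A'<M. \<bar>?z A A'\<bar>) = \<bar>\<Sum>A'<M. sgn (?z A A') * ?z A A'\<bar>"
    by (simp only: sum_abs_eq_sgn[symmetric]) (simp add: sum_nonneg)
  also have "\<dots> \<le> G * (1 / M) powr \<alpha>"
    using B[of "{A}" "{..<M}" "\<lambda>_. 1" "\<lambda>A'. sgn (?z A A')"] A assms(2) by (simp add: abs_sgn_le_1)
  finally show "(\<Sum>A'<M. \<bar>?z A A'\<bar>) \<le> G * M powr (- \<alpha>)"
    unfolding powr .
  have "(\<Sum>A'<M. \<bar>?z A' A\<bar>) = \<bar>\<Sum>A'<M. sgn (?z A' A) * ?z A' A\<bar>"
    by (simp only: sum_abs_eq_sgn[symmetric]) (simp add: sum_nonneg)
  also have "\<dots> \<le> G * (1 / M) powr (1 - \<alpha>)"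
    using B[of "{..<M}" "{A}" "\<lambda>A'. sgn (?z A' A)" "\<lambda>_. 1"] A assms(2) by (simp add: abs_sgn_le_1)
  finally show "(\<Sum>A'<M. \<bar>?z A' A\<bar>) \<le> G * M powr (- (1 - \<alpha>))"
    unfolding powr .
qed (use assms in auto)

text \<open>Sorting the terms by which pairs of signs coincide leaves, besides the subtracted
  diagonal, a chaos in W alone, one in W' alone and one in both. They contribute 2, 2 and 4 times
  the common bound, and squaring a sum of three terms costs a factor 3: 3 (2 + 2 + 4) = 24.\<close>

lemma rad_tensor_variance:
  fixes e e' f f' :: "nat \<Rightarrow> 'a"
  assumes \<tau>: "tensor_bound M G \<alpha> \<beta> \<tau>" and M: "0 < M" and G: "0 \<le> G" and S: "finite S"
    and e: "\<And>A. A < M \<Longrightarrow> e A \<in> S" "\<And>A. A < M \<Longrightarrow> e' A \<in> S" "inj_on e {..<M}" "inj_on e' {..<M}"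
      "(\<forall>A<M. e A = e' A) \<or> e ` {..<M} \<inter> e' ` {..<M} = {}"
    and f: "\<And>A. A < M \<Longrightarrow> f A \<in> S" "\<And>A. A < M \<Longrightarrow> f' A \<in> S" "inj_on f {..<M}" "inj_on f' {..<M}"
      "(\<forall>A<M. f A = f' A) \<or> f ` {..<M} \<inter> f' ` {..<M} = {}"
  shows "rad_avg S (\<lambda>W'. rad_avg S (\<lambda>W.
      (\<Sum>A<M. \<Sum>A'<M. \<Sum>C<M. \<Sum>C'<M.
        (rad W (e A) * rad W (e' A') * (rad W' (f C) * rad W' (f' C'))
         - of_bool (e A = e' A' \<and> f C = f' C')) * \<tau> A C A' C')\<^sup>2))
    \<le> 24 * (G\<^sup>2 * M powr (- (1 / 2)))" (is "rad_avg S (\<lambda>W'. rad_avg S (\<lambda>W. (?Y W W')\<^sup>2)) \<le> 24 * ?K")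
proof -
  let ?p = "\<lambda>A A'. of_bool (e A \<noteq> e' A') :: real" and ?g = "\<lambda>C C'. of_bool (f C \<noteq> f' C') :: real"
  let ?\<theta> = "\<lambda>W A A'. rad W (e A) * rad W (e' A')" and ?\<epsilon> = "\<lambda>W C C'. rad W (f C) * rad W (f' C')"
  let ?X10 = "\<lambda>W. \<Sum>A<M. \<Sum>A'<M. ?p A A' * ((\<Sum>C<M. \<Sum>C'<M. of_bool (f C = f' C') * \<tau> A C A' C') * ?\<theta> W A A')"
  let ?X01 = "\<lambda>W. \<Sum>C<M. \<Sum>C'<M. ?g C C' * ((\<Sum>A<M. \<Sum>A'<M. of_bool (e A = e' A') * \<tau> A C A' C') * ?\<epsilon> W C C')"
  let ?X11 = "\<lambda>W W'. \<Sum>A<M. \<Sum>A'<M. ?p A A' * ((\<Sum>C<M. \<Sum>C'<M. ?g C C' * (\<tau> A C A' C' * ?\<epsilon> W' C C')) * ?\<theta> W A A')"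
  have swap4: "(\<Sum>C<M. \<Sum>C'<M. \<Sum>A<M. \<Sum>A'<M. h A A' C C') = (\<Sum>A<M. \<Sum>A'<M. \<Sum>C<M. \<Sum>C'<M. h A A' C C')"
    for h :: "nat \<Rightarrow> nat \<Rightarrow> nat \<Rightarrow> nat \<Rightarrow> real"
  proof -
    have "(\<Sum>x\<in>{..<M} \<times> {..<M}. \<Sum>y\<in>{..<M} \<times> {..<M}. h (fst y) (snd y) (fst x) (snd x))
        = (\<Sum>y\<in>{..<M} \<times> {..<M}. \<Sum>x\<in>{..<M} \<times> {..<M}. h (fst y) (snd y) (fst x) (snd x))"
      by (rule sum.swap)
    then show ?thesis
      by (simp add: sum.cartesian_product')
  qed
  have split: "?Y W W' = ?X10 W + ?X01 W' + ?X11 W W'" for W W'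
  proof -
    have "?X01 W' = (\<Sum>A<M. \<Sum>A'<M. \<Sum>C<M. \<Sum>C'<M. ?g C C' * (of_bool (e A = e' A') * \<tau> A C A' C' * ?\<epsilon> W' C C'))"
      by (subst swap4[symmetric]) (simp only: sum_distrib_left sum_distrib_right)
    moreover have "(?\<theta> W A A' * ?\<epsilon> W' C C' - of_bool (e A = e' A' \<and> f C = f' C')) * t
      = ?p A A' * ((of_bool (f C = f' C') * t) * ?\<theta> W A A')
        + ?g C C' * (of_bool (e A = e' A') * t * ?\<epsilon> W' C C')
        + ?p A A' * ((?g C C' * (t * ?\<epsilon> W' C C')) * ?\<theta> W A A')" for A A' C C' and t :: real
      by (cases "e A = e' A'"; cases "f C = f' C'") simp_all
    ultimately show ?thesis
      by (simp only: sum_distrib_left sum_distrib_right sum.distrib)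
  qed
  \<comment> \<open>The terms with coinciding signs form a trace if f and f' agree, and there are
    none if their ranges are disjoint.\<close>
  have diag: "(\<Sum>C<M. \<Sum>C'<M. of_bool (f C = f' C') * h C C')\<^sup>2 \<le> (\<Sum>C<M. h C C)\<^sup>2"
    if same: "(\<forall>A<M. f A = f' A) \<or> f ` {..<M} \<inter> f' ` {..<M} = {}" and inj: "inj_on f' {..<M}"
    for h :: "nat \<Rightarrow> nat \<Rightarrow> real" and f f' :: "nat \<Rightarrow> 'a"
  proof (cases "\<forall>A<M. f A = f' A")
    case True
    have "(\<Sum>C<M. \<Sum>C'<M. of_bool (f C = f' C') * h C C') = (\<Sum>C<M. \<Sum>C'<M. if C = C' then h C C' else 0)"
      using True inj by (intro sum.cong refl) (auto simp: inj_on_def)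
    then show ?thesis
      by simp
  next
    case False
    then have "f C \<noteq> f' C'" if "C < M" "C' < M" for C C'
      using same that by auto
    then have "(\<Sum>C<M. \<Sum>C'<M. of_bool (f C = f' C') * h C C') = 0"
      by (intro sum.neutral ballI) auto
    then show ?thesis
      by simp
  qed
  have K: "0 \<le> ?K" by simp
  have "rad_avg S (\<lambda>W. (?X10 W)\<^sup>2) \<le> 2 * (\<Sum>A<M. \<Sum>A'<M. (\<Sum>C<M. \<Sum>C'<M. of_bool (f C = f' C') * \<tau> A C A' C')\<^sup>2)"
    by (rule rad_chaos_rows[OF S e])
  also have "\<dots> \<le> 2 * ?K"
    by (intro mult_left_mono order_trans[OF _ tensor_trace_square_sum[OF \<tau> M G]] sum_mono diag[OF f(5,4)]) simp
  finally have X10: "rad_avg S (\<lambda>W. (?X10 W)\<^sup>2) \<le> 2 * ?K" .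
  have "rad_avg S (\<lambda>W. (?X01 W)\<^sup>2) \<le> 2 * (\<Sum>C<M. \<Sum>C'<M. (\<Sum>A<M. \<Sum>A'<M. of_bool (e A = e' A') * \<tau> A C A' C')\<^sup>2)"
    by (rule rad_chaos_rows[OF S f])
  also have "\<dots> \<le> 2 * ?K"
    by (intro mult_left_mono order_trans[OF _ tensor_trace_square_sum[OF tensor_bound_swap[OF \<tau>] M G]] sum_mono diag[OF e(5,4)]) simp
  finally have X01: "rad_avg S (\<lambda>W. (?X01 W)\<^sup>2) \<le> 2 * ?K" .
  \<comment> \<open>For fixed W' this is a chaos in W whose coefficients are themselves chaoses in
    W'; each of the two estimates contributes a factor 2.\<close>
  have "rad_avg S (\<lambda>W'. rad_avg S (\<lambda>W. (?X11 W W')\<^sup>2))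
      \<le> rad_avg S (\<lambda>W'. 2 * (\<Sum>A<M. \<Sum>A'<M. (\<Sum>C<M. \<Sum>C'<M. ?g C C' * (\<tau> A C A' C' * ?\<epsilon> W' C C'))\<^sup>2))"
    by (intro rad_avg_mono rad_chaos_rows[OF S e])
  also have "\<dots> \<le> 2 * (\<Sum>A<M. \<Sum>A'<M. 2 * (\<Sum>C<M. \<Sum>C'<M. (\<tau> A C A' C')\<^sup>2))"
    unfolding rad_avg_cmult rad_avg_sum
    by (intro mult_left_mono sum_mono rad_chaos_rows[OF S f]) auto
  also have "\<dots> = 4 * (\<Sum>A<M. \<Sum>A'<M. \<Sum>C<M. \<Sum>C'<M. (\<tau> A C A' C')\<^sup>2)"
    by (simp flip: sum_distrib_left)
  also have "\<dots> \<le> 4 * ?K"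
    using tensor_square_sum[OF \<tau> M G] by simp
  finally have X11: "rad_avg S (\<lambda>W'. rad_avg S (\<lambda>W. (?X11 W W')\<^sup>2)) \<le> 4 * ?K" .
  have three: "(x + y + z)\<^sup>2 \<le> 3 * x\<^sup>2 + (3 * y\<^sup>2 + 3 * z\<^sup>2)" for x y z :: real
  proof -
    have "0 \<le> (x - y)\<^sup>2 + (y - z)\<^sup>2 + (x - z)\<^sup>2" by simp
    then show ?thesis by (simp add: power2_eq_square algebra_simps)
  qed
  have "rad_avg S (\<lambda>W'. rad_avg S (\<lambda>W. (?Y W W')\<^sup>2))
      \<le> rad_avg S (\<lambda>W'. rad_avg S (\<lambda>W. 3 * (?X10 W)\<^sup>2 + (3 * (?X01 W')\<^sup>2 + 3 * (?X11 W W')\<^sup>2)))"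
    unfolding split by (intro rad_avg_mono three)
  also have "\<dots> = 3 * rad_avg S (\<lambda>W. (?X10 W)\<^sup>2) + (3 * rad_avg S (\<lambda>W'. (?X01 W')\<^sup>2)
      + 3 * rad_avg S (\<lambda>W'. rad_avg S (\<lambda>W. (?X11 W W')\<^sup>2)))"
    by (simp only: rad_avg_add rad_avg_cmult rad_avg_const[OF S])
  also have "\<dots> \<le> 24 * ?K"
    using X10 X01 X11 by linarith
  finally show ?thesis .
qed

section \<open>Factorization at the level of coefficients\<close>

definition block_c :: "nat \<Rightarrow> ivl \<times> ivl \<Rightarrow> nat set \<Rightarrow> nat set \<Rightarrow> (nat \<Rightarrow> nat \<Rightarrow> real) \<Rightarrow> ivl \<times> ivl \<Rightarrow> real" where
  "block_c m r \<A> \<C> u q = (if \<exists>A\<in>\<A>. \<exists>C\<in>\<C>. q = copy2 m A C r then u (block_index m (fst q)) (block_index m (snd q)) else 0)"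

lemma block_block_c: "(\<And>A C. \<bar>u A C\<bar> \<le> 1) \<Longrightarrow> block m r \<A> \<C> (block_c m r \<A> \<C> u)"
  by (simp add: block_def block_c_def)

lemma sum_block_c:
  assumes r: "r \<in> rects n" and sub: "\<A> \<subseteq> {..<2 ^ m}" "\<C> \<subseteq> {..<2 ^ m}"
  shows "(\<Sum>q\<in>rects (m + n). block_c m r \<A> \<C> u q * g q) = (\<Sum>A\<in>\<A>. \<Sum>C\<in>\<C>. u A C * g (copy2 m A C r))"
proof -
  let ?h = "\<lambda>(A, C). copy2 m A C r"
  have inj: "inj_on ?h (\<A> \<times> \<C>)"
    by (auto simp: inj_on_def copy2_def copy_def)
  have "(\<Sum>q\<in>rects (m + n). block_c m r \<A> \<C> u q * g q) = (\<Sum>q\<in>?h ` (\<A> \<times> \<C>). block_c m r \<A> \<C> u q * g q)"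
  proof (intro sum.mono_neutral_right)
    show "?h ` (\<A> \<times> \<C>) \<subseteq> rects (m + n)"
      using sub by (auto intro!: copy2_in_rects[OF r])
  qed (auto simp: block_c_def image_iff)
  also have "\<dots> = (\<Sum>(A, C)\<in>\<A> \<times> \<C>. block_c m r \<A> \<C> u (copy2 m A C r) * g (copy2 m A C r))"
    by (subst sum.reindex[OF inj]) (simp add: case_prod_unfold)
  also have "\<dots> = (\<Sum>(A, C)\<in>\<A> \<times> \<C>. u A C * g (copy2 m A C r))"
  proof (intro sum.cong refl, clarify)
    fix A C assume "A \<in> \<A>" "C \<in> \<C>"
    moreover have "block_index m (fst (copy2 m A C r)) = A" "block_index m (snd (copy2 m A C r)) = C"
      using r by (auto simp: copy2_def rects_def)
    ultimately show "block_c m r \<A> \<C> u (copy2 m A C r) * g (copy2 m A C r) = u A C * g (copy2 m A C r)"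
      unfolding block_c_def by auto
  qed
  finally show ?thesis
    by (simp add: sum.cartesian_product)
qed

text \<open>The operator with bilinear matrix t: pairing with a Haar function gives the coefficient
  times the area, hence the division.\<close>

definition matrix_c :: "nat \<Rightarrow> (ivl \<times> ivl \<Rightarrow> ivl \<times> ivl \<Rightarrow> real) \<Rightarrow> (ivl \<times> ivl \<Rightarrow> real) \<Rightarrow> ivl \<times> ivl \<Rightarrow> real" where
  "matrix_c N t c q' = (\<Sum>q\<in>rects N. c q * t q q') / area q'"

text \<open>The averages in \<open>compress\<close> cancel the small area of the copies, so the
  compressed operator has as its matrix the pairings of T b_r with b_s, divided by the area of s
  only.\<close>

lemma compress_matrix_expand:
  assumes s: "s \<in> rects n"
  shows "compress m \<psi> (matrix_c (m + n) t (expand m \<phi> c)) s = (\<Sum>r\<in>rects n. c r *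
    (\<Sum>A<2 ^ m. \<Sum>C<2 ^ m. \<Sum>A'<2 ^ m. \<Sum>C'<2 ^ m.
      \<phi> (copy2 m A C r) * \<psi> (copy2 m A' C' s) * t (copy2 m A C r) (copy2 m A' C' s))) / area s"
proof -
  have "matrix_c (m + n) t (expand m \<phi> c) (copy2 m A' C' s) = (\<Sum>r\<in>rects n. \<Sum>A<2 ^ m. \<Sum>C<2 ^ m.
      \<phi> (copy2 m A C r) * c r * t (copy2 m A C r) (copy2 m A' C' s)) * 2 ^ m * 2 ^ m / area s" for A' C'
  proof -
    have "(\<Sum>q\<in>rects (m + n). expand m \<phi> c q * t q (copy2 m A' C' s)) = (\<Sum>r\<in>rects n. \<Sum>A<2 ^ m. \<Sum>C<2 ^ m.
      expand m \<phi> c (copy2 m A C r) * t (copy2 m A C r) (copy2 m A' C' s))"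
      by (rule sum_copies2) (auto simp: expand_def)
    then show ?thesis
      by (simp add: matrix_c_def area_copy2 expand_copy2 cong: sum.cong)
  qed
  then have "compress m \<psi> (matrix_c (m + n) t (expand m \<phi> c)) s =
    (\<Sum>A'<2 ^ m. \<Sum>C'<2 ^ m. \<psi> (copy2 m A' C' s) * (\<Sum>r\<in>rects n. \<Sum>A<2 ^ m. \<Sum>C<2 ^ m.
      \<phi> (copy2 m A C r) * c r * t (copy2 m A C r) (copy2 m A' C' s))) / area s"
    unfolding compress_def by (simp add: sum_divide_distrib sum_distrib_left)
  also have "(\<Sum>A'<2 ^ m. \<Sum>C'<2 ^ m. \<psi> (copy2 m A' C' s) * (\<Sum>r\<in>rects n. \<Sum>A<2 ^ m. \<Sum>C<2 ^ m.
      \<phi> (copy2 m A C r) * c r * t (copy2 m A C r) (copy2 m A' C' s)))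
    = (\<Sum>x\<in>{..<2 ^ m} \<times> {..<2 ^ m}. \<Sum>r\<in>rects n. \<Sum>y\<in>{..<2 ^ m} \<times> {..<2 ^ m}.
      c r * (\<phi> (copy2 m (fst y) (snd y) r) * \<psi> (copy2 m (fst x) (snd x) s) * t (copy2 m (fst y) (snd y) r) (copy2 m (fst x) (snd x) s)))"
    by (simp add: sum.cartesian_product' sum_distrib_left mult_ac)
  also have "\<dots> = (\<Sum>r\<in>rects n. \<Sum>y\<in>{..<2 ^ m} \<times> {..<2 ^ m}. \<Sum>x\<in>{..<2 ^ m} \<times> {..<2 ^ m}.
      c r * (\<phi> (copy2 m (fst y) (snd y) r) * \<psi> (copy2 m (fst x) (snd x) s) * t (copy2 m (fst y) (snd y) r) (copy2 m (fst x) (snd x) s)))"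
    by (subst sum.swap) (intro sum.cong refl sum.swap)
  also have "\<dots> = (\<Sum>r\<in>rects n. c r *
    (\<Sum>A<2 ^ m. \<Sum>C<2 ^ m. \<Sum>A'<2 ^ m. \<Sum>C'<2 ^ m.
      \<phi> (copy2 m A C r) * \<psi> (copy2 m A' C' s) * t (copy2 m A C r) (copy2 m A' C' s)))"
    by (simp add: sum.cartesian_product' sum_distrib_left)
  finally show ?thesis .
qed

lemma copies_same_or_disjoint:
  assumes "I \<in> ivls n" "I' \<in> ivls n"
  shows "(\<forall>A<M. copy m A I = copy m A I') \<or>
    (\<lambda>A. copy m A I) ` {..<M} \<inter> (\<lambda>A. copy m A I') ` {..<M} = {}"
proof (cases "I = I'")
  case False
  then have "copy m A I \<noteq> copy m A' I'" for A A'
    using assms by (metis base_copy)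
  then show ?thesis
    unfolding disjoint_iff image_iff by metis
qed simp

definition block_bound :: "nat \<Rightarrow> nat \<Rightarrow> ((ivl \<times> ivl \<Rightarrow> real) \<Rightarrow> real) \<Rightarrow> real \<Rightarrow> real \<Rightarrow> bool" where
  "block_bound m n \<nu> \<alpha> \<beta> \<longleftrightarrow> (\<forall>r \<A> \<C> c. r \<in> rects n \<longrightarrow> block m r \<A> \<C> c \<longrightarrow>
    \<A> \<subseteq> {..<2 ^ m} \<longrightarrow> \<C> \<subseteq> {..<2 ^ m} \<longrightarrow>
    0 \<le> \<nu> c \<and> \<nu> c \<le> (card \<A> / 2 ^ m) powr \<alpha> * (card \<C> / 2 ^ m) powr \<beta>)"

lemma block_boundD:
  assumes "block_bound m n \<nu> \<alpha> \<beta>" "r \<in> rects n" "block m r \<A> \<C> c" "\<A> \<subseteq> {..<2 ^ m}" "\<C> \<subseteq> {..<2 ^ m}"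
  shows "0 \<le> \<nu> c \<and> \<nu> c \<le> (card \<A> / 2 ^ m) powr \<alpha> * (card \<C> / 2 ^ m) powr \<beta>"
  using assms unfolding block_bound_def by blast

text \<open>Input and output share the signs \<theta>, so a copy paired with itself carries a square
  and survives averaging; \<sigma> is a fixed weight absorbed into the tensor. The average is taken
  of the sum over all pairs (r, s), so that one choice of signs serves them all.\<close>

lemma good_signs:
  fixes t :: "ivl \<times> ivl \<Rightarrow> ivl \<times> ivl \<Rightarrow> real" and \<sigma> :: "ivl \<times> ivl \<Rightarrow> real"
  assumes \<sigma>: "\<forall>q. \<bar>\<sigma> q\<bar> \<le> 1" and \<Gamma>: "0 \<le> \<Gamma>"
    and bound: "\<forall>c d. \<bar>\<Sum>q\<in>rects (m + n). \<Sum>q'\<in>rects (m + n). c q * d q' * t q q'\<bar> \<le> \<Gamma> * \<nu> c * \<nu>' d"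
    and block: "block_bound m n \<nu> \<alpha> \<beta>"
    and block': "block_bound m n \<nu>' (1 - \<alpha>) (1 - \<beta>)"
  shows "\<exists>\<theta> :: ivl \<times> ivl \<Rightarrow> real. (\<forall>q. \<bar>\<theta> q\<bar> = 1) \<and> (\<forall>r\<in>rects n. \<forall>s\<in>rects n.
      \<bar>(\<Sum>A<2 ^ m. \<Sum>C<2 ^ m. \<Sum>A'<2 ^ m. \<Sum>C'<2 ^ m.
        (\<sigma> (copy2 m A C r) * \<theta> (copy2 m A C r)) * \<theta> (copy2 m A' C' s) * t (copy2 m A C r) (copy2 m A' C' s))
       - of_bool (r = s) * (\<Sum>A<2 ^ m. \<Sum>C<2 ^ m. \<sigma> (copy2 m A C r) * t (copy2 m A C r) (copy2 m A C r))\<bar>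
      \<le> 2 ^ (2 * n + 5) * \<Gamma> * (2 ^ m) powr (- (1 / 4)))"
proof -
  define M where "M = (2::nat) ^ m"
  have M: "0 < M" by (simp add: M_def)
  define \<tau> where "\<tau> r s A C A' C' = \<sigma> (copy2 m A C r) * t (copy2 m A C r) (copy2 m A' C' s)" for r s A C A' C'
  have tensor: "tensor_bound M \<Gamma> \<alpha> \<beta> (\<tau> r s)" if r: "r \<in> rects n" and s: "s \<in> rects n" for r s
    unfolding tensor_bound_def
  proof (intro allI impI)
    fix \<A> \<C> \<A>' \<C>' and u v :: "nat \<Rightarrow> nat \<Rightarrow> real"
    assume "\<A> \<subseteq> {..<M}" "\<C> \<subseteq> {..<M}" "\<A>' \<subseteq> {..<M}" "\<C>' \<subseteq> {..<M}"
      and uv: "\<forall>A C. \<bar>u A C\<bar> \<le> 1" "\<forall>A C. \<bar>v A C\<bar> \<le> 1"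
    then have sub: "\<A> \<subseteq> {..<2 ^ m}" "\<C> \<subseteq> {..<2 ^ m}" "\<A>' \<subseteq> {..<2 ^ m}" "\<C>' \<subseteq> {..<2 ^ m}"
      by (simp_all add: M_def)
    let ?u = "\<lambda>A C. u A C * \<sigma> (copy2 m A C r)"
    let ?c = "block_c m r \<A> \<C> ?u" and ?d = "block_c m s \<A>' \<C>' v"
    have u: "\<bar>?u A C\<bar> \<le> 1" for A C
      unfolding abs_mult using uv(1) \<sigma>[rule_format, of "copy2 m A C r"] by (intro mult_le_one) auto
    note c = block_boundD[OF block r block_block_c[of ?u, OF u] sub(1,2)]
    note d = block_boundD[OF block' s block_block_c[of v] sub(3,4)]
    have "(\<Sum>q\<in>rects (m + n). \<Sum>q'\<in>rects (m + n). ?c q * ?d q' * t q q')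
        = (\<Sum>q\<in>rects (m + n). ?c q * (\<Sum>q'\<in>rects (m + n). ?d q' * t q q'))"
      by (simp add: sum_distrib_left mult.assoc)
    also have "\<dots> = (\<Sum>A\<in>\<A>. \<Sum>C\<in>\<C>. ?u A C * (\<Sum>A'\<in>\<A>'. \<Sum>C'\<in>\<C>'. v A' C' * t (copy2 m A C r) (copy2 m A' C' s)))"
      by (simp only: sum_block_c[OF r sub(1,2)] sum_block_c[OF s sub(3,4)])
    also have "\<dots> = (\<Sum>A\<in>\<A>. \<Sum>C\<in>\<C>. \<Sum>A'\<in>\<A>'. \<Sum>C'\<in>\<C>'. u A C * v A' C' * \<tau> r s A C A' C')"
      by (simp add: \<tau>_def sum_distrib_left mult_ac)
    finally have "\<bar>\<Sum>A\<in>\<A>. \<Sum>C\<in>\<C>. \<Sum>A'\<in>\<A>'. \<Sum>C'\<in>\<C>'. u A C * v A' C' * \<tau> r s A C A' C'\<bar> \<le> \<Gamma> * \<nu> ?c * \<nu>' ?d"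
      using bound[rule_format, of ?c ?d] by simp
    also have "\<dots> \<le> \<Gamma> * ((card \<A> / M) powr \<alpha> * (card \<C> / M) powr \<beta>)
          * ((card \<A>' / M) powr (1 - \<alpha>) * (card \<C>' / M) powr (1 - \<beta>))"
      using c d uv \<Gamma> by (intro mult_mono) (auto simp: M_def)
    finally show "\<bar>\<Sum>A\<in>\<A>. \<Sum>C\<in>\<C>. \<Sum>A'\<in>\<A>'. \<Sum>C'\<in>\<C>'. u A C * v A' C' * \<tau> r s A C A' C'\<bar> \<le> \<dots>" .
  qed
  let ?S = "ivls (m + n)"
  define Y where "Y r s W W' = (\<Sum>A<M. \<Sum>A'<M. \<Sum>C<M. \<Sum>C'<M.
    (rad W (copy m A (fst r)) * rad W (copy m A' (fst s)) * (rad W' (copy m C (snd r)) * rad W' (copy m C' (snd s)))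
      - of_bool (copy m A (fst r) = copy m A' (fst s) \<and> copy m C (snd r) = copy m C' (snd s))) * \<tau> r s A C A' C')"
    for r s W W'
  let ?K = "24 * (\<Gamma>\<^sup>2 * M powr (- (1 / 2)))"
  have var: "rad_avg ?S (\<lambda>W'. rad_avg ?S (\<lambda>W. (Y r s W W')\<^sup>2)) \<le> ?K"
    if r: "r \<in> rects n" and s: "s \<in> rects n" for r s
  proof -
    have *: "fst r \<in> ivls n" "snd r \<in> ivls n" "fst s \<in> ivls n" "snd s \<in> ivls n"
      using r s by (auto simp: rects_def)
    have inj: "inj_on (\<lambda>A. copy m A I) X" for I X
      using inj_copy inj_on_subset by blast
    show ?thesis
      unfolding Y_def
      by (rule rad_tensor_variance[OF tensor[OF r s] M \<Gamma> finite_ivls])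
        (intro copy_in_ivls inj copies_same_or_disjoint[where n = n] *; simp add: M_def)+
  qed
  let ?P = "rects n \<times> rects n"
  have "rad_avg ?S (\<lambda>W'. rad_avg ?S (\<lambda>W. \<Sum>x\<in>?P. (Y (fst x) (snd x) W W')\<^sup>2)) \<le> (\<Sum>x\<in>?P. ?K)"
    unfolding rad_avg_sum using var by (intro sum_mono) auto
  then obtain W' where "rad_avg ?S (\<lambda>W. \<Sum>x\<in>?P. (Y (fst x) (snd x) W W')\<^sup>2) \<le> (\<Sum>x\<in>?P. ?K)"
    by (rule rad_avg_witness[OF finite_ivls])
  then obtain W where W: "(\<Sum>x\<in>?P. (Y (fst x) (snd x) W W')\<^sup>2) \<le> (\<Sum>x\<in>?P. ?K)"
    by (rule rad_avg_witness[OF finite_ivls])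
  let ?B = "2 ^ (2 * n + 5) * \<Gamma> * (2 ^ m) powr (- (1 / 4))"
  have card: "real (card ?P) \<le> 2 ^ (4 * n + 4)"
  proof -
    have "card ?P \<le> ((2 ^ (n + 1)) * (2 ^ (n + 1))) * ((2 ^ (n + 1)) * (2 ^ (n + 1)))"
      unfolding card_cartesian_product rects_def by (intro mult_le_mono card_ivls)
    also have "\<dots> = 2 ^ (4 * n + 4)"
    proof -
      have "4 * n + 4 = (n + 1) + (n + 1) + ((n + 1) + (n + 1))" by simp
      then show ?thesis by (simp only: power_add)
    qed
    finally show ?thesis
      by (simp flip: of_nat_le_iff[where 'a = real])
  qed
  have Y: "\<bar>Y r s W W'\<bar> \<le> ?B" if r: "r \<in> rects n" and s: "s \<in> rects n" for r s
  proof (rule power2_le_imp_le)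
    have "\<bar>Y r s W W'\<bar>\<^sup>2 \<le> (\<Sum>x\<in>?P. (Y (fst x) (snd x) W W')\<^sup>2)"
      using r s member_le_sum[of "(r, s)" ?P "\<lambda>x. (Y (fst x) (snd x) W W')\<^sup>2"] by simp
    also have "\<dots> \<le> card ?P * ?K"
      using W by simp
    also have "\<dots> \<le> 2 ^ (4 * n + 4) * ?K"
      by (intro mult_right_mono card) auto
    \<comment> \<open>Rounding 24 up to 2^6 instead of 2^5 makes the total exponent 4n + 10 even,
      with square root 2^(2n+5).\<close>
    also have "\<dots> \<le> 2 ^ (4 * n + 4) * (2 ^ 6 * (\<Gamma>\<^sup>2 * M powr (- (1 / 2))))"
      by (intro mult_left_mono) auto
    also have "\<dots> = ?B\<^sup>2"
    proof -
      have "real M powr (- (1 / 2)) = ((2 ^ m) powr (- (1 / 4)))\<^sup>2"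
        by (simp add: M_def power2_eq_square flip: powr_add)
      moreover have "((2::real) ^ (2 * n + 5))\<^sup>2 = 2 ^ (4 * n + 4) * 2 ^ 6"
      proof -
        have "(2 * n + 5) * 2 = (4 * n + 4) + 6" by simp
        then show ?thesis by (simp only: power_mult[symmetric] flip: power_add)
      qed
      ultimately show ?thesis
        by (simp only: power_mult_distrib mult_ac)
    qed
    finally show "\<bar>Y r s W W'\<bar>\<^sup>2 \<le> ?B\<^sup>2" .
  qed (use \<Gamma> in auto)
  define \<theta> where "\<theta> q = rad W (fst q) * rad W' (snd q)" for q
  have copy_eq: "copy m A I = copy m A' I' \<longleftrightarrow> A = A' \<and> I = I'" if "I \<in> ivls n" "I' \<in> ivls n" for A A' I I'
    using that by (metis base_copy block_index_copy)
  show ?thesis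
  proof (intro exI[of _ \<theta>] conjI allI ballI)
    show "\<bar>\<theta> q\<bar> = 1" for q
      by (simp add: \<theta>_def abs_mult)
    fix r s assume rs: "r \<in> rects n" "s \<in> rects n"
    let ?X = "\<lambda>A C A' C'. (\<sigma> (copy2 m A C r) * \<theta> (copy2 m A C r)) * \<theta> (copy2 m A' C' s) * t (copy2 m A C r) (copy2 m A' C' s)"
    have "(\<Sum>A<M. \<Sum>A'<M. \<Sum>C<M. \<Sum>C'<M. of_bool (copy m A (fst r) = copy m A' (fst s) \<and> copy m C (snd r) = copy m C' (snd s)) * \<tau> r s A C A' C')
      = (\<Sum>A<M. \<Sum>A'<M. \<Sum>C<M. \<Sum>C'<M. if C = C' then (if A = A' then of_bool (r = s) * \<tau> r s A C A' C' else 0) else 0)"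
    proof -
      have "fst r \<in> ivls n" "fst s \<in> ivls n" "snd r \<in> ivls n" "snd s \<in> ivls n"
        using rs by (auto simp: rects_def)
      then have "copy m A (fst r) = copy m A' (fst s) \<and> copy m C (snd r) = copy m C' (snd s)
          \<longleftrightarrow> C = C' \<and> A = A' \<and> r = s" for A A' C C'
        unfolding prod_eq_iff[of r s] by (simp only: copy_eq) blast
      then show ?thesis
        by (simp only:) (intro sum.cong refl, auto)
    qed
    also have "\<dots> = (\<Sum>A<M. \<Sum>A'<M. if A = A' then (\<Sum>C<M. of_bool (r = s) * \<tau> r s A C A' C) else 0)"
      by (intro sum.cong refl) auto
    also have "\<dots> = of_bool (r = s) * (\<Sum>A<M. \<Sum>C<M. \<tau> r r A C A C)"
      by (cases "r = s") simp_all
    finally have diag: "(\<Sum>A<M. \<Sum>A'<M. \<Sum>C<M. \<Sum>C'<M.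
        of_bool (copy m A (fst r) = copy m A' (fst s) \<and> copy m C (snd r) = copy m C' (snd s)) * \<tau> r s A C A' C')
      = of_bool (r = s) * (\<Sum>A<M. \<Sum>C<M. \<tau> r r A C A C)" .
    have "Y r s W W' = (\<Sum>A<M. \<Sum>A'<M. \<Sum>C<M. \<Sum>C'<M. ?X A C A' C')
        - of_bool (r = s) * (\<Sum>A<M. \<Sum>C<M. \<tau> r r A C A C)"
      unfolding Y_def left_diff_distrib sum_subtractf diag
      by (intro arg_cong2[where f = "(-)"] sum.cong refl) (simp add: \<tau>_def \<theta>_def copy2_def mult_ac)
    also have "(\<Sum>A<M. \<Sum>A'<M. \<Sum>C<M. \<Sum>C'<M. ?X A C A' C') = (\<Sum>A<M. \<Sum>C<M. \<Sum>A'<M. \<Sum>C'<M. ?X A C A' C')"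
      by (intro sum.cong refl sum.swap)
    finally show "\<bar>(\<Sum>A<2 ^ m. \<Sum>C<2 ^ m. \<Sum>A'<2 ^ m. \<Sum>C'<2 ^ m. ?X A C A' C')
       - of_bool (r = s) * (\<Sum>A<2 ^ m. \<Sum>C<2 ^ m. \<sigma> (copy2 m A C r) * t (copy2 m A C r) (copy2 m A C r))\<bar> \<le> ?B"
      using Y[OF rs] by (simp only: M_def \<tau>_def)
  qed
qed

text \<open>Division by the diagonal D, which is at least \<delta> times the area, has norm at most
  1/\<delta> by \<open>mono\<close>, with no loss in n. What remains is the identity plus Y / D, and
  the Neumann series inverting it contributes the factor 1 + \<eta>.\<close>

lemma coefficient_factorization:
  fixes t :: "ivl \<times> ivl \<Rightarrow> ivl \<times> ivl \<Rightarrow> real"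
  assumes norm: "lattice_norm (rects n) area \<nu>n"
    and \<Gamma>: "0 < \<Gamma>" and \<delta>: "0 < \<delta>" and \<eta>: "0 < \<eta>"
    and size: "2 ^ (10 * n + 9) * (\<Gamma> / \<delta>) * (1 + 1 / \<eta>) \<le> (2 ^ m) powr (1 / 4)"
    and bound: "\<forall>c d. \<bar>\<Sum>q\<in>rects (m + n). \<Sum>q'\<in>rects (m + n). c q * d q' * t q q'\<bar> \<le> \<Gamma> * \<nu> c * \<nu>' d"
    and diag: "\<forall>q\<in>rects (m + n). \<delta> * area q \<le> \<bar>t q q\<bar>"
    and block: "block_bound m n \<nu> \<alpha> \<beta>"
    and block': "block_bound m n \<nu>' (1 - \<alpha>) (1 - \<beta>)"
  shows "\<exists>(\<phi> :: ivl \<times> ivl \<Rightarrow> real) (\<psi> :: ivl \<times> ivl \<Rightarrow> real) H.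
    (\<forall>q. \<bar>\<phi> q\<bar> \<le> 1 \<and> \<bar>\<psi> q\<bar> \<le> 1) \<and>
    (\<forall>c d s. H (\<lambda>r. c r + d r) s = H c s + H d s) \<and> (\<forall>a c s. H (\<lambda>r. a * c r) s = a * H c s) \<and>
    (\<forall>c. \<nu>n (H c) \<le> (1 + \<eta>) / \<delta> * \<nu>n c) \<and>
    (\<forall>c d. (\<forall>r\<in>rects n. c r = d r) \<longrightarrow> (\<forall>s\<in>rects n. H c s = H d s)) \<and>
    (\<forall>c. \<forall>s\<in>rects n. H (compress m \<psi> (matrix_c (m + n) t (expand m \<phi> c))) s = c s)"
proof -
  interpret lattice_norm "rects n" area \<nu>n by (rule norm)
  \<comment> \<open>These signs make the contributions of all copies to D add up.\<close>
  define \<sigma> where "\<sigma> q = sgn (t q q)" for q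
  have \<sigma>: "\<forall>q. \<bar>\<sigma> q\<bar> \<le> 1"
    by (simp add: \<sigma>_def abs_sgn_le_1)
  obtain \<theta> :: "ivl \<times> ivl \<Rightarrow> real" where \<theta>: "\<And>q. \<bar>\<theta> q\<bar> = 1" and
    small: "\<And>r s. r \<in> rects n \<Longrightarrow> s \<in> rects n \<Longrightarrow>
      \<bar>(\<Sum>A<2 ^ m. \<Sum>C<2 ^ m. \<Sum>A'<2 ^ m. \<Sum>C'<2 ^ m.
        (\<sigma> (copy2 m A C r) * \<theta> (copy2 m A C r)) * \<theta> (copy2 m A' C' s) * t (copy2 m A C r) (copy2 m A' C' s))
       - of_bool (r = s) * (\<Sum>A<2 ^ m. \<Sum>C<2 ^ m. \<sigma> (copy2 m A C r) * t (copy2 m A C r) (copy2 m A C r))\<bar>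
      \<le> 2 ^ (2 * n + 5) * \<Gamma> * (2 ^ m) powr (- (1 / 4))"
    using good_signs[OF \<sigma> less_imp_le[OF \<Gamma>] bound block block'] by blast
  define \<phi> where "\<phi> q = \<sigma> q * \<theta> q" for q
  define X where "X r s = (\<Sum>A<2 ^ m. \<Sum>C<2 ^ m. \<Sum>A'<2 ^ m. \<Sum>C'<2 ^ m.
    \<phi> (copy2 m A C r) * \<theta> (copy2 m A' C' s) * t (copy2 m A C r) (copy2 m A' C' s))" for r s
  define D where "D r = (\<Sum>A<2 ^ m. \<Sum>C<2 ^ m. \<sigma> (copy2 m A C r) * t (copy2 m A C r) (copy2 m A C r))" for r
  define Y where "Y r s = X r s - of_bool (r = s) * D r" for r s
  define \<kappa> where "\<kappa> = 2 ^ (2 * n + 5) * \<Gamma> * (2 ^ m) powr (- (1 / 4))"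
  have Y: "\<bar>Y r s\<bar> \<le> \<kappa>" if "r \<in> rects n" "s \<in> rects n" for r s
    using small[OF that] by (simp only: Y_def X_def D_def \<kappa>_def \<phi>_def)
  have \<kappa>: "0 \<le> \<kappa>" using \<Gamma> by (simp add: \<kappa>_def)
  have D: "\<delta> * area r \<le> D r" if r: "r \<in> rects n" for r
  proof -
    have "\<delta> * area r = (\<Sum>A<(2::nat) ^ m. \<Sum>C<(2::nat) ^ m. \<delta> * area (copy2 m A C r))"
      by (simp add: area_copy2)
    also have "\<dots> \<le> D r"
      unfolding D_def
    proof (intro sum_mono)
      fix A C :: nat assume "A \<in> {..<2 ^ m}" "C \<in> {..<2 ^ m}"
      then show "\<delta> * area (copy2 m A C r) \<le> \<sigma> (copy2 m A C r) * t (copy2 m A C r) (copy2 m A C r)"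
        using bspec[OF diag copy2_in_rects[OF r], of A C] by (simp add: \<sigma>_def abs_sgn mult.commute)
    qed
    finally show ?thesis .
  qed
  have D_pos: "0 < D r" if "r \<in> rects n" for r
    using D[OF that] mult_pos_pos[OF \<delta> area_pos[of r]] by linarith
  \<comment> \<open>The minus sign makes \<open>c - L c\<close> the compressed operator after
    division by its diagonal.\<close>
  define l where "l r s = - (Y r s / D s)" for r s
  \<comment> \<open>The exponent is the sum of 4n + 4 for the pairs of rectangles, 2n + 5 from
    \<kappa>, and 2n twice for inverse areas: one from dividing by D, one from bounding a
    coefficient by the norm.\<close>
  define e where "e = 2 ^ (10 * n + 9) * (\<Gamma> / \<delta>) * (2 ^ m) powr (- (1 / 4))"
  have e0: "0 \<le> e" using \<Gamma> \<delta> by (simp add: e_def)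
  have e1: "e * (1 + 1 / \<eta>) \<le> 1"
  proof -
    have "e * (1 + 1 / \<eta>) = (2 ^ (10 * n + 9) * (\<Gamma> / \<delta>) * (1 + 1 / \<eta>)) * (2 ^ m) powr (- (1 / 4))"
      by (simp add: e_def mult_ac)
    also have "\<dots> \<le> (2 ^ m) powr (1 / 4) * (2 ^ m) powr (- (1 / 4))"
      by (intro mult_right_mono size) auto
    also have "\<dots> = 1"
      by (simp flip: powr_add)
    finally show ?thesis .
  qed
  have e2: "e < 1" "1 / (1 - e) \<le> 1 + \<eta>"
  proof -
    have "e * (\<eta> + 1) \<le> \<eta>"
      using e1 \<eta> by (simp add: field_simps)
    then have lt: "e * (\<eta> + 1) < 1 * (\<eta> + 1)" and le: "1 \<le> (1 + \<eta>) * (1 - e)"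
      by (simp_all add: algebra_simps)
    show "e < 1"
      by (rule mult_right_less_imp_less[OF lt]) (use \<eta> in simp)
    then show "1 / (1 - e) \<le> 1 + \<eta>"
      using le by (subst pos_divide_le_eq) auto
  qed
  have contr: "\<nu>n (\<lambda>s. \<Sum>r\<in>rects n. l r s * c r) \<le> e * \<nu>n c" for c
  proof -
    have inv_area: "1 / area r \<le> 2 ^ (2 * n)" if "r \<in> rects n" for r
      using area_lower[OF that] by (simp add: field_simps)
    have "\<nu>n (\<lambda>s. \<Sum>r\<in>rects n. l r s * c r)
        \<le> (\<Sum>s\<in>rects n. \<Sum>r\<in>rects n. (\<kappa> / \<delta> * 2 ^ (2 * n)) * (\<nu>n c * 2 ^ (2 * n)))"
    proof (rule matrix_bound)
      fix r s assume rs: "r \<in> rects n" "s \<in> rects n"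
      have "\<bar>l r s\<bar> = \<bar>Y r s\<bar> / D s"
        using D_pos[OF rs(2)] by (simp add: l_def)
      also have "\<dots> \<le> \<kappa> / (\<delta> * area s)"
        using Y[OF rs] D[OF rs(2)] \<kappa> \<delta> by (intro frac_le) auto
      also have "\<dots> = \<kappa> / \<delta> * (1 / area s)" by simp
      also have "\<dots> \<le> \<kappa> / \<delta> * 2 ^ (2 * n)"
        using \<kappa> \<delta> by (intro mult_left_mono inv_area rs) auto
      finally show "\<bar>l r s\<bar> \<le> \<kappa> / \<delta> * 2 ^ (2 * n)" .
    next
      fix r assume r: "r \<in> rects n"
      have "\<bar>c r\<bar> \<le> \<nu>n c * (1 / area r)"
        using coeff_bound[OF r] by simp
      also have "\<dots> \<le> \<nu>n c * 2 ^ (2 * n)"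
        by (intro mult_left_mono inv_area r) auto
      finally show "\<bar>c r\<bar> \<le> \<nu>n c * 2 ^ (2 * n)" .
    qed simp
    also have "\<dots> = (real (card (rects n)))\<^sup>2 * ((\<kappa> / \<delta> * 2 ^ (2 * n)) * (\<nu>n c * 2 ^ (2 * n)))"
      by (simp add: power2_eq_square)
    also have "\<dots> \<le> (2 ^ (2 * n + 2))\<^sup>2 * ((\<kappa> / \<delta> * 2 ^ (2 * n)) * (\<nu>n c * 2 ^ (2 * n)))"
    proof (intro mult_right_mono power_mono)
      have "card (rects n) \<le> 2 ^ (n + 1) * 2 ^ (n + 1)"
        unfolding rects_def card_cartesian_product by (intro mult_le_mono card_ivls)
      also have "\<dots> = 2 ^ (2 * n + 2)"
        by (simp flip: power_add)
      finally show "real (card (rects n)) \<le> 2 ^ (2 * n + 2)"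
        by (simp flip: of_nat_le_iff[where 'a = real])
    qed (use \<kappa> \<delta> in auto)
    also have "\<dots> = ((2 ^ (2 * n + 2))\<^sup>2 * 2 ^ (2 * n + 5) * 2 ^ (2 * n) * 2 ^ (2 * n)) * (\<Gamma> / \<delta>) * (2 ^ m) powr (- (1 / 4)) * \<nu>n c"
      by (simp add: \<kappa>_def mult_ac)
    also have "(2 ^ (2 * n + 2))\<^sup>2 * 2 ^ (2 * n + 5) * 2 ^ (2 * n) * 2 ^ (2 * n) = (2 ^ (10 * n + 9) :: real)"
    proof -
      have "10 * n + 9 = (2 * n + 2) * 2 + (2 * n + 5) + 2 * n + 2 * n" by simp
      then show ?thesis by (simp only: power_mult[of _ "2 * n + 2"] power_add[of _ "_ + 2 * n"]
        power_add[of _ "_ + (2 * n + 5)"] power_add[of _ "(2 * n + 2) * 2"])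
    qed
    finally show ?thesis
      by (simp only: e_def)
  qed
  obtain H where H:
    "\<And>c d s. H (\<lambda>r. c r + d r) s = H c s + H d s" "\<And>a c s. H (\<lambda>r. a * c r) s = a * H c s"
    "\<And>c s. s \<in> rects n \<Longrightarrow> H (\<lambda>s. c s - (\<Sum>r\<in>rects n. l r s * c r)) s = c s"
    "\<And>c. \<nu>n (H c) \<le> \<nu>n c / (1 - e)"
    using neumann[where l = l and e = e, OF contr e0 e2(1)] by blast
  \<comment> \<open>The formula for the compressed operator holds on \<open>rects n\<close> only, so
    H must not see other indices. Its boundedness ensures this, since a family vanishing on
    \<open>rects n\<close> has norm 0.\<close>
  have H_cong: "H c s = H d s" if eq: "\<And>r. r \<in> rects n \<Longrightarrow> c r = d r" and s: "s \<in> rects n" for c d s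
  proof -
    have "\<nu>n (\<lambda>r. c r - d r) = 0"
      using eq cong[of "\<lambda>r. c r - d r" "\<lambda>r. 0"] by simp
    then have "\<nu>n (H (\<lambda>r. c r - d r)) = 0"
      using H(4)[of "\<lambda>r. c r - d r"] by (simp add: order_antisym)
    then have "H (\<lambda>r. c r - d r) s = 0"
      using coeff_bound[OF s, of "H (\<lambda>r. c r - d r)"] by simp
    then show ?thesis
      using H(1)[of "\<lambda>r. c r - d r" d s] by simp
  qed
  define H' where "H' c = H (\<lambda>s. area s / D s * c s)" for c
  show ?thesis
  proof (rule exI[of _ \<phi>], rule exI[of _ \<theta>], rule exI[of _ H'], intro conjI allI impI ballI)
    fix q
    show "\<bar>\<phi> q\<bar> \<le> 1" "\<bar>\<theta> q\<bar> \<le> 1"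
      using \<sigma>[rule_format, of q] \<theta>[of q] by (simp_all add: \<phi>_def abs_mult)
  next
    show "H' (\<lambda>r. c r + d r) s = H' c s + H' d s" for c d s
      by (simp add: H'_def distrib_left H(1))
    show "H' (\<lambda>r. a * c r) s = a * H' c s" for a c s
      using H(2)[of a "\<lambda>s. area s / D s * c s" s] by (simp add: H'_def mult.left_commute)
    show "\<nu>n (H' c) \<le> (1 + \<eta>) / \<delta> * \<nu>n c" for c
    proof -
      have "\<nu>n (\<lambda>s. area s / D s * c s) \<le> \<nu>n (\<lambda>s. 1 / \<delta> * c s)"
      proof (rule mono)
        fix s assume s: "s \<in> rects n"
        have "area s / D s \<le> 1 / \<delta>"
          using D[OF s] D_pos[OF s] \<delta> by (simp add: field_simps)
        then show "\<bar>area s / D s * c s\<bar> \<le> \<bar>1 / \<delta> * c s\<bar>"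
          unfolding abs_mult using D_pos[OF s] \<delta> less_imp_le[OF area_pos[of s]]
          by (intro mult_right_mono) auto
      qed
      also have "\<dots> = 1 / \<delta> * \<nu>n c"
        using \<delta> by (simp only: scale) simp
      finally have le: "\<nu>n (\<lambda>s. area s / D s * c s) \<le> 1 / \<delta> * \<nu>n c" .
      have "\<nu>n (H' c) \<le> \<nu>n (\<lambda>s. area s / D s * c s) * (1 / (1 - e))"
        using H(4) by (simp add: H'_def)
      also have "\<dots> \<le> (1 / \<delta> * \<nu>n c) * (1 + \<eta>)"
        using e2 \<delta> by (intro mult_mono le) auto
      finally show ?thesis
        by (simp add: mult_ac)
    qed
    show "H' c s = H' d s" if "\<forall>r\<in>rects n. c r = d r" "s \<in> rects n" for c d s
      unfolding H'_def by (intro H_cong) (simp_all add: that)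
    show "H' (compress m \<theta> (matrix_c (m + n) t (expand m \<phi> c))) s = c s" if s: "s \<in> rects n" for c s
    proof -
      have "area s / D s * compress m \<theta> (matrix_c (m + n) t (expand m \<phi> c)) s
          = c s - (\<Sum>r\<in>rects n. l r s * c r)" if s: "s \<in> rects n" for s
      proof -
        have "compress m \<theta> (matrix_c (m + n) t (expand m \<phi> c)) s = (\<Sum>r\<in>rects n. c r * X r s) / area s"
          unfolding compress_matrix_expand[OF s] X_def ..
        also have "(\<Sum>r\<in>rects n. c r * X r s) = (\<Sum>r\<in>rects n. c r * Y r s) + c s * D s"
        proof -
          have "c r * X r s = c r * Y r s + (if r = s then c s * D s else 0)" for r
            by (simp add: Y_def algebra_simps)
          then show ?thesis
            using s by (simp add: sum.distrib)
        qed
        finally have "area s / D s * compress m \<theta> (matrix_c (m + n) t (expand m \<phi> c)) s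
            = ((\<Sum>r\<in>rects n. c r * Y r s) + c s * D s) / D s"
          using less_imp_neq[OF area_pos[of s], symmetric] by simp
        also have "\<dots> = c s - (\<Sum>r\<in>rects n. l r s * c r)"
          using D_pos[OF s] by (simp add: l_def add_divide_distrib sum_divide_distrib sum_negf mult.commute)
        finally show ?thesis .
      qed
      then have "H' (compress m \<theta> (matrix_c (m + n) t (expand m \<phi> c))) s
          = H (\<lambda>s. c s - (\<Sum>r\<in>rects n. l r s * c r)) s"
        unfolding H'_def by (intro H_cong s)
      then show ?thesis
        by (simp add: H(3) s)
    qed
  qed
qed

section \<open>Haar functions and their coefficients\<close>

definition dy :: "ivl \<Rightarrow> real set" where
  "dy a = {real (snd a) / 2 ^ fst a ..< (real (snd a) + 1) / 2 ^ fst a}"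

definition haar_fn :: "ivl \<times> ivl \<Rightarrow> real \<times> real \<Rightarrow> real" where
  "haar_fn r = haar2 (dy (fst r), dy (snd r))"

lemma haar_fn_eq: "haar_fn = haar2 \<circ> map_prod dy dy"
  by (auto simp: haar_fn_def fun_eq_iff)

lemma mem_dy_iff: "x \<in> dy (l, i) \<longleftrightarrow> \<lfloor>x * 2 ^ l\<rfloor> = int i"
  by (auto simp: dy_def floor_eq_iff field_simps)

text \<open>Iterated floors: passing to the enclosing interval of twice the length drops the last
  binary digit of the position.\<close>

lemma mem_dy_coarser:
  assumes "x \<in> dy (k, j)" "l \<le> k"
  shows "x \<in> dy (l, i) \<longleftrightarrow> j div 2 ^ (k - l) = i"
proof -
  have "(2::real) ^ k = 2 ^ l * 2 ^ (k - l)"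
    using assms(2) by (simp flip: power_add)
  then have "x * 2 ^ l = x * 2 ^ k / real_of_int (2 ^ (k - l))"
    by simp
  then have "\<lfloor>x * 2 ^ l\<rfloor> = \<lfloor>x * 2 ^ k\<rfloor> div 2 ^ (k - l)"
    using floor_divide_real_eq_div[of "2 ^ (k - l)" "x * 2 ^ k"] by simp
  also have "\<dots> = int (j div 2 ^ (k - l))"
    using assms(1) by (simp add: mem_dy_iff zdiv_int)
  finally show ?thesis
    by (simp add: mem_dy_iff)
qed

lemma dy_nonempty: "real i / 2 ^ l \<in> dy (l, i)"
  by (simp add: dy_def divide_strict_right_mono)

lemma dy_nonneg: "x \<in> dy a \<Longrightarrow> 0 \<le> x"
  by (auto simp: dy_def intro: order_trans[of 0 "real (snd a) / 2 ^ fst a"])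

lemma emeasure_dy: "emeasure lborel (dy a) < \<infinity>"
  by (simp add: dy_def divide_right_mono)

lemma sets_dy [measurable, simp]: "dy a \<in> sets borel"
  by (simp add: dy_def)

lemma measure_dy: "measure lborel (dy a) = 1 / 2 ^ fst a"
  by (simp add: dy_def divide_right_mono add_divide_distrib)

lemma inj_dy: "inj dy"
proof (rule injI)
  fix a b assume eq: "dy a = dy b"
  then have "(1::real) / 2 ^ fst a = 1 / 2 ^ fst b"
    using measure_dy by metis
  then have l: "fst a = fst b"
    by simp
  have "real (snd a) / 2 ^ fst a \<in> dy b"
    using dy_nonempty[of "snd a" "fst a"] eq by simp
  then have "\<lfloor>real (snd a) / 2 ^ fst a * 2 ^ fst b\<rfloor> = int (snd b)"
    using mem_dy_iff[of _ "fst b" "snd b"] by simp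
  then show "a = b"
    using l by (simp add: prod_eq_iff)
qed

lemma dyadic_eq: "dyadic = dy ` (\<Union>k. ivls k)"
proof -
  have "dyadic = {dy (n, i) | n i. i < 2 ^ n}"
  proof (intro set_eqI iffI)
    fix I assume "I \<in> dyadic"
    then obtain n k where "I = {(real k - 1) / 2 ^ n ..< real k / 2 ^ n}" "1 \<le> k" "k \<le> 2 ^ n"
      by (auto simp: dyadic_def)
    then have "I = dy (n, k - 1) \<and> k - 1 < 2 ^ n"
      by (auto simp: dy_def of_nat_diff)
    then show "I \<in> {dy (n, i) | n i. i < 2 ^ n}" by blast
  next
    fix I assume "I \<in> {dy (n, i) | n i. i < 2 ^ n}"
    then obtain n i where "I = dy (n, i)" "i < 2 ^ n" by blast
    then show "I \<in> dyadic"
      unfolding dyadic_def by (intro CollectI exI[of _ n] exI[of _ "Suc i"]) (simp add: dy_def add.commute)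
  qed
  also have "\<dots> = dy ` (\<Union>k. ivls k)"
    by (auto simp: ivls_def image_iff)
  finally show ?thesis .
qed

lemma dyadic_upto_eq: "dyadic_upto N = dy ` ivls N"
proof -
  have "dyadic_level n = dy ` ({n} \<times> {..<2 ^ n})" for n
    unfolding dyadic_level_def dyadic_eq by (auto simp: measure_dy ivls_def)
  then show ?thesis
    by (auto simp: dyadic_upto_def ivls_def)
qed

lemma halves_dy: "left_half (dy (l, i)) = dy (Suc l, 2 * i)" "right_half (dy (l, i)) = dy (Suc l, 2 * i + 1)"
proof -
  have "Inf (dy (l, i)) = real i / 2 ^ l" "Sup (dy (l, i)) = (real i + 1) / 2 ^ l"
    by (simp_all add: dy_def divide_strict_right_mono)
  moreover have "(real i / 2 ^ l + (real i + 1) / 2 ^ l) / 2 = (2 * real i + 1) / 2 ^ Suc l"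
    "real i / 2 ^ l = 2 * real i / 2 ^ Suc l" "(real i + 1) / 2 ^ l = (2 * real i + 1 + 1) / 2 ^ Suc l"
    by (simp_all add: field_simps)
  ultimately show "left_half (dy (l, i)) = dy (Suc l, 2 * i)" "right_half (dy (l, i)) = dy (Suc l, 2 * i + 1)"
    by (simp_all only: left_half_def right_half_def dy_def fst_conv snd_conv of_nat_add of_nat_mult of_nat_numeral of_nat_1)
qed

lemma haar_dy: "haar (dy (l, i)) x = of_bool (x \<in> dy (Suc l, 2 * i)) - of_bool (x \<in> dy (Suc l, 2 * i + 1))"
  by (simp add: haar_def halves_dy indicator_def)

lemma haar_dy_fine:
  assumes "x \<in> dy (k, j)" "l < k"
  shows "haar (dy (l, i)) x = of_bool (j div 2 ^ (k - Suc l) = 2 * i) - of_bool (j div 2 ^ (k - Suc l) = 2 * i + 1)"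
  using assms by (simp add: haar_dy mem_dy_coarser[OF assms(1)])

lemma haar_dy_square: "(haar (dy a) x)\<^sup>2 = of_bool (x \<in> dy a)"
proof -
  obtain l i where a: "a = (l, i)" by force
  define j where "j = nat \<lfloor>x * 2 ^ Suc l\<rfloor>"
  show ?thesis
  proof (cases "x \<ge> 0")
    case True
    then have x: "x \<in> dy (Suc l, j)"
      by (simp add: mem_dy_iff j_def)
    have "j div 2 = i \<longleftrightarrow> j = 2 * i \<or> j = 2 * i + 1" by auto
    then show ?thesis
      using mem_dy_coarser[OF x, of l i] haar_dy_fine[OF x, of l i] by (auto simp: a)
  next
    case False
    then have "x \<notin> dy b" for b
      using dy_nonneg by blast
    then show ?thesis by (simp add: a haar_dy)
  qed
qed

section \<open>Integrals of dyadic step functions\<close>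

lemma cell_exists:
  assumes "x \<in> {0..<1::real}"
  obtains j where "j < 2 ^ k" "x \<in> dy (k, j)"
proof
  have "\<lfloor>x * 2 ^ k\<rfloor> < 2 ^ k"
    using assms by (simp add: floor_less_iff)
  then show "nat \<lfloor>x * 2 ^ k\<rfloor> < 2 ^ k"
    by (simp add: nat_less_iff)
  show "x \<in> dy (k, nat \<lfloor>x * 2 ^ k\<rfloor>)"
    using assms by (simp add: mem_dy_iff)
qed

lemma dy_subset_unit: "j < 2 ^ k \<Longrightarrow> dy (k, j) \<subseteq> {0..<1}"
proof
  fix x assume j: "j < 2 ^ k" and x: "x \<in> dy (k, j)"
  have "real (j + 1) \<le> real (2 ^ k)"
    using j by (simp only: of_nat_le_iff)
  then have "(real j + 1) / 2 ^ k \<le> 1"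
    by simp
  moreover have "x < (real j + 1) / 2 ^ k"
    using x by (simp add: dy_def)
  ultimately have "x < 1"
    by (rule order.strict_trans2[rotated])
  then show "x \<in> {0..<1}"
    using dy_nonneg[OF x] by simp
qed

text \<open>The integrands met below are constant on dyadic cells or multiples of such functions, so
  integrals reduce to finite averages.\<close>

lemma integral_step:
  fixes f :: "real \<Rightarrow> real"
  assumes "\<And>x j. j < 2 ^ k \<Longrightarrow> x \<in> dy (k, j) \<Longrightarrow> f x = g j"
  shows "(LINT x:{0..<1}|lborel. f x) = (\<Sum>j<2 ^ k. g j) / 2 ^ k"
proof -
  have "indicator {0..<1} x *\<^sub>R f x = (\<Sum>j<2 ^ k. g j * indicator (dy (k, j)) x)" for x
  proof (cases "x \<in> {0..<1::real}")
    case True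
    then obtain j where j: "j < 2 ^ k" "x \<in> dy (k, j)"
      by (rule cell_exists)
    have "x \<in> dy (k, j') \<longleftrightarrow> j' = j" for j'
      using mem_dy_coarser[OF j(2), of k j'] by auto
    then have "(\<Sum>j'<2 ^ k. g j' * indicator (dy (k, j')) x) = (\<Sum>j'<2 ^ k. if j' = j then g j' else 0)"
      by (intro sum.cong) (auto simp: indicator_def)
    then show ?thesis
      using True j assms by simp
  next
    case False
    then have "x \<notin> dy (k, j)" if "j < 2 ^ k" for j
      using dy_subset_unit[OF that] by blast
    with False show ?thesis by simp
  qed
  then have "(LINT x:{0..<1}|lborel. f x) = (\<Sum>j<2 ^ k. LINT x|lborel. g j * indicator (dy (k, j)) x)"
    unfolding set_lebesgue_integral_def
    by (subst Bochner_Integration.integral_sum[symmetric])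
      (auto intro!: integrable_mult_right integrable_real_indicator emeasure_dy[unfolded infinity_ennreal_def])
  also have "\<dots> = (\<Sum>j<2 ^ k. g j / 2 ^ k)"
    using measure_dy by simp
  finally show ?thesis
    by (simp add: sum_divide_distrib)
qed

definition cell_point :: "nat \<Rightarrow> nat \<Rightarrow> nat \<Rightarrow> real \<times> real" where
  "cell_point k i j = (real i / 2 ^ k, real j / 2 ^ k)"

definition cellwise :: "nat \<Rightarrow> (real \<times> real \<Rightarrow> real) \<Rightarrow> bool" where
  "cellwise k f \<longleftrightarrow> (\<forall>i<2 ^ k. \<forall>j<2 ^ k. \<forall>x\<in>dy (k, i). \<forall>y\<in>dy (k, j). f (x, y) = f (cell_point k i j))"

lemma pairing_cellwise:
  assumes "cellwise k f" "cellwise k g"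
  shows "pairing f g = (\<Sum>j<2 ^ k. (\<Sum>i<2 ^ k. f (cell_point k i j) * g (cell_point k i j)) / 2 ^ k) / 2 ^ k"
  unfolding pairing_def
proof (rule integral_step)
  fix y j assume "j < (2::nat) ^ k" "y \<in> dy (k, j)"
  then show "(LINT x:{0..<1}|lborel. f (x, y) * g (x, y))
      = (\<Sum>i<2 ^ k. f (cell_point k i j) * g (cell_point k i j)) / 2 ^ k"
    using assms by (intro integral_step) (auto simp: cellwise_def)
qed

text \<open>The strict inequality accounts for the sign change at the midpoint: a Haar function of
  level n is constant only on cells of half that length.\<close>

lemma cellwise_haar_fn:
  assumes "r \<in> rects n" "n < k"
  shows "cellwise k (haar_fn r)"
proof -
  obtain l i l' i' where r: "r = ((l, i), (l', i'))"
    by (metis surj_pair)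
  have l: "l < k" "l' < k"
    using assms by (auto simp: r rects_def ivls_def)
  show ?thesis
    unfolding cellwise_def haar_fn_def haar2_def cell_point_def r
    using haar_dy_fine[OF _ l(1), of _ _ i] haar_dy_fine[OF _ l(2), of _ _ i'] haar_dy_fine[OF dy_nonempty l(1)]
      haar_dy_fine[OF dy_nonempty l(2)]
    by simp
qed

text \<open>The coarser function is constant on the interval of the finer one, and the finer one has
  mean zero.\<close>

lemma haar_dy_orthogonal:
  "(LINT x:{0..<1}|lborel. haar (dy a) x * haar (dy b) x) = of_bool (a = b) / 2 ^ fst a"
  if "a \<in> ivls n" "b \<in> ivls n" for a b
proof -
  have mean_zero: "(LINT x:{0..<1}|lborel. haar (dy a) x) = 0" if a: "a \<in> ivls n" for a
  proof -
    obtain l i where li: "a = (l, i)" "i < 2 ^ l"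
      using a by (auto simp: ivls_def)
    have "(LINT x:{0..<1}|lborel. haar (dy a) x)
        = (\<Sum>j<2 ^ Suc l. of_bool (j = 2 * i) - of_bool (j = 2 * i + 1)) / 2 ^ Suc l"
      unfolding li(1) by (rule integral_step) (simp add: haar_dy_fine)
    also have "(\<Sum>j<2 ^ Suc l. of_bool (j = 2 * i) - of_bool (j = 2 * i + 1) :: real) = 0"
      using li(2) by (simp add: sum_subtractf of_bool_def)
    finally show ?thesis by simp
  qed
  have off: "(LINT x:{0..<1}|lborel. haar (dy a) x * haar (dy b) x) = 0"
    if ab: "a \<in> ivls n" "b \<in> ivls n" "a \<noteq> b" "fst a \<le> fst b" for a b
  proof -
    obtain l i l' i' where a: "a = (l, i)" and b: "b = (l', i')"
      by (metis surj_pair)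
    \<comment> \<open>The value of the Haar function of a on the interval b; for equal lengths the
      intervals are disjoint and it is 0.\<close>
    define c :: real where "c = of_bool (l < l') *
      (of_bool (i' div 2 ^ (l' - Suc l) = 2 * i) - of_bool (i' div 2 ^ (l' - Suc l) = 2 * i + 1))"
    have eq: "haar (dy a) x * haar (dy b) x = c * haar (dy b) x" for x
    proof (cases "x \<in> dy b")
      case True
      show ?thesis
      proof (cases "l < l'")
        case True
        then show ?thesis
          using haar_dy_fine[of x l' i' l i] \<open>x \<in> dy b\<close> by (simp add: c_def a b)
      next
        case False
        then have "l = l'" "i \<noteq> i'"
          using ab by (auto simp: a b)
        then have "x \<notin> dy a"
          using mem_dy_coarser[of x l' i' l i] \<open>x \<in> dy b\<close> by (simp add: a b)
        then have "haar (dy a) x = 0"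
          using haar_dy_square[of a x] by simp
        then show ?thesis
          using False by (simp add: c_def)
      qed
    next
      case False
      then have "haar (dy b) x = 0"
        using haar_dy_square[of b x] by simp
      then show ?thesis by simp
    qed
    show ?thesis
      unfolding eq set_integral_mult_right mean_zero[OF ab(2)] by simp
  qed
  show ?thesis
  proof (cases "a = b")
    case True
    have "(LINT x:{0..<1}|lborel. haar (dy a) x * haar (dy a) x)
        = (\<Sum>j<2 ^ fst a. of_bool (j = snd a)) / 2 ^ fst a"
    proof (rule integral_step)
      fix x j assume x: "x \<in> dy (fst a, j)"
      show "haar (dy a) x * haar (dy a) x = of_bool (j = snd a)"
        using mem_dy_coarser[OF x, of "fst a" "snd a"] haar_dy_square[of a x] by (simp add: power2_eq_square)
    qed
    also have "(\<Sum>j<2 ^ fst a. of_bool (j = snd a) :: real) = 1"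
      using that by (auto simp: ivls_def of_bool_def)
    finally show ?thesis
      using True by simp
  next
    case False
    then show ?thesis
      using off[of a b] off[of b a] that by (cases "fst a \<le> fst b") (auto simp: mult.commute)
  qed
qed

lemma pairing_haar_fn:
  assumes "r \<in> rects n" "s \<in> rects n"
  shows "pairing (haar_fn r) (haar_fn s) = of_bool (r = s) * area r"
proof -
  have *: "fst r \<in> ivls n" "fst s \<in> ivls n" "snd r \<in> ivls n" "snd s \<in> ivls n"
    using assms by (auto simp: rects_def)
  have "pairing (haar_fn r) (haar_fn s) = (LINT y:{0..<1}|lborel. LINT x:{0..<1}|lborel.
      (haar (dy (snd r)) y * haar (dy (snd s)) y) * (haar (dy (fst r)) x * haar (dy (fst s)) x))"
    by (simp add: pairing_def haar_fn_def haar2_def mult_ac)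
  also have "\<dots> = (LINT y:{0..<1}|lborel. (haar (dy (snd r)) y * haar (dy (snd s)) y)
      * (of_bool (fst r = fst s) / 2 ^ fst (fst r)))"
    by (simp only: set_integral_mult_right haar_dy_orthogonal[OF *(1,2)])
  also have "\<dots> = (of_bool (snd r = snd s) / 2 ^ fst (snd r)) * (of_bool (fst r = fst s) / 2 ^ fst (fst r))"
    by (simp only: set_integral_mult_left haar_dy_orthogonal[OF *(3,4)])
  also have "\<dots> = of_bool (r = s) * area r"
    by (cases "fst r = fst s"; cases "snd r = snd s") (auto simp: area_def prod_eq_iff[of r s])
  finally show ?thesis .
qed

section \<open>Haar expansions and their coefficients\<close>

definition synth :: "nat \<Rightarrow> (ivl \<times> ivl \<Rightarrow> real) \<Rightarrow> real \<times> real \<Rightarrow> real" where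
  "synth k c = (\<Sum>r\<in>rects k. c r *\<^sub>R haar_fn r)"

text \<open>The value 0 off \<open>rects k\<close> lets linearity be stated as an equality of
  functions.\<close>

definition coeff :: "nat \<Rightarrow> (real \<times> real \<Rightarrow> real) \<Rightarrow> ivl \<times> ivl \<Rightarrow> real" where
  "coeff k f r = (if r \<in> rects k then pairing f (haar_fn r) / area r else 0)"

lemma sum_fun_apply: "(\<Sum>k\<in>K. f k) z = (\<Sum>k\<in>K. f k z)" for f :: "'a \<Rightarrow> 'b \<Rightarrow> 'c::comm_monoid_add"
  by (induction K rule: infinite_finite_induct) auto

lemma synth_apply: "synth k c z = (\<Sum>r\<in>rects k. c r * haar_fn r z)"
  by (simp add: synth_def sum_fun_apply scaleR_fun_def)

lemma cellwise_synth: "n < k \<Longrightarrow> cellwise k (synth n c)"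
  using cellwise_haar_fn[of _ n k] unfolding cellwise_def synth_apply
  by (auto intro!: sum.cong)

lemma pairing_synth_left:
  assumes "cellwise k g" "n < k"
  shows "pairing (synth n c) g = (\<Sum>r\<in>rects n. c r * pairing (haar_fn r) g)"
proof -
  have "pairing (synth n c) g = (\<Sum>j<2 ^ k. \<Sum>i<2 ^ k. \<Sum>r\<in>rects n.
      c r * haar_fn r (cell_point k i j) * g (cell_point k i j) / 2 ^ k / 2 ^ k)"
    by (simp add: pairing_cellwise[OF cellwise_synth[OF assms(2)] assms(1)] synth_apply sum_distrib_right sum_divide_distrib)
  also have "\<dots> = (\<Sum>r\<in>rects n. \<Sum>j<2 ^ k. \<Sum>i<2 ^ k.
      c r * haar_fn r (cell_point k i j) * g (cell_point k i j) / 2 ^ k / 2 ^ k)"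
    by (subst sum.swap[of _ "{..<2 ^ k}" "rects n"], subst sum.swap[of _ "rects n"]) simp
  also have "\<dots> = (\<Sum>r\<in>rects n. c r * pairing (haar_fn r) g)"
    by (intro sum.cong refl)
      (simp add: pairing_cellwise[OF cellwise_haar_fn[OF _ assms(2)] assms(1)] sum_distrib_left sum_divide_distrib mult.assoc)
  finally show ?thesis .
qed

lemma pairing_commute: "pairing f g = pairing g f"
  by (simp add: pairing_def mult.commute)

lemma pairing_synth_haar:
  assumes "s \<in> rects n"
  shows "pairing (synth n c) (haar_fn s) = c s * area s"
proof -
  have "pairing (synth n c) (haar_fn s) = (\<Sum>r\<in>rects n. c r * pairing (haar_fn r) (haar_fn s))"
    by (rule pairing_synth_left[of "Suc n"]) (use cellwise_haar_fn[OF assms] in auto)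
  also have "\<dots> = (\<Sum>r\<in>rects n. if r = s then c s * area s else 0)"
    using assms by (intro sum.cong refl) (auto simp: pairing_haar_fn)
  finally show ?thesis
    using assms by simp
qed

lemma pairing_synth: "pairing (synth n c) (synth n d) = pair_c n c d"
proof -
  have "pairing (synth n c) (synth n d) = (\<Sum>r\<in>rects n. c r * pairing (haar_fn r) (synth n d))"
    by (rule pairing_synth_left[of "Suc n"]) (use cellwise_synth in auto)
  also have "\<dots> = pair_c n c d"
    unfolding pair_c_def
    by (intro sum.cong refl) (simp add: pairing_commute[of "haar_fn _"] pairing_synth_haar mult.assoc)
  finally show ?thesis .
qed

lemma coeff_synth: "r \<in> rects n \<Longrightarrow> coeff n (synth n c) r = c r"
  using less_imp_neq[OF area_pos[of r]] by (auto simp: coeff_def pairing_synth_haar)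

lemma synth_cong: "(\<And>r. r \<in> rects n \<Longrightarrow> c r = d r) \<Longrightarrow> synth n c = synth n d"
  by (simp add: synth_def)

lemma synth_add: "synth n (\<lambda>r. c r + d r) = synth n c + synth n d"
  by (simp add: synth_def scaleR_left_distrib sum.distrib)

lemma synth_scale: "synth n (\<lambda>r. a * c r) = a *\<^sub>R synth n c"
  by (simp add: synth_def scaleR_sum_right)

lemma inj_haar_fn: "inj_on haar_fn (rects n)"
proof (rule inj_onI)
  fix r s assume *: "r \<in> rects n" "s \<in> rects n" "haar_fn r = haar_fn s"
  then have "of_bool (r = s) * area r = area s"
    using pairing_haar_fn[of r n s] pairing_haar_fn[of s n s] by simp
  then show "r = s"
    using less_imp_neq[OF area_pos[of s]] by (cases "r = s") auto
qed

lemma haar_space_eq: "haar_space n = range (synth n)"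
proof -
  have "haar2 ` (dyadic_upto n \<times> dyadic_upto n) = haar_fn ` rects n"
    by (simp add: dyadic_upto_eq rects_def haar_fn_eq image_comp map_prod_surj_on[OF refl refl, symmetric])
  then have "haar_space n = range (\<lambda>u. \<Sum>v\<in>haar_fn ` rects n. u v *\<^sub>R v)"
    by (simp add: haar_space_def real_vector.span_finite)
  also have "\<dots> = range (\<lambda>u. synth n (\<lambda>r. u (haar_fn r)))"
    unfolding synth_def sum.reindex[OF inj_haar_fn] by simp
  also have "\<dots> = range (synth n)"
  proof (intro equalityI subsetI)
    fix f assume "f \<in> range (synth n)"
    then obtain c where "f = synth n c" by blast
    also have "\<dots> = synth n (\<lambda>r. (c \<circ> inv_into (rects n) haar_fn) (haar_fn r))"
      by (rule synth_cong) (simp add: inv_into_f_f[OF inj_haar_fn])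
    finally show "f \<in> range (\<lambda>u. synth n (\<lambda>r. u (haar_fn r)))"
      by blast
  qed auto
  finally show ?thesis .
qed

lemma synth_coeff: "f \<in> haar_space n \<Longrightarrow> synth n (coeff n f) = f"
  unfolding haar_space_eq by (auto intro!: synth_cong simp: coeff_synth)

lemma coeff_add:
  assumes "f \<in> haar_space n" "g \<in> haar_space n"
  shows "coeff n (f + g) = (\<lambda>r. coeff n f r + coeff n g r)"
proof
  fix r
  obtain c d where f: "f = synth n c" and g: "g = synth n d"
    using assms unfolding haar_space_eq by blast
  show "coeff n (f + g) r = coeff n f r + coeff n g r"
    using coeff_synth[of r n] unfolding f g synth_add[symmetric] by (cases "r \<in> rects n") (simp_all add: coeff_def)
qed

lemma coeff_scale:
  assumes "f \<in> haar_space n"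
  shows "coeff n (a *\<^sub>R f) = (\<lambda>r. a * coeff n f r)"
proof
  fix r
  obtain c where f: "f = synth n c"
    using assms unfolding haar_space_eq by blast
  show "coeff n (a *\<^sub>R f) r = a * coeff n f r"
    using coeff_synth[of r n] unfolding f synth_scale[symmetric] by (cases "r \<in> rects n") (simp_all add: coeff_def)
qed

section \<open>The full Haar system and \<open>haar_coeff\<close>\<close>

lemma rects_mono: "k \<le> n \<Longrightarrow> rects k \<subseteq> rects n"
  by (auto simp: rects_def ivls_def)

lemma dyadic_rects_eq: "dyadic \<times> dyadic = map_prod dy dy ` (\<Union>k. rects k)"
proof -
  have "(a, b) \<in> (\<Union>k. rects k)" if "a \<in> ivls k" "b \<in> ivls k'" for a b k k'
    using that by (intro UN_I[of "max k k'"]) (auto simp: rects_def ivls_def)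
  then have "(\<Union>k. ivls k) \<times> (\<Union>k. ivls k) = (\<Union>k. rects k)"
    by (auto simp: rects_def)
  then show ?thesis
    by (simp add: dyadic_eq map_prod_surj_on[OF refl refl, symmetric])
qed

lemma haar_basis_eq: "haar2 ` (dyadic \<times> dyadic) = haar_fn ` (\<Union>k. rects k)"
  by (simp only: dyadic_rects_eq haar_fn_eq image_comp)

lemma finite_subset_rects:
  assumes "finite T" "T \<subseteq> (\<Union>k. rects k)"
  obtains k where "T \<subseteq> rects k"
  using assms
proof (induction T arbitrary: thesis rule: finite_induct)
  case (insert r T)
  obtain k where k: "T \<subseteq> rects k"
    using insert.IH insert.prems(2) by auto
  obtain k' where "r \<in> rects k'"
    using insert.prems(2) by auto
  then have "insert r T \<subseteq> rects (max k k')"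
    using k rects_mono[of k "max k k'"] rects_mono[of k' "max k k'"] by auto
  then show ?case by (rule insert.prems(1))
qed blast

text \<open>\<open>haar_coeff\<close> uses \<open>representation\<close> over the infinite family of
  all Haar functions, which is meaningful only for an independent family. Finitely many of them lie
  in a common \<open>rects k\<close>, where pairing recovers the coefficients.\<close>

lemma independent_haar: "independent (haar2 ` (dyadic \<times> dyadic))"
  unfolding real_vector.independent_explicit_module
proof (intro allI impI)
  fix S u v
  assume S: "finite S" "S \<subseteq> haar2 ` (dyadic \<times> dyadic)" and zero: "(\<Sum>v\<in>S. u v *\<^sub>R v) = 0" and v: "v \<in> S"
  obtain T where T: "finite T" "T \<subseteq> (\<Union>k. rects k)" "S = haar_fn ` T"
    using finite_subset_image[of S haar_fn "\<Union>k. rects k"] S by (auto simp: haar_basis_eq)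
  obtain k where k: "T \<subseteq> rects k"
    using finite_subset_rects[OF T(1,2)] .
  obtain r where r: "r \<in> T" "v = haar_fn r"
    using v T by blast
  let ?c = "\<lambda>r. if r \<in> T then u (haar_fn r) else 0"
  have "synth k ?c = (\<Sum>r\<in>T. u (haar_fn r) *\<^sub>R haar_fn r)"
    unfolding synth_def using k by (intro sum.mono_neutral_cong_right) auto
  also have "\<dots> = 0"
    using zero inj_on_subset[OF inj_haar_fn k] by (simp add: T(3) sum.reindex)
  finally have "synth k ?c = 0" .
  moreover have "synth k (\<lambda>r. 0) = 0"
    by (simp add: synth_def)
  ultimately have "?c r = 0"
    using coeff_synth[of r k ?c] coeff_synth[of r k "\<lambda>r. 0"] k r by auto
  then show "u v = 0"
    using r by simp
qed

lemma haar_coeff_synth: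
  assumes R: "R \<in> dyadic \<times> dyadic"
  shows "haar_coeff (synth n c) R = (\<Sum>r\<in>rects n. if haar_fn r = haar2 R then c r else 0)"
proof -
  let ?B = "haar2 ` (dyadic \<times> dyadic)"
  have B: "haar_fn r \<in> ?B" if "r \<in> rects n" for r
    using that unfolding haar_basis_eq by blast
  have "representation ?B (synth n c) = (\<lambda>b. \<Sum>r\<in>rects n. representation ?B (c r *\<^sub>R haar_fn r) b)"
    unfolding synth_def
    by (rule real_vector.representation_sum[OF independent_haar])
      (intro real_vector.span_scale real_vector.span_base B)
  also have "\<dots> = (\<lambda>b. \<Sum>r\<in>rects n. c r * (if b = haar_fn r then 1 else 0))"
    by (intro ext sum.cong refl)
      (simp add: real_vector.representation_scale[OF independent_haar] real_vector.span_base B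
        real_vector.representation_basis[OF independent_haar])
  finally show ?thesis
    by (simp add: haar_coeff_def if_distrib eq_commute cong: if_cong)
qed

lemma haar_coeff_synth_eq:
  assumes "r \<in> rects k"
  shows "haar_coeff (synth n c) (dy (fst r), dy (snd r)) = (if r \<in> rects n then c r else 0)"
proof -
  have R: "(dy (fst r), dy (snd r)) \<in> dyadic \<times> dyadic"
    unfolding dyadic_rects_eq using assms by (intro image_eqI[of _ _ r]) (auto simp: map_prod_def case_prod_unfold)
  have "haar_fn s = haar2 (dy (fst r), dy (snd r)) \<longleftrightarrow> s = r" if "s \<in> rects n" for s
  proof -
    have "s \<in> rects (max k n)" "r \<in> rects (max k n)"
      using that assms rects_mono[of k "max k n"] rects_mono[of n "max k n"] by auto
    then show ?thesis
      using inj_on_eq_iff[OF inj_haar_fn, of s "max k n" r] by (simp add: haar_fn_def[of r])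
  qed
  then show ?thesis
    unfolding haar_coeff_synth[OF R] by (simp cong: sum.cong if_cong)
qed

section \<open>Norms of Haar expansions in terms of coefficients\<close>

lemma square_sum_synth: "square_sum (synth n c) z = (\<Sum>r\<in>rects n. (c r)\<^sup>2 * (haar_fn r z)\<^sup>2)"
proof -
  let ?d = "\<lambda>r. (dy (fst r), dy (snd r))"
  let ?T = "{r \<in> rects n. c r \<noteq> 0}"
  have all: "dyadic \<times> dyadic = ?d ` (\<Union>k. rects k)"
    unfolding dyadic_rects_eq by (simp add: map_prod_def case_prod_unfold)
  have "{R \<in> dyadic \<times> dyadic. haar_coeff (synth n c) R \<noteq> 0} = ?d ` ?T"
  proof (intro equalityI subsetI)
    fix R assume "R \<in> {R \<in> dyadic \<times> dyadic. haar_coeff (synth n c) R \<noteq> 0}"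
    then obtain r k where r: "r \<in> rects k" "R = ?d r" "haar_coeff (synth n c) R \<noteq> 0"
      unfolding all by blast
    then show "R \<in> ?d ` ?T"
      by (intro image_eqI[of _ _ r]) (auto simp: haar_coeff_synth_eq split: if_splits)
  next
    fix R assume "R \<in> ?d ` ?T"
    then obtain r where "r \<in> rects n" "c r \<noteq> 0" "R = ?d r"
      by blast
    then show "R \<in> {R \<in> dyadic \<times> dyadic. haar_coeff (synth n c) R \<noteq> 0}"
      unfolding all by (auto simp: haar_coeff_synth_eq)
  qed
  moreover have "inj_on ?d ?T"
    using inj_dy by (auto simp: inj_on_def inj_def prod_eq_iff)
  ultimately have "square_sum (synth n c) z = (\<Sum>r\<in>?T. \<bar>haar_coeff (synth n c) (?d r)\<bar>\<^sup>2 * (haar2 (?d r) z)\<^sup>2)"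
    by (simp add: square_sum_def sum.reindex)
  also have "\<dots> = (\<Sum>r\<in>rects n. (c r)\<^sup>2 * (haar_fn r z)\<^sup>2)"
  proof (rule sum.mono_neutral_cong_left)
    fix r assume r: "r \<in> ?T"
    then have "haar_coeff (synth n c) (?d r) = c r"
      using haar_coeff_synth_eq[of r n n c] by simp
    then show "\<bar>haar_coeff (synth n c) (?d r)\<bar>\<^sup>2 * (haar2 (?d r) z)\<^sup>2 = (c r)\<^sup>2 * (haar_fn r z)\<^sup>2"
      by (simp add: haar_fn_def)
  qed auto
  finally show ?thesis .
qed

text \<open>Cells of level n suffice, in contrast to \<open>cellwise_haar_fn\<close>: squares of
  Haar functions do not jump at midpoints.\<close>

lemma square_sum_cell:
  assumes "i < 2 ^ n" "j < 2 ^ n" "x \<in> dy (n, i)" "y \<in> dy (n, j)"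
  shows "square_sum (synth n c) (x, y) = (square_fn n c i j)\<^sup>2"
proof -
  have mem: "x \<in> dy a \<longleftrightarrow> a \<in> chain n i" if a: "a \<in> ivls n" and x: "x \<in> dy (n, i)" for a i x
  proof -
    obtain l k where a: "a = (l, k)" "l \<le> n"
      using a by (cases a) (auto simp: ivls_def)
    then show ?thesis
      using mem_dy_coarser[OF x, of l k] by (auto simp: chain_def)
  qed
  have "square_sum (synth n c) (x, y) = (\<Sum>r\<in>rects n. (c r)\<^sup>2 * of_bool (r \<in> chain n i \<times> chain n j))"
    unfolding square_sum_synth
  proof (intro sum.cong refl)
    fix r assume "r \<in> rects n"
    then have "fst r \<in> ivls n" "snd r \<in> ivls n"
      by (auto simp: rects_def)
    then show "(c r)\<^sup>2 * (haar_fn r (x, y))\<^sup>2 = (c r)\<^sup>2 * of_bool (r \<in> chain n i \<times> chain n j)"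
      using mem assms(3,4) by (simp add: haar_fn_def haar2_def power_mult_distrib haar_dy_square mem_Times_iff)
  qed
  also have "\<dots> = (\<Sum>r\<in>chain n i \<times> chain n j. (c r)\<^sup>2)"
    using chain_subset[OF assms(1)] chain_subset[OF assms(2)]
    by (intro sum.mono_neutral_cong_right) (auto simp: rects_def)
  finally show ?thesis
    by (simp add: square_fn_def L2_set_def sum_nonneg)
qed

lemma hardy_norm_synth:
  assumes "1 \<le> p" "1 \<le> q"
  shows "hardy_norm p q (synth n c) = hardy_c p q n c"
proof -
  have "(LINT x:{0..<1}|lborel. (LINT y:{0..<1}|lborel. square_sum (synth n c) (x, y) powr (q / 2)) powr (p / q))
    = (\<Sum>i<2 ^ n. pmean q {..<2 ^ n} (square_fn n c i) powr p) / 2 ^ n"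
  proof (rule integral_step)
    fix x i assume i: "i < (2::nat) ^ n" "x \<in> dy (n, i)"
    have "(LINT y:{0..<1}|lborel. square_sum (synth n c) (x, y) powr (q / 2))
        = (\<Sum>j<2 ^ n. square_fn n c i j powr q) / 2 ^ n"
    proof (rule integral_step)
      fix y j assume j: "j < (2::nat) ^ n" "y \<in> dy (n, j)"
      have "((square_fn n c i j)\<^sup>2) powr (q / 2) = square_fn n c i j powr q"
        by (cases "square_fn n c i j = 0") (simp_all add: powr_powr flip: powr_numeral)
      then show "square_sum (synth n c) (x, y) powr (q / 2) = square_fn n c i j powr q"
        by (simp add: square_sum_cell[OF i(1) j(1) i(2) j(2)])
    qed
    also have "\<dots> powr (p / q) = pmean q {..<2 ^ n} (square_fn n c i) powr p"
      by (simp add: pmean_def powr_powr)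
    finally show "(LINT y:{0..<1}|lborel. square_sum (synth n c) (x, y) powr (q / 2)) powr (p / q)
        = pmean q {..<2 ^ n} (square_fn n c i) powr p" .
  qed
  then show ?thesis
    unfolding hardy_norm_def hardy_c_def pmean_def[of p] by simp
qed

lemma hardy_dual_norm_synth:
  assumes "1 \<le> p" "1 \<le> q"
  shows "hardy_dual_norm p q n (synth n c) = dual_c p q n c"
proof -
  have "{\<bar>pairing (synth n c) g\<bar> | g. g \<in> haar_space n \<and> hardy_norm p q g \<le> 1}
      = {\<bar>pair_c n c d\<bar> | d. hardy_c p q n d \<le> 1}"
  proof (intro equalityI subsetI)
    fix t assume "t \<in> {\<bar>pairing (synth n c) g\<bar> | g. g \<in> haar_space n \<and> hardy_norm p q g \<le> 1}"
    then obtain d where "t = \<bar>pairing (synth n c) (synth n d)\<bar>" "hardy_norm p q (synth n d) \<le> 1"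
      unfolding haar_space_eq by blast
    then show "t \<in> {\<bar>pair_c n c d\<bar> | d. hardy_c p q n d \<le> 1}"
      by (auto simp: hardy_norm_synth[OF assms] pairing_synth)
  next
    fix t assume "t \<in> {\<bar>pair_c n c d\<bar> | d. hardy_c p q n d \<le> 1}"
    then obtain d where "t = \<bar>pair_c n c d\<bar>" "hardy_c p q n d \<le> 1"
      by blast
    then have "t = \<bar>pairing (synth n c) (synth n d)\<bar>" "synth n d \<in> haar_space n" "hardy_norm p q (synth n d) \<le> 1"
      by (simp_all add: hardy_norm_synth[OF assms] pairing_synth haar_space_eq)
    then show "t \<in> {\<bar>pairing (synth n c) g\<bar> | g. g \<in> haar_space n \<and> hardy_norm p q g \<le> 1}"
      by blast
  qed
  then show ?thesis
    by (simp add: hardy_dual_norm_def dual_c_def)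
qed

section \<open>Operators on Haar spaces\<close>

lemma linear_between_sum:
  assumes T: "linear_between (haar_space n) W T" and "finite K" "\<And>k. k \<in> K \<Longrightarrow> f k \<in> haar_space n"
  shows "T (\<Sum>k\<in>K. c k *\<^sub>R f k) = (\<Sum>k\<in>K. c k *\<^sub>R T (f k))"
  using assms(2,3)
proof (induction K rule: finite_induct)
  case empty
  have "(0 :: real \<times> real \<Rightarrow> real) \<in> haar_space n"
    by (simp add: haar_space_def real_vector.span_zero)
  then have "T (0 *\<^sub>R 0) = 0 *\<^sub>R T 0"
    using T unfolding linear_between_def by blast
  then show ?case
    by (simp only: scaleR_zero_left sum.empty)
next
  case (insert k K)
  have "c k *\<^sub>R f k \<in> haar_space n" "(\<Sum>k\<in>K. c k *\<^sub>R f k) \<in> haar_space n"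
    using insert.prems unfolding haar_space_def
    by (auto intro!: real_vector.span_scale real_vector.span_sum)
  then have "T (c k *\<^sub>R f k + (\<Sum>k\<in>K. c k *\<^sub>R f k)) = T (c k *\<^sub>R f k) + T (\<Sum>k\<in>K. c k *\<^sub>R f k)"
    using T unfolding linear_between_def by blast
  also have "T (c k *\<^sub>R f k) = c k *\<^sub>R T (f k)"
    using T insert.prems unfolding linear_between_def by blast
  also have "T (\<Sum>k\<in>K. c k *\<^sub>R f k) = (\<Sum>k\<in>K. c k *\<^sub>R T (f k))"
    using insert by blast
  finally show ?case
    unfolding sum.insert[OF insert.hyps(1,2)] .
qed

lemma haar_fn_in_haar_space: "r \<in> rects n \<Longrightarrow> haar_fn r \<in> haar_space n"
  unfolding haar_space_def
  by (intro real_vector.span_base) (auto simp: haar_fn_def dyadic_upto_eq rects_def)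

lemma synth_in_haar_space [simp]: "synth n c \<in> haar_space n"
  by (simp add: haar_space_eq)

lemma operator_matrix:
  assumes T: "linear_between (haar_space N) (haar_space N) T"
  shows "T (synth N c) = synth N (matrix_c N (\<lambda>q q'. pairing (T (haar_fn q)) (haar_fn q')) c)"
proof -
  have "T (synth N c) = (\<Sum>q\<in>rects N. c q *\<^sub>R T (haar_fn q))"
    unfolding synth_def by (rule linear_between_sum[OF T]) (auto intro: haar_fn_in_haar_space)
  also have "\<dots> = (\<Sum>q\<in>rects N. c q *\<^sub>R synth N (coeff N (T (haar_fn q))))"
    using T by (intro sum.cong refl) (simp add: linear_between_def synth_coeff haar_fn_in_haar_space)
  also have "\<dots> = synth N (\<lambda>q'. \<Sum>q\<in>rects N. c q * coeff N (T (haar_fn q)) q')"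
    unfolding synth_def scaleR_sum_right scaleR_sum_left scaleR_scaleR by (rule sum.swap)
  also have "\<dots> = synth N (matrix_c N (\<lambda>q q'. pairing (T (haar_fn q)) (haar_fn q')) c)"
    by (rule synth_cong) (simp add: matrix_c_def coeff_def sum_divide_distrib)
  finally show ?thesis .
qed

text \<open>
  The supremum defining \<open>op_norm\<close> is over a bounded set because there are only finitely many
  coefficients, each controlled by the norm.
\<close>

lemma op_norm_bound:
  assumes norm: "lattice_norm (rects N) area \<nu>"
    and normV: "\<And>c. normV (synth N c) = \<nu> c"
    and T: "\<And>c. T (synth N c) = synth N (matrix_c N t c)"
    and bound: "op_norm (haar_space N) normV normV T \<le> \<Gamma>" and \<Gamma>: "0 \<le> \<Gamma>"
  shows "\<nu> (matrix_c N t c) \<le> \<Gamma> * \<nu> c"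
proof -
  interpret lattice_norm "rects N" area \<nu> by (rule norm)
  define B where "B = (\<Sum>s\<in>rects N. \<Sum>r\<in>rects N. \<bar>t r s / area s\<bar> * (1 / area r))"
  have B: "\<nu> (matrix_c N t c) \<le> B * \<nu> c" for c
  proof -
    have "\<nu> (matrix_c N t c) = \<nu> (\<lambda>s. \<Sum>r\<in>rects N. t r s / area s * c r)"
      by (intro cong) (simp add: matrix_c_def sum_divide_distrib mult.commute)
    also have "\<dots> \<le> (\<Sum>s\<in>rects N. \<Sum>r\<in>rects N. \<bar>t r s / area s\<bar> * (\<nu> c / area r))"
      by (rule matrix_bound) (auto intro: coeff_bound)
    also have "\<dots> = B * \<nu> c"
      by (simp add: B_def sum_distrib_right)
    finally show ?thesis .
  qed
  have B0: "0 \<le> B"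
    unfolding B_def by (intro sum_nonneg mult_nonneg_nonneg) (auto simp: less_imp_le)
  show ?thesis
  proof (cases "\<nu> c = 0")
    case True
    then show ?thesis using B[of c] by simp
  next
    case False
    then have pos: "0 < \<nu> c"
      using nonneg[of c] by linarith
    let ?S = "{normV (T f) | f. f \<in> haar_space N \<and> normV f \<le> 1}"
    have bdd: "bdd_above ?S"
    proof (rule bdd_aboveI)
      fix x assume "x \<in> ?S"
      then obtain d where "x = normV (T (synth N d))" "normV (synth N d) \<le> 1"
        unfolding haar_space_eq by blast
      then have "x \<le> B * \<nu> d" "\<nu> d \<le> 1"
        using B by (simp_all add: T normV)
      then show "x \<le> B"
        using B0 mult_left_mono[of "\<nu> d" 1 B] by simp
    qed
    let ?d = "\<lambda>r. 1 / \<nu> c * c r"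
    have "\<nu> ?d = 1"
      unfolding scale using pos by simp
    then have "normV (T (synth N ?d)) \<in> ?S"
      using normV[of ?d] by (intro CollectI exI[of _ "synth N ?d"]) simp
    then have "normV (T (synth N ?d)) \<le> \<Gamma>"
      using cSup_upper[OF _ bdd] bound unfolding op_norm_def by (meson order_trans)
    then have "\<nu> (matrix_c N t ?d) \<le> \<Gamma>"
      by (simp only: T normV)
    moreover have "matrix_c N t ?d = (\<lambda>s. 1 / \<nu> c * matrix_c N t c s)"
      by (rule ext) (simp add: matrix_c_def sum_distrib_left mult.assoc flip: sum_divide_distrib)
    ultimately show ?thesis
      using pos by (simp only: scale) (simp add: pos_divide_le_eq)
  qed
qed

lemma op_norm_least:
  assumes "\<And>f. f \<in> haar_space k \<Longrightarrow> normV f \<le> 1 \<Longrightarrow> normW (T f) \<le> B" "normV (0 :: real \<times> real \<Rightarrow> real) \<le> 1"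
  shows "op_norm (haar_space k) normV normW T \<le> B"
  unfolding op_norm_def
proof (rule cSup_least)
  have "(0 :: real \<times> real \<Rightarrow> real) \<in> haar_space k"
    by (simp add: haar_space_def real_vector.span_zero)
  then show "{normW (T f) | f. f \<in> haar_space k \<and> normV f \<le> 1} \<noteq> {}"
    using assms(2) by blast
qed (use assms(1) in blast)

text \<open>Multiplying the bounds for E and F requires the norm of F to be nonnegative. For a real
  \<open>Sup\<close> this rests on boundedness of the set, hence the bound B.\<close>

lemma op_norm_nonneg:
  assumes "\<And>f. f \<in> haar_space k \<Longrightarrow> normV f \<le> 1 \<Longrightarrow> 0 \<le> normW (T f) \<and> normW (T f) \<le> B"
    "normV (0 :: real \<times> real \<Rightarrow> real) \<le> 1"
  shows "0 \<le> op_norm (haar_space k) normV normW T"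
proof -
  have 0: "(0 :: real \<times> real \<Rightarrow> real) \<in> haar_space k"
    by (simp add: haar_space_def real_vector.span_zero)
  have "normW (T 0) \<le> op_norm (haar_space k) normV normW T"
    unfolding op_norm_def
  proof (rule cSup_upper)
    show "normW (T 0) \<in> {normW (T f) | f. f \<in> haar_space k \<and> normV f \<le> 1}"
      using 0 assms(2) by blast
    show "bdd_above {normW (T f) | f. f \<in> haar_space k \<and> normV f \<le> 1}"
      using assms(1) by (auto intro!: bdd_aboveI[of _ B])
  qed
  then show ?thesis
    using assms(1)[OF 0 assms(2)] by linarith
qed

text \<open>The floor loses less than 1, so m exceeds 40n + 122 plus the logarithmic terms, while
  40n + 36 is what the fourth power of the left side requires.\<close>

lemma size_estimate:
  assumes "0 < \<Gamma>" "0 < \<delta>" "0 < \<eta>"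
    and N: "int (m + n) = 41 * (int n + 3) + \<lfloor>4 * log 2 (\<Gamma> / \<delta>) + 4 * log 2 (1 + 1 / \<eta>)\<rfloor>"
  shows "2 ^ (10 * n + 9) * (\<Gamma> / \<delta>) * (1 + 1 / \<eta>) \<le> (2 ^ m) powr (1 / 4)"
proof -
  let ?L = "log 2 (\<Gamma> / \<delta>) + log 2 (1 + 1 / \<eta>)"
  have "4 * log 2 (\<Gamma> / \<delta>) + 4 * log 2 (1 + 1 / \<eta>) - 1 < \<lfloor>4 * log 2 (\<Gamma> / \<delta>) + 4 * log 2 (1 + 1 / \<eta>)\<rfloor>"
    by linarith
  moreover have "real m + real n = 41 * (real n + 3) + \<lfloor>4 * log 2 (\<Gamma> / \<delta>) + 4 * log 2 (1 + 1 / \<eta>)\<rfloor>"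
    using arg_cong[OF N, of real_of_int] by simp
  ultimately have "4 * (10 * real n + 9) + (4 * log 2 (\<Gamma> / \<delta>) + 4 * log 2 (1 + 1 / \<eta>)) \<le> real m"
    by argo
  then have m: "real (10 * n + 9) + ?L \<le> real m * (1 / 4)"
    by simp
  have pos: "0 < \<Gamma> / \<delta>" "0 < 1 + 1 / \<eta>"
    using assms by (auto simp: add_pos_pos)
  have "2 ^ (10 * n + 9) * (\<Gamma> / \<delta>) * (1 + 1 / \<eta>) = 2 powr (real (10 * n + 9) + ?L)"
  proof -
    have "2 powr log 2 (\<Gamma> / \<delta>) = \<Gamma> / \<delta>" "2 powr log 2 (1 + 1 / \<eta>) = 1 + 1 / \<eta>"
      "2 powr real (10 * n + 9) = 2 ^ (10 * n + 9)"
      using pos powr_realpow[of 2 "10 * n + 9"] by simp_all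
    then show ?thesis
      by (simp only: powr_add mult.assoc)
  qed
  also have "\<dots> \<le> 2 powr (real m * (1 / 4))"
    using m by (intro powr_mono) auto
  also have "\<dots> = (2 ^ m) powr (1 / 4)"
    by (simp only: powr_powr[symmetric]) (simp add: powr_realpow)
  finally show ?thesis .
qed

text \<open>Stated for a pair of norms in duality: \<nu> measures the space on which T acts and
  \<nu>' the test families. Both choices of the spaces V_k are instances, with the two norms
  exchanged.\<close>

lemma factorization:
  fixes normV :: "nat \<Rightarrow> (real \<times> real \<Rightarrow> real) \<Rightarrow> real" and T :: "(real \<times> real \<Rightarrow> real) \<Rightarrow> real \<times> real \<Rightarrow> real"
  assumes pos: "0 < \<delta>" "0 < \<Gamma>" "0 < \<eta>"
    and N: "int N = 41 * (int n + 3) + \<lfloor>4 * log 2 (\<Gamma> / \<delta>) + 4 * log 2 (1 + 1 / \<eta>)\<rfloor>"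
    and T: "linear_between (haar_space N) (haar_space N) T"
    and T_bound: "op_norm (haar_space N) (normV N) (normV N) T \<le> \<Gamma>"
    and diag: "\<forall>Q \<in> dyadic_upto N \<times> dyadic_upto N. \<bar>pairing (T (haar2 Q)) (haar2 Q)\<bar> \<ge> \<delta> * rect_area Q"
    and norm: "\<And>k. lattice_norm (rects k) area (\<nu> k)" "\<And>k. lattice_norm (rects k) area (\<nu>' k)"
    and normV: "\<And>k c. normV k (synth k c) = \<nu> k c"
    and duality: "\<And>k c d. \<bar>pair_c k c d\<bar> \<le> \<nu> k c * \<nu>' k d"
    and expand: "\<And>m \<phi> c. (\<And>q. \<bar>\<phi> q\<bar> \<le> 1) \<Longrightarrow> \<nu> (m + n) (expand m \<phi> c) \<le> \<nu> n c"
    and compress: "\<And>m \<phi> c. (\<And>q. \<bar>\<phi> q\<bar> \<le> 1) \<Longrightarrow> \<nu> n (compress m \<phi> c) \<le> \<nu> (m + n) c"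
    and block: "\<And>m. block_bound m n (\<nu> (m + n)) \<alpha> \<beta>" "\<And>m. block_bound m n (\<nu>' (m + n)) (1 - \<alpha>) (1 - \<beta>)"
  shows "\<exists>E F.
           linear_between (haar_space n) (haar_space N) E \<and>
           bounded_between (haar_space n) (normV n) (normV N) E \<and>
           linear_between (haar_space N) (haar_space n) F \<and>
           bounded_between (haar_space N) (normV N) (normV n) F \<and>
           (\<forall>f \<in> haar_space n. F (T (E f)) = f) \<and>
           op_norm (haar_space n) (normV n) (normV N) E *
             op_norm (haar_space N) (normV N) (normV n) F \<le> (1 + \<eta>) / \<delta>"
proof -
  interpret \<nu>: lattice_norm "rects k" area "\<nu> k" for k by (rule norm)
  interpret \<nu>': lattice_norm "rects k" area "\<nu>' k" for k by (rule norm)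
  define t where "t q q' = pairing (T (haar_fn q)) (haar_fn q')" for q q'
  have T_synth: "T (synth N c) = synth N (matrix_c N t c)" for c
    using operator_matrix[OF T] by (simp add: t_def[abs_def])
  have T_norm: "\<nu> N (matrix_c N t c) \<le> \<Gamma> * \<nu> N c" for c
    by (rule op_norm_bound[OF norm(1) normV T_synth T_bound less_imp_le[OF pos(2)]])
  have bound: "\<bar>\<Sum>q\<in>rects N. \<Sum>q'\<in>rects N. c q * d q' * t q q'\<bar> \<le> \<Gamma> * \<nu> N c * \<nu>' N d" for c d
  proof -
    have "pair_c N (matrix_c N t c) d = (\<Sum>q'\<in>rects N. \<Sum>q\<in>rects N. c q * d q' * t q q')"
      unfolding pair_c_def matrix_c_def
      by (intro sum.cong refl, simp add: less_imp_neq[OF area_pos, symmetric]) (simp add: sum_distrib_left mult_ac)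
    also have "\<dots> = (\<Sum>q\<in>rects N. \<Sum>q'\<in>rects N. c q * d q' * t q q')"
      by (rule sum.swap)
    finally have "\<bar>\<Sum>q\<in>rects N. \<Sum>q'\<in>rects N. c q * d q' * t q q'\<bar> \<le> \<nu> N (matrix_c N t c) * \<nu>' N d"
      using duality[of N "matrix_c N t c" d] by simp
    also have "\<dots> \<le> \<Gamma> * \<nu> N c * \<nu>' N d"
      by (intro mult_right_mono T_norm \<nu>'.nonneg)
    finally show ?thesis .
  qed
  have diag_t: "\<delta> * area q \<le> \<bar>t q q\<bar>" if q: "q \<in> rects N" for q
  proof -
    have "rect_area (dy (fst q), dy (snd q)) = area q"
    proof -
      have "measure (lborel \<Otimes>\<^sub>M lborel) (dy (fst q) \<times> dy (snd q)) = measure lborel (dy (fst q)) * measure lborel (dy (snd q))"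
        by (simp add: measure_def lborel.emeasure_pair_measure_Times enn2real_mult)
      then show ?thesis
        by (simp add: rect_area_def area_def measure_dy lborel_prod)
    qed
    moreover have mem: "(dy (fst q), dy (snd q)) \<in> dyadic_upto N \<times> dyadic_upto N"
      using q by (auto simp: rects_def dyadic_upto_eq)
    ultimately show ?thesis
      using bspec[OF diag mem] by (simp add: t_def haar_fn_def)
  qed
  \<comment> \<open>Testing T on the Haar function of the unit square, of norm at most 1 in both
    norms. It makes the floor in N nonnegative, so that N is at least n and m is a genuine
    difference.\<close>
  have "\<delta> \<le> \<Gamma>"
  proof -
    let ?r = "((0, 0), (0, 0)) :: ivl \<times> ivl"
    let ?c = "\<lambda>q. if q = ?r then 1 else 0 :: real"
    have r: "?r \<in> rects N"
      by (simp add: rects_def ivls_def)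
    have one: "(\<Sum>q\<in>rects N. \<bar>?c q\<bar>) = 1"
      using r by (simp add: if_distrib cong: if_cong)
    have "\<nu> N ?c \<le> 1" "\<nu>' N ?c \<le> 1"
      using \<nu>.upper[of N ?c] \<nu>'.upper[of N ?c] one by auto
    then have "\<Gamma> * \<nu> N ?c * \<nu>' N ?c \<le> \<Gamma> * 1 * 1"
      using pos(2) by (intro mult_mono) auto
    moreover have "(\<Sum>q\<in>rects N. \<Sum>q'\<in>rects N. ?c q * ?c q' * t q q') = t ?r ?r"
      using r by (simp add: if_distrib[of "\<lambda>x. x * _"] if_distrib[of "\<lambda>x. _ * x"] cong: if_cong)
    ultimately have "\<bar>t ?r ?r\<bar> \<le> \<Gamma>"
      using bound[of ?c ?c] by simp
    then show ?thesis
      using diag_t[OF r] by (simp add: area_def)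
  qed
  then have "0 \<le> log 2 (\<Gamma> / \<delta>)" "0 \<le> log 2 (1 + 1 / \<eta>)"
    using pos by (simp_all add: zero_le_log_cancel_iff add_pos_pos)
  then have "0 \<le> \<lfloor>4 * log 2 (\<Gamma> / \<delta>) + 4 * log 2 (1 + 1 / \<eta>)\<rfloor>"
    by simp
  then obtain k where "0 \<le> k" "int N = 41 * (int n + 3) + k"
    using N by blast
  then have "int n \<le> int N"
    by auto
  define m where "m = N - n"
  have m: "N = m + n"
    unfolding m_def using \<open>int n \<le> int N\<close> by simp
  have bound': "\<forall>c d. \<bar>\<Sum>q\<in>rects (m + n). \<Sum>q'\<in>rects (m + n). c q * d q' * t q q'\<bar> \<le> \<Gamma> * \<nu> (m + n) c * \<nu>' (m + n) d"
    using bound by (simp add: m)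
  have diag': "\<forall>q\<in>rects (m + n). \<delta> * area q \<le> \<bar>t q q\<bar>"
    using diag_t by (simp add: m)
  obtain \<phi> \<psi> :: "ivl \<times> ivl \<Rightarrow> real" and H where
    signs: "\<forall>q. \<bar>\<phi> q\<bar> \<le> 1 \<and> \<bar>\<psi> q\<bar> \<le> 1" and
    H_add: "\<forall>c d s. H (\<lambda>r. c r + d r) s = H c s + H d s" and
    H_scale: "\<forall>a c s. H (\<lambda>r. a * c r) s = a * H c s" and
    H_norm: "\<forall>c. \<nu> n (H c) \<le> (1 + \<eta>) / \<delta> * \<nu> n c" and
    H_cong: "\<forall>c d. (\<forall>r\<in>rects n. c r = d r) \<longrightarrow> (\<forall>s\<in>rects n. H c s = H d s)" and
    H_inverse: "\<forall>c. \<forall>s\<in>rects n. H (compress m \<psi> (matrix_c (m + n) t (expand m \<phi> c))) s = c s"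
    using coefficient_factorization[OF norm(1)[of n] pos(2,1,3) size_estimate[OF pos(2,1,3) N[unfolded m]]
      bound' diag' block(1)[of m] block(2)[of m]]
    by (elim exE conjE) (rule that)
  have \<phi>: "\<bar>\<phi> q\<bar> \<le> 1" and \<psi>: "\<bar>\<psi> q\<bar> \<le> 1" for q
    using signs by (simp_all only: simp_thms)
  define E where "E f = synth N (expand m \<phi> (coeff n f))" for f
  \<comment> \<open>The whole correction by H is placed in F; E stays a contraction and the constant
    is the norm bound of F.\<close>
  define F where "F g = synth n (H (compress m \<psi> (coeff N g)))" for g
  have normV_coeff: "normV k f = \<nu> k (coeff k f)" if "f \<in> haar_space k" for k f
    using normV[of k "coeff k f"] synth_coeff[OF that] by simp
  have E_norm: "normV N (E f) \<le> normV n f" if "f \<in> haar_space n" for f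
    unfolding E_def normV normV_coeff[OF that] m by (rule expand[OF \<phi>])
  have F_norm: "normV n (F g) \<le> (1 + \<eta>) / \<delta> * normV N g" if "g \<in> haar_space N" for g
  proof -
    have "normV n (F g) \<le> (1 + \<eta>) / \<delta> * \<nu> n (compress m \<psi> (coeff N g))"
      unfolding F_def normV by (rule H_norm[rule_format])
    also have "\<dots> \<le> (1 + \<eta>) / \<delta> * \<nu> N (coeff N g)"
      unfolding m using pos by (intro mult_left_mono compress[OF \<psi>]) auto
    finally show ?thesis
      by (simp add: normV_coeff[OF that])
  qed
  have expand_add: "expand m \<phi> (\<lambda>r. c r + d r) = (\<lambda>q. expand m \<phi> c q + expand m \<phi> d q)"
    and expand_scale: "expand m \<phi> (\<lambda>r. a * c r) = (\<lambda>q. a * expand m \<phi> c q)" for a c d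
    by (auto simp: expand_def algebra_simps)
  have compress_add: "compress m \<psi> (\<lambda>r. c r + d r) = (\<lambda>q. compress m \<psi> c q + compress m \<psi> d q)"
    and compress_scale: "compress m \<psi> (\<lambda>r. a * c r) = (\<lambda>q. a * compress m \<psi> c q)" for a c d
    by (auto simp: compress_def distrib_left sum.distrib add_divide_distrib sum_distrib_left mult.left_commute)
  have H_add': "H (\<lambda>r. c r + d r) = (\<lambda>s. H c s + H d s)" and H_scale': "H (\<lambda>r. a * c r) = (\<lambda>s. a * H c s)" for a c d
    by (rule ext, simp only: H_add H_scale)+
  have E: "linear_between (haar_space n) (haar_space N) E"
    unfolding linear_between_def E_def by (simp add: coeff_add coeff_scale expand_add expand_scale synth_add synth_scale)
  have F: "linear_between (haar_space N) (haar_space n) F"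
    unfolding linear_between_def F_def
    by (simp add: coeff_add coeff_scale compress_add compress_scale H_add' H_scale' synth_add synth_scale)
  have FTE: "F (T (E f)) = f" if f: "f \<in> haar_space n" for f
  proof -
    have "F (T (E f)) = synth n (H (compress m \<psi> (coeff N (synth N (matrix_c N t (expand m \<phi> (coeff n f)))))))"
      by (simp add: F_def E_def T_synth)
    also have "\<dots> = synth n (coeff n f)"
    proof (rule synth_cong)
      fix s assume s: "s \<in> rects n"
      have "H (compress m \<psi> (coeff N (synth N (matrix_c N t (expand m \<phi> (coeff n f)))))) s
          = H (compress m \<psi> (matrix_c N t (expand m \<phi> (coeff n f)))) s"
        using copy2_in_rects[of _ n _ m]
        by (intro H_cong[rule_format] s) (simp add: compress_def coeff_synth m)
      then show "H (compress m \<psi> (coeff N (synth N (matrix_c N t (expand m \<phi> (coeff n f)))))) s = coeff n f s"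
        using H_inverse[rule_format, OF s] by (simp add: m)
    qed
    finally show ?thesis
      by (simp add: synth_coeff[OF f])
  qed
  have zero: "normV k 0 \<le> 1" for k
  proof -
    have "synth k (\<lambda>r. 0) = 0"
      by (simp add: synth_def)
    then show ?thesis
      using normV[of k "\<lambda>r. 0"] by simp
  qed
  have ratio: "0 \<le> (1 + \<eta>) / \<delta>"
    using pos by simp
  have F_le: "normV n (F g) \<le> (1 + \<eta>) / \<delta>" if "g \<in> haar_space N" "normV N g \<le> 1" for g
    using F_norm[OF that(1)] mult_left_mono[OF that(2) ratio] by simp
  have E_op: "op_norm (haar_space n) (normV n) (normV N) E \<le> 1"
    using E_norm order_trans by (intro op_norm_least zero) blast
  have F_op: "op_norm (haar_space N) (normV N) (normV n) F \<le> (1 + \<eta>) / \<delta>"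
    using F_le by (intro op_norm_least zero)
  have F_nonneg: "0 \<le> op_norm (haar_space N) (normV N) (normV n) F"
    using F_le by (intro op_norm_nonneg[where B = "(1 + \<eta>) / \<delta>"] zero) (auto simp: F_def normV)
  have "op_norm (haar_space n) (normV n) (normV N) E * op_norm (haar_space N) (normV N) (normV n) F
      \<le> 1 * ((1 + \<eta>) / \<delta>)"
    using E_op F_op F_nonneg by (intro mult_mono) auto
  moreover have "bounded_between (haar_space n) (normV n) (normV N) E"
    unfolding bounded_between_def using E_norm by (intro exI[of _ 1]) simp
  moreover have "bounded_between (haar_space N) (normV N) (normV n) F"
    unfolding bounded_between_def using F_norm by blast
  ultimately show ?thesis
    using E F FTE by (intro exI[of _ E] exI[of _ F]) simp
qed

lemma block_bound_hardy:
  assumes "1 \<le> p" "1 \<le> q"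
  shows "block_bound m n (hardy_c p q (m + n)) (1 / p) (1 / q)"
  unfolding block_bound_def
  using hardy_c_block[OF assms] lattice_norm.nonneg[OF lattice_norm_hardy_c[OF assms]] by blast

lemma block_bound_dual:
  assumes "1 \<le> p" "1 \<le> q"
  shows "block_bound m n (dual_c p q (m + n)) (1 - 1 / p) (1 - 1 / q)"
  unfolding block_bound_def
  using dual_c_block[OF assms] lattice_norm.nonneg[OF lattice_norm_dual_c[OF assms]] by blast

theorem theorem3p1:
  fixes p q \<delta> \<Gamma> \<eta> :: real
    and n N :: nat
    and normV :: "nat \<Rightarrow> (real \<times> real \<Rightarrow> real) \<Rightarrow> real"
    and T :: "(real \<times> real \<Rightarrow> real) \<Rightarrow> (real \<times> real \<Rightarrow> real)"
  assumes "1 \<le> p" and "1 \<le> q"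
    and "normV = (\<lambda>k. hardy_norm p q) \<or> normV = (\<lambda>k. hardy_dual_norm p q k)"
    and "\<delta> > 0" and "\<Gamma> > 0" and "\<eta> > 0"
    and "int N = 41 * (int n + 3) + \<lfloor>4 * log 2 (\<Gamma> / \<delta>) + 4 * log 2 (1 + 1 / \<eta>)\<rfloor>"
    and "linear_between (haar_space N) (haar_space N) T"
    and "op_norm (haar_space N) (normV N) (normV N) T \<le> \<Gamma>"
    and "\<forall>Q \<in> dyadic_upto N \<times> dyadic_upto N. \<bar>pairing (T (haar2 Q)) (haar2 Q)\<bar> \<ge> \<delta> * rect_area Q"
  shows "\<exists>E F.
           linear_between (haar_space n) (haar_space N) E \<and>
           bounded_between (haar_space n) (normV n) (normV N) E \<and>
           linear_between (haar_space N) (haar_space n) F \<and>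
           bounded_between (haar_space N) (normV N) (normV n) F \<and>
           (\<forall>f \<in> haar_space n. F (T (E f)) = f) \<and>
           op_norm (haar_space n) (normV n) (normV N) E *
             op_norm (haar_space N) (normV N) (normV n) F \<le> (1 + \<eta>) / \<delta>"
proof (cases "normV = (\<lambda>k. hardy_norm p q)")
  case True
  note pq = assms(1,2)
  show ?thesis
  proof (rule factorization[where normV = normV and N = N and n = n and T = T and
        \<nu> = "hardy_c p q" and \<nu>' = "dual_c p q" and \<alpha> = "1 / p" and \<beta> = "1 / q",
        OF assms(4-10) lattice_norm_hardy_c[OF pq] lattice_norm_dual_c[OF pq]])
    show "normV k (synth k c) = hardy_c p q k c" for k c
      by (simp add: True hardy_norm_synth[OF pq])
    show "\<bar>pair_c k c d\<bar> \<le> hardy_c p q k c * dual_c p q k d" for k c d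
      using pair_c_le_dual[OF pq, of k d c] by (simp add: pair_c_commute[of k d c] mult.commute)
  qed (use expand_contractive[OF pq] compress_contractive[OF pq] block_bound_hardy[OF pq] block_bound_dual[OF pq] in auto)
next
  case False
  then have normV: "normV = (\<lambda>k. hardy_dual_norm p q k)"
    using assms(3) by blast
  note pq = assms(1,2)
  show ?thesis
  \<comment> \<open>The exponents are those of blocks in the dual norm; their complements 1/p and
    1/q are the ones for the Hardy norm, which now measures the test families.\<close>
  proof (rule factorization[where normV = normV and N = N and n = n and T = T and
        \<nu> = "dual_c p q" and \<nu>' = "hardy_c p q" and \<alpha> = "1 - 1 / p" and \<beta> = "1 - 1 / q",
        OF assms(4-10) lattice_norm_dual_c[OF pq] lattice_norm_hardy_c[OF pq]])
    show "normV k (synth k c) = dual_c p q k c" for k c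
      by (simp add: normV hardy_dual_norm_synth[OF pq])
    show "\<bar>pair_c k c d\<bar> \<le> dual_c p q k c * hardy_c p q k d" for k c d
      by (rule pair_c_le_dual[OF pq])
  qed (use expand_contractive_dual[OF pq] compress_contractive_dual[OF pq] block_bound_hardy[OF pq] block_bound_dual[OF pq] in auto)
qed

end
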